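(* Let $\ell>0$, $0<\sigma<1$, $\Omega=(0,\pi)\times(-\ell,\ell)$. Let $\alpha\ge 0$ with $\alpha\notin\{1,2,3,\dots\}$, let $g\in L^2(0,\pi)$ be not identically zero, with sine expansion $g(x)=\sum_{m=1}^{\infty}\gamma_m\sin(mx)$, $\gamma_m=\frac{2}{\pi}\int_0^\pi g(x)\sin(mx)\,dx$, and let $f(x,y)=K_\alpha e^{\alpha y}g(x)$ with $K_\alpha=\frac{\alpha}{2\sinh(\alpha\ell)\int_0^\pi|g(x)|\,dx}$ (for $\alpha=0$ this is understood as the limit value $K_0=\frac{1}{2\ell\int_0^\pi|g(x)|\,dx}$). Then the unique solution $u$ of the partially hinged plate problem with load $f$, $$\begin{cases}\Delta^2u=f & \text{in }\Omega\\ u(0,y)=u_{xx}(0,y)=u(\pi,y)=u_{xx}(\pi,y)=0 & y\in(-\ell,\ell)\\ u_{yy}(x,\pm\ell)+\sigma u_{xx}(x,\pm\ell)=u_{yyy}(x,\pm\ell)+(2-\sigma)u_{xxy}(x,\pm\ell)=0 & x\in(0,\pi),\end{cases}$$ is given by $$u(x,y)=K_\alpha\sum_{m=1}^{\infty}\left[\frac{\gamma_m e^{\alpha y}}{(m^2-\alpha^2)^2}+A_m\cosh(my)+B_m\sinh(my)+C_m\,y\cosh(my)+D_m\,y\sinh(my)\right]\sin(mx),$$ where, for each $m\ge1$, the constants $A_m,D_m$ (depending on $m,\ell,\alpha,\sigma,\gamma_m$) are the solution of $$\begin{cases}(1-\sigma)m^2\cosh(m\ell)\,A_m+m\,[2\cosh(m\ell)+(1-\sigma)m\ell\sinh(m\ell)]\,D_m=\gamma_m\frac{\sigma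 m^2-\alpha^2}{(m^2-\alpha^2)^2}\cosh(\alpha\ell)\\ (\sigma-1)m^3\sinh(m\ell)\,A_m+m^2[(1+\sigma)\sinh(m\ell)+(\sigma-1)m\ell\cosh(m\ell)]\,D_m=\alpha\gamma_m\frac{(2-\sigma)m^2-\alpha^2}{(m^2-\alpha^2)^2}\sinh(\alpha\ell)\end{cases}$$ and the constants $B_m,C_m$ are the solution of $$\begin{cases}(1-\sigma)m^2\sinh(m\ell)\,B_m+m\,[2\sinh(m\ell)+(1-\sigma)m\ell\cosh(m\ell)]\,C_m=\gamma_m\frac{\sigma m^2-\alpha^2}{(m^2-\alpha^2)^2}\sinh(\alpha\ell)\\ (\sigma-1)m^3\cosh(m\ell)\,B_m+m^2[(1+\sigma)\cosh(m\ell)+(\sigma-1)m\ell\sinh(m\ell)]\,C_m=\alpha\gamma_m\frac{(2-\sigma)m^2-\alpha^2}{(m^2-\alpha^2)^2}\cosh(\alpha\ell).\end{cases}$$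
   Context: Let $H^2_*=\{w\in H^2(\Omega): w=0 \text{ on }\{0,\pi\}\times(-\ell,\ell)\}$ (the condition is meant pointwise, since $H^2(\Omega)\subset C^0(\overline\Omega)$), a Hilbert space with scalar product $$(u,v)_{H^2_*}=\int_\Omega\left[\Delta u\,\Delta v+(1-\sigma)(2u_{xy}v_{xy}-u_{xx}v_{yy}-u_{yy}v_{xx})\right]dx\,dy,$$ whose norm is equivalent to the usual $H^2(\Omega)$ norm. For $f\in L^2(\Omega)$, the solution of the plate problem is the unique $u\in H^2_*$ with $(u,v)_{H^2_*}=\int_\Omega fv\,dx\,dy$ for all $v\in H^2_*$; it belongs to $H^4(\Omega)$ and is a strong solution of the boundary value problem. *)

theory Defs
  imports "HOL-Analysis.Analysis"
begin

definition L2 :: "'a::euclidean_space set \<Rightarrow> ('a \<Rightarrow> real) set" where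
  "L2 S = {f \<in> borel_measurable (lebesgue_on S). integrable (lebesgue_on S) (\<lambda>z. (f z)\<^sup>2)}"

definition partial_x :: "(real \<times> real \<Rightarrow> real) \<Rightarrow> real \<times> real \<Rightarrow> real" where
  "partial_x f z = frechet_derivative f (at z) (1, 0)"

definition partial_y :: "(real \<times> real \<Rightarrow> real) \<Rightarrow> real \<times> real \<Rightarrow> real" where
  "partial_y f z = frechet_derivative f (at z) (0, 1)"

fun C_diff :: "nat \<Rightarrow> (real \<times> real \<Rightarrow> real) \<Rightarrow> bool" where
  "C_diff 0 f \<longleftrightarrow> continuous_on UNIV f"
| "C_diff (Suc k) f \<longleftrightarrow>
     (\<forall>z. f differentiable (at z)) \<and> C_diff k (partial_x f) \<and> C_diff k (partial_y f)"

definition test_functions :: "(real \<times> real) set \<Rightarrow> (real \<times> real \<Rightarrow> real) set" where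
  "test_functions S = {\<phi>. (\<forall>k. C_diff k \<phi>) \<and>
     compact (closure {z. \<phi> z \<noteq> 0}) \<and> closure {z. \<phi> z \<noteq> 0} \<subseteq> S}"

definition has_weak_derivative ::
    "(real \<times> real) set \<Rightarrow> nat \<Rightarrow> nat \<Rightarrow> (real \<times> real \<Rightarrow> real) \<Rightarrow> (real \<times> real \<Rightarrow> real) \<Rightarrow> bool" where
  "has_weak_derivative S i j u w \<longleftrightarrow> (\<forall>\<phi>\<in>test_functions S.
     (LINT z|lebesgue_on S. u z * (partial_x ^^ i) ((partial_y ^^ j) \<phi>) z) =
     (-1) ^ (i + j) * (LINT z|lebesgue_on S. w z * \<phi> z))"

definition H2 :: "(real \<times> real) set \<Rightarrow> (real \<times> real \<Rightarrow> real) set" where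
  "H2 S = {u \<in> L2 S. \<forall>i j. i + j \<le> 2 \<longrightarrow> (\<exists>w\<in>L2 S. has_weak_derivative S i j u w)}"

text \<open>Weak derivatives on an open set are unique only up to null sets; an arbitrary
  representative is chosen. It is used below under an integral only.\<close>

definition weak_derivative ::
    "(real \<times> real) set \<Rightarrow> nat \<Rightarrow> nat \<Rightarrow> (real \<times> real \<Rightarrow> real) \<Rightarrow> real \<times> real \<Rightarrow> real" where
  "weak_derivative S i j u = (SOME w. w \<in> L2 S \<and> has_weak_derivative S i j u w)"

definition plate :: "real \<Rightarrow> (real \<times> real) set" where
  "plate l = {0<..<pi} \<times> {-l<..<l}"

text \<open>An element of the Sobolev space is represented by its continuous version on the closed
  rectangle, which makes the pointwise boundary condition meaningful. The values of such a
  function outside the closed rectangle are arbitrary.\<close>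

definition H2_star :: "real \<Rightarrow> (real \<times> real \<Rightarrow> real) set" where
  "H2_star l = {w \<in> H2 (plate l). continuous_on (closure (plate l)) w \<and>
     (\<forall>z \<in> {0, pi} \<times> {-l<..<l}. w z = 0)}"

definition H2_star_inner ::
    "real \<Rightarrow> real \<Rightarrow> (real \<times> real \<Rightarrow> real) \<Rightarrow> (real \<times> real \<Rightarrow> real) \<Rightarrow> real" where
  "H2_star_inner l \<sigma> u v =
     (let uxx = weak_derivative (plate l) 2 0 u; vxx = weak_derivative (plate l) 2 0 v;
          uxy = weak_derivative (plate l) 1 1 u; vxy = weak_derivative (plate l) 1 1 v;
          uyy = weak_derivative (plate l) 0 2 u; vyy = weak_derivative (plate l) 0 2 v
      in LINT z|lebesgue_on (plate l).
           (uxx z + uyy z) * (vxx z + vyy z) +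
           (1 - \<sigma>) * (2 * uxy z * vxy z - uxx z * vyy z - uyy z * vxx z))"

text \<open>The solution of the partially hinged plate problem
  \[ \Delta^2 u = f \mbox{ in } \Omega, \quad u = u_{xx} = 0 \mbox{ for } x \in \{0, \pi\}, \quad
     u_{yy} + \sigma u_{xx} = u_{yyy} + (2 - \sigma) u_{xxy} = 0 \mbox{ for } y = \pm l \]
  is understood in the variational sense. The condition that \<open>u\<close> vanishes for
  \<open>x \<in> {0, pi}\<close> is part of the space; the other boundary conditions are the natural ones of
  the bilinear form.\<close>

definition plate_solution ::
    "real \<Rightarrow> real \<Rightarrow> (real \<times> real \<Rightarrow> real) \<Rightarrow> (real \<times> real \<Rightarrow> real) \<Rightarrow> bool" where
  "plate_solution l \<sigma> f u \<longleftrightarrow> u \<in> H2_star l \<and>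
     (\<forall>v\<in>H2_star l. H2_star_inner l \<sigma> u v = (LINT z|lebesgue_on (plate l). f z * v z))"

definition sine_coeff :: "(real \<Rightarrow> real) \<Rightarrow> nat \<Rightarrow> real" where
  "sine_coeff g m = 2 / pi * (LINT x|lebesgue_on {0<..<pi}. g x * sin (real m * x))"

text \<open>The value at \<open>\<alpha> = 0\<close> is the limit of the generic formula.\<close>

definition load_const :: "real \<Rightarrow> real \<Rightarrow> (real \<Rightarrow> real) \<Rightarrow> real" where
  "load_const l \<alpha> g =
     (if \<alpha> = 0 then 1 / (2 * l * (LINT x|lebesgue_on {0<..<pi}. \<bar>g x\<bar>))
      else \<alpha> / (2 * sinh (\<alpha> * l) * (LINT x|lebesgue_on {0<..<pi}. \<bar>g x\<bar>)))"

definition load :: "real \<Rightarrow> real \<Rightarrow> (real \<Rightarrow> real) \<Rightarrow> real \<times> real \<Rightarrow> real" where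
  "load l \<alpha> g = (\<lambda>(x, y). load_const l \<alpha> g * exp (\<alpha> * y) * g x)"

definition system_AD ::
    "real \<Rightarrow> real \<Rightarrow> real \<Rightarrow> (nat \<Rightarrow> real) \<Rightarrow> nat \<Rightarrow> real \<Rightarrow> real \<Rightarrow> bool" where
  "system_AD l \<sigma> \<alpha> \<gamma> k a d \<longleftrightarrow> (let m = real k in
     (1 - \<sigma>) * m^2 * cosh (m * l) * a
       + m * (2 * cosh (m * l) + (1 - \<sigma>) * m * l * sinh (m * l)) * d
     = \<gamma> k * ((\<sigma> * m^2 - \<alpha>^2) / (m^2 - \<alpha>^2)^2) * cosh (\<alpha> * l) \<and>
     (\<sigma> - 1) * m^3 * sinh (m * l) * a
       + m^2 * ((1 + \<sigma>) * sinh (m * l) + (\<sigma> - 1) * m * l * cosh (m * l)) * d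
     = \<alpha> * \<gamma> k * (((2 - \<sigma>) * m^2 - \<alpha>^2) / (m^2 - \<alpha>^2)^2) * sinh (\<alpha> * l))"

definition system_BC ::
    "real \<Rightarrow> real \<Rightarrow> real \<Rightarrow> (nat \<Rightarrow> real) \<Rightarrow> nat \<Rightarrow> real \<Rightarrow> real \<Rightarrow> bool" where
  "system_BC l \<sigma> \<alpha> \<gamma> k b c \<longleftrightarrow> (let m = real k in
     (1 - \<sigma>) * m^2 * sinh (m * l) * b
       + m * (2 * sinh (m * l) + (1 - \<sigma>) * m * l * cosh (m * l)) * c
     = \<gamma> k * ((\<sigma> * m^2 - \<alpha>^2) / (m^2 - \<alpha>^2)^2) * sinh (\<alpha> * l) \<and>
     (\<sigma> - 1) * m^3 * cosh (m * l) * b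
       + m^2 * ((1 + \<sigma>) * cosh (m * l) + (\<sigma> - 1) * m * l * sinh (m * l)) * c
     = \<alpha> * \<gamma> k * (((2 - \<sigma>) * m^2 - \<alpha>^2) / (m^2 - \<alpha>^2)^2) * cosh (\<alpha> * l))"

definition series_term ::
    "real \<Rightarrow> (nat \<Rightarrow> real) \<Rightarrow> (nat \<Rightarrow> real) \<Rightarrow> (nat \<Rightarrow> real) \<Rightarrow> (nat \<Rightarrow> real) \<Rightarrow> (nat \<Rightarrow> real) \<Rightarrow>
     real \<Rightarrow> real \<Rightarrow> nat \<Rightarrow> real" where
  "series_term \<alpha> \<gamma> A B C D x y k = (let m = real k in
     (\<gamma> k * exp (\<alpha> * y) / (m^2 - \<alpha>^2)^2
       + A k * cosh (m * y) + B k * sinh (m * y)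
       + C k * y * cosh (m * y) + D k * y * sinh (m * y)) * sin (m * x))"

end

theory Submission
  imports Defs
begin

text \<open>A mode $\varphi(y) \sin (m x)$ satisfies the variational equation with the load
  $(\varphi^{(4)} - 2 m^2 \varphi^{(2)} + m^4 \varphi) \sin (m x)$ as soon as $\varphi$ satisfies the natural
  boundary conditions. Since the competitors $v$ only have weak second derivatives inside the plate,
  this is obtained without traces, by testing the weak derivatives with products of cutoffs and
  using no more than the uniform continuity of $v$ on the closed rectangle. The modes can be summed
  because the sine coefficients of $g$ are square summable, and the loads of the partial sums
  converge to $f$ weakly, because the functions $\sin (i x) e^{k y}$ span a dense set by the
  Stone--Weierstrass theorem. Uniqueness follows from the symmetry of the bilinear form: two
  solutions have the same integrals against the loads of all explicitly solvable single modes, and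
  these loads are again complete.\<close>

subsection \<open>Smooth functions of one variable\<close>

text \<open>A competitor \<open>v\<close> has no usable derivatives on the edges, so boundary terms
  must be controlled by scaling alone. A cutoff at distance 1/n from an edge has derivatives of size
  n and n^2 on a strip of area of order 1/n. A kernel of size n therefore has bounded mass there,
  and its integral against a continuous function tends to 0 once that function vanishes on the edge.
  In x this is the hinge condition on \<open>v\<close>; in y an interpolant has to be subtracted
  first. The products of sin (i x) and e^(k y) do not form an algebra, so Stone--Weierstrass is
  applied to multipliers: the algebra generated by cos x and e^y maps the span of the products into
  itself, and sin x times this algebra approximates every continuous function vanishing on the
  hinged sides. Orthogonality to the first n sines survives such a multiplication up to a fixed loss
  of order, which is all that the weak convergence of the loads requires. The test loads for
  uniqueness have exponents k + 1/2, since an integer exponent could equal the frequency i; the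
  shift by 1/2 is absorbed into the positive factor e^(y/2).\<close>

primrec Ck :: "nat \<Rightarrow> (real \<Rightarrow> real) \<Rightarrow> bool" where
  "Ck 0 f \<longleftrightarrow> continuous_on UNIV f"
| "Ck (Suc k) f \<longleftrightarrow> (\<exists>f'. (\<forall>x. (f has_real_derivative f' x) (at x)) \<and> Ck k f')"

definition smooth :: "(real \<Rightarrow> real) \<Rightarrow> bool" where
  "smooth f \<longleftrightarrow> (\<forall>k. Ck k f)"

lemma Ck_SucI:
  "(\<And>x. (f has_real_derivative f' x) (at x)) \<Longrightarrow> Ck k f' \<Longrightarrow> Ck (Suc k) f"
  by auto

lemma Ck_Suc_imp: "Ck (Suc k) f \<Longrightarrow> Ck k f"
proof (induction k arbitrary: f)
  case 0
  then show ?case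
    by (auto intro!: continuous_at_imp_continuous_on intro: DERIV_isCont)
next
  case (Suc k)
  then show ?case by (metis Ck.simps(2))
qed

lemma smooth_DERIV: assumes "smooth f" shows "(f has_real_derivative deriv f x) (at x)"
proof -
  have "Ck (Suc 0) f" using assms unfolding smooth_def by blast
  then obtain f' where "(f has_real_derivative f' x) (at x)" by auto
  then show ?thesis using DERIV_imp_deriv by metis
qed

lemma smooth_deriv: assumes "smooth f" shows "smooth (deriv f)"
  unfolding smooth_def
proof
  fix k
  obtain f' where "\<forall>x. (f has_real_derivative f' x) (at x)" "Ck k f'"
    using assms Ck.simps(2)[of k f] unfolding smooth_def by blast
  moreover from this have "f' = deriv f" by (intro ext DERIV_imp_deriv[symmetric]) simp
  ultimately show "Ck k (deriv f)" by simp
qed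

lemma smooth_continuous_on: "smooth f \<Longrightarrow> continuous_on S f"
  unfolding smooth_def using Ck.simps(1) continuous_on_subset by blast

lemma smoothI_DERIV:
  assumes "\<And>x. (f has_real_derivative f' x) (at x)" "smooth f'"
  shows "smooth f"
  unfolding smooth_def
proof
  show "Ck k f" for k
    using assms Ck_Suc_imp[OF Ck_SucI] unfolding smooth_def by blast
qed

lemma Ck_const: "Ck k (\<lambda>x. c)"
proof (induction k arbitrary: c)
  case (Suc k)
  then show ?case by (auto intro!: exI[of _ "\<lambda>x. 0"])
qed auto

lemma Ck_add: "Ck k f \<Longrightarrow> Ck k g \<Longrightarrow> Ck k (\<lambda>x. f x + g x)"
proof (induction k arbitrary: f g)
  case 0
  then show ?case by (auto intro!: continuous_intros)
next
  case (Suc k)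
  then obtain f' g' where "\<forall>x. (f has_real_derivative f' x) (at x)" "Ck k f'"
    "\<forall>x. (g has_real_derivative g' x) (at x)" "Ck k g'"
    by auto
  then show ?case using Suc.IH[of f' g']
    by (auto intro!: exI[of _ "\<lambda>x. f' x + g' x"] DERIV_add)
qed

lemma Ck_mult: "Ck k f \<Longrightarrow> Ck k g \<Longrightarrow> Ck k (\<lambda>x. f x * g x)"
proof (induction k arbitrary: f g)
  case 0
  then show ?case by (auto intro!: continuous_intros)
next
  case (Suc k)
  then obtain f' g' where D: "\<forall>x. (f has_real_derivative f' x) (at x)" "Ck k f'"
    "\<forall>x. (g has_real_derivative g' x) (at x)" "Ck k g'"
    by auto
  have "Ck k f" "Ck k g" using Suc.prems Ck_Suc_imp by blast+
  then have "Ck k (\<lambda>x. f' x * g x + g' x * f x)"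
    using D Suc.IH by (intro Ck_add) auto
  moreover have "((\<lambda>x. f x * g x) has_real_derivative f' x * g x + g' x * f x) (at x)" for x
    using D by (auto intro!: DERIV_mult)
  ultimately show ?case by (auto intro!: exI[of _ "\<lambda>x. f' x * g x + g' x * f x"])
qed

lemma smooth_const [simp]: "smooth (\<lambda>x. c)"
  by (simp add: smooth_def Ck_const)

lemma smooth_add: "smooth f \<Longrightarrow> smooth g \<Longrightarrow> smooth (\<lambda>x. f x + g x)"
  by (simp add: smooth_def Ck_add)

lemma smooth_mult: "smooth f \<Longrightarrow> smooth g \<Longrightarrow> smooth (\<lambda>x. f x * g x)"
  by (simp add: smooth_def Ck_mult)

lemma smooth_ident: "smooth (\<lambda>x. x)"
  by (rule smoothI_DERIV[of _ "\<lambda>x. 1"]) auto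

lemma smooth_exp: "smooth (\<lambda>x. exp (a * x))"
proof -
  \<comment> \<open>The multiples of the exponential are closed under differentiation, so the
    constant \<open>c\<close> is generalised in the induction.\<close>
  have "Ck k (\<lambda>x. c * exp (a * x))" for k c
  proof (induction k arbitrary: c)
    case 0
    then show ?case by (auto intro!: continuous_intros)
  next
    case (Suc k)
    have "((\<lambda>x. c * exp (a * x)) has_real_derivative c * a * exp (a * x)) (at x)" for x
      by (auto intro!: derivative_eq_intros)
    then show ?case by (rule Ck_SucI) (rule Suc)
  qed
  from this[of _ 1] show ?thesis by (simp add: smooth_def)
qed

lemma smooth_sin_cos: "smooth (\<lambda>x. sin (a * x))" "smooth (\<lambda>x. cos (a * x))"
proof -
  have "Ck k (\<lambda>x. c * sin (a * x) + d * cos (a * x))" for k c d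
  proof (induction k arbitrary: c d)
    case 0
    then show ?case by (auto intro!: continuous_intros)
  next
    case (Suc k)
    have "((\<lambda>x. c * sin (a * x) + d * cos (a * x)) has_real_derivative
       (- d * a) * sin (a * x) + (c * a) * cos (a * x)) (at x)" for x
      by (auto intro!: derivative_eq_intros)
    then show ?case by (rule Ck_SucI) (rule Suc)
  qed
  from this[of _ 1 0] this[of _ 0 1]
  show "smooth (\<lambda>x. sin (a * x))" "smooth (\<lambda>x. cos (a * x))" by (simp_all add: smooth_def)
qed

lemma smooth_cosh_sinh: "smooth (\<lambda>x. cosh (a * x))" "smooth (\<lambda>x. sinh (a * x))"
proof -
  have "(\<lambda>x. cosh (a * x)) = (\<lambda>x. (1/2) * exp (a * x) + (1/2) * exp ((-a) * x))"
    "(\<lambda>x. sinh (a * x)) = (\<lambda>x. (1/2) * exp (a * x) + (-1/2) * exp ((-a) * x))"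
    by (auto simp: cosh_def sinh_def)
  moreover have "smooth (\<lambda>x. c * exp (a * x) + d * exp ((-a) * x))" for c d
    by (intro smooth_add smooth_mult smooth_const smooth_exp)
  ultimately show "smooth (\<lambda>x. cosh (a * x))" "smooth (\<lambda>x. sinh (a * x))"
    by (simp_all only:)
qed

lemma smooth_affine:
  assumes "smooth f" shows "smooth (\<lambda>x. f (a * x + b))"
proof -
  have "Ck k f \<Longrightarrow> Ck k (\<lambda>x. f (a * x + b))" for k and f :: "real \<Rightarrow> real"
  proof (induction k arbitrary: f)
    case 0
    then show ?case by (auto intro!: continuous_intros continuous_on_compose2[of UNIV f])
  next
    case (Suc k)
    then obtain f' where D: "\<And>x. (f has_real_derivative f' x) (at x)" "Ck k f'" by auto
    have "((\<lambda>x. f (a * x + b)) has_real_derivative f' (a * x + b) * a) (at x)" for x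
      by (rule DERIV_chain2[OF D(1)]) (auto intro!: derivative_eq_intros)
    moreover have "Ck k (\<lambda>x. f' (a * x + b) * a)"
      using Suc.IH[OF D(2)] by (intro Ck_mult Ck_const)
    ultimately show ?case by (rule Ck_SucI)
  qed
  then show ?thesis using assms by (simp add: smooth_def)
qed

text \<open>The derivatives of the flat function \<open>x \<mapsto> exp (- 1 / x)\<close> stay in the family of its products
  with polynomials in \<open>1 / x\<close>.\<close>

definition flat :: "real poly \<Rightarrow> real \<Rightarrow> real" where
  "flat p x = (if x \<le> 0 then 0 else poly p (1 / x) * exp (- (1 / x)))"

text \<open>The substitution t = 1/x reduces this to the decay of t^n exp (- t) at infinity, summed
  over the monomials of \<open>p\<close>.\<close>

lemma flat_limit: "((\<lambda>x. poly p (1 / x) * exp (- (1 / x))) \<longlongrightarrow> 0) (at_right (0::real))"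
proof -
  have "((\<lambda>x::real. poly p x * exp (- x)) \<longlongrightarrow> 0) at_top"
  proof (induction p)
    case 0
    then show ?case by simp
  next
    case (pCons a p)
    have *: "((\<lambda>x::real. x ^ n * exp (- x)) \<longlongrightarrow> 0) at_top" for n
      using tendsto_power_div_exp_0[of n] by (simp add: exp_minus divide_inverse)
    have "((\<lambda>x. \<Sum>i\<le>degree (pCons a p). coeff (pCons a p) i * (x ^ i * exp (- x))) \<longlongrightarrow>
        (\<Sum>i\<le>degree (pCons a p). coeff (pCons a p) i * 0)) at_top"
      by (intro tendsto_sum tendsto_mult_left *)
    then show ?case
      by (simp only: poly_altdef sum_distrib_right mult.assoc mult_zero_right sum.neutral_const)
  qed
  moreover have "filterlim (\<lambda>x::real. 1 / x) at_top (at_right 0)"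
    using filterlim_inverse_at_top_right by (simp add: divide_inverse)
  ultimately show ?thesis by (rule filterlim_compose)
qed

text \<open>For x > 0 the inner derivative contributes 1/x^2, the value of \<open>[:0,0,1:]\<close>
  at 1/x, while the polynomial and the exponential together contribute \<open>p - pderiv p\<close>.
  At 0 the right difference quotient is again of the flat form, with polynomial t p(t), so
  \<open>flat_limit\<close> applies to it.\<close>

lemma flat_DERIV: "(flat p has_real_derivative flat ([:0,0,1:] * (p - pderiv p)) x) (at x)"
proof -
  consider "x < 0" | "x > 0" | "x = 0" by linarith
  then show ?thesis
  proof cases
    case 1
    have "((\<lambda>x. 0) has_real_derivative 0) (at x)" by simp
    then have "(flat p has_real_derivative 0) (at x)"
      by (rule has_field_derivative_transform_within_open[of _ _ _ "{..<0}"]) (use 1 in \<open>auto simp: flat_def\<close>)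
    then show ?thesis using 1 by (simp add: flat_def)
  next
    case 2
    have "((\<lambda>x. poly p (1 / x) * exp (- (1 / x))) has_real_derivative
        flat ([:0,0,1:] * (p - pderiv p)) x) (at x)"
      using 2 by (auto intro!: derivative_eq_intros DERIV_chain2[OF poly_DERIV]
          simp: flat_def field_simps power2_eq_square)
    then show ?thesis
      by (rule has_field_derivative_transform_within_open[of _ _ _ "{0<..}"]) (use 2 in \<open>auto simp: flat_def\<close>)
  next
    case 3
    have "((\<lambda>x. poly ([:0,1:] * p) (1 / x) * exp (- (1 / x))) \<longlongrightarrow> 0) (at_right (0::real))"
      by (rule flat_limit)
    moreover have "eventually (\<lambda>x. poly ([:0,1:] * p) (1 / x) * exp (- (1 / x)) = (flat p x - flat p 0) / (x - 0)) (at_right (0::real))"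
      by (auto simp: eventually_at_right_field flat_def intro!: exI[of _ 1])
    ultimately have "((\<lambda>x. (flat p x - flat p 0) / (x - 0)) \<longlongrightarrow> 0) (at_right (0::real))"
      using filterlim_cong[OF refl refl] by fast
    moreover have "((\<lambda>x. (flat p x - flat p 0) / (x - 0)) \<longlongrightarrow> 0) (at_left (0::real))"
    proof -
      have "eventually (\<lambda>x. 0 = (flat p x - flat p 0) / (x - 0)) (at_left (0::real))"
        by (auto simp: eventually_at_left_field flat_def intro!: exI[of _ "-1"])
      from filterlim_cong[OF refl refl this] show ?thesis by auto
    qed
    ultimately have "((\<lambda>x. (flat p x - flat p 0) / (x - 0)) \<longlongrightarrow> 0) (at (0::real))"
      using filterlim_split_at by blast
    then show ?thesis using 3 by (simp add: has_field_derivative_iff flat_def)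
  qed
qed

lemma smooth_flat: "smooth (flat p)"
proof -
  have "Ck k (flat p)" for k p
  proof (induction k arbitrary: p)
    case 0
    show ?case using flat_DERIV[of p] by (auto intro!: continuous_at_imp_continuous_on intro: DERIV_isCont)
  next
    case (Suc k)
    show ?case by (rule Ck_SucI[OF flat_DERIV Suc])
  qed
  then show ?thesis by (simp add: smooth_def)
qed

text \<open>The normalised integral of a bump. The rise takes place between 1 and 2, not from 0 on,
  so that the rescaled function t \<mapsto> \<theta> (n t) still vanishes on a margin of width 1/n;
  this gives the cutoffs compact support inside an open interval.\<close>

lemma smooth_step:
  obtains \<theta> :: "real \<Rightarrow> real" where "smooth \<theta>" "\<And>t. 0 \<le> \<theta> t" "\<And>t. \<theta> t \<le> 1"
    "\<And>t. t \<le> 1 \<Longrightarrow> \<theta> t = 0" "\<And>t. t \<ge> 2 \<Longrightarrow> \<theta> t = 1"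
proof -
  \<comment> \<open>One flat factor is positive to the right of 1, the other to the left of 2, so
    the bump is positive exactly on (1, 2).\<close>
  define b where "b = (\<lambda>t. flat [:1:] (1 * t + (-1)) * flat [:1:] ((-1) * t + 2))"
  have b_smooth: "smooth b" unfolding b_def
    by (intro smooth_mult smooth_affine smooth_flat)
  have b_nonneg: "b t \<ge> 0" for t by (simp add: b_def flat_def)
  have b_zero: "b t = 0" if "t \<le> 1 \<or> t \<ge> 2" for t using that by (auto simp: b_def flat_def)
  have b_pos: "b t > 0" if "1 < t" "t < 2" for t using that by (auto simp: b_def flat_def)
  have b_int: "b integrable_on {u..v}" for u v
    by (rule integrable_continuous_real) (rule smooth_continuous_on[OF b_smooth])
  define Z where "Z = integral {1..2} b"
  have "integral {1..2} b \<noteq> 0"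
  proof
    assume *: "integral {1..2} b = 0"
    have "(\<forall>x\<in>cbox 1 2. b x = 0)"
      using integral_cbox_eq_0_iff[of 1 2 b] * smooth_continuous_on[OF b_smooth] b_nonneg
      by (auto simp: box_real)
    then show False using b_pos[of "3/2"] by (auto simp: cbox_interval)
  qed
  moreover have "Z \<ge> 0" unfolding Z_def using b_nonneg by (intro integral_nonneg b_int) auto
  ultimately have Z: "Z > 0" unfolding Z_def by simp
  define \<theta> where "\<theta> = (\<lambda>t. (if t \<le> 1 then 0 else integral {1..t} b) / Z)"
  have D: "((\<lambda>t. if t \<le> 1 then 0 else integral {1..t} b) has_real_derivative b t) (at t)" for t
  proof -
    have eq: "(if t \<le> 1 then 0 else integral {1..t} b) = integral {a..t} b" if "a \<le> 1" "a \<le> t" for a t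
    proof (cases "t \<le> 1")
      case True
      then have "integral {a..t} b = integral {a..t} (\<lambda>x. 0)"
        by (intro integral_cong) (auto simp: b_zero)
      then show ?thesis using True by simp
    next
      case False
      have "integral {a..t} b = integral {a..1} b + integral {1..t} b"
        using Henstock_Kurzweil_Integration.integral_combine[of a 1 t b] that False b_int by auto
      moreover have "integral {a..1} b = integral {a..1} (\<lambda>x. 0)"
        by (intro integral_cong) (auto simp: b_zero)
      ultimately show ?thesis using False by simp
    qed
    \<comment> \<open>The fundamental theorem needs \<open>t\<close> in the interior of the interval
      of integration, also when t \<le> 1. Moving the lower limit to the left of both 1 and
      \<open>t\<close> changes nothing, because \<open>b\<close> vanishes there.\<close>
    define a where "a = min 0 (t - 1)"
    have a1: "a \<le> 1" by (simp add: a_def)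
    have "((\<lambda>u. integral {a..u} b) has_real_derivative b t) (at t within {a..t + 1})"
      by (rule integral_has_real_derivative) (auto simp: a_def smooth_continuous_on[OF b_smooth])
    then have "((\<lambda>u. integral {a..u} b) has_real_derivative b t) (at t)"
      by (subst (asm) at_within_interior) (auto simp: a_def interior_atLeastAtMost_real)
    then show ?thesis
      by (rule has_field_derivative_transform_within_open[of _ _ _ "{a<..}"])
        (use a1 eq in \<open>auto simp: a_def[symmetric]\<close>, simp add: a_def)
  qed
  have "((\<lambda>t. \<theta> t) has_real_derivative (1 / Z) * b t) (at t)" for t
    using DERIV_cdivide[OF D[of t], of Z] unfolding \<theta>_def by (simp add: mult.commute)
  then have sm: "smooth \<theta>"
    by (rule smoothI_DERIV) (intro smooth_mult smooth_const b_smooth)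
  have one: "\<theta> t = 1" if "t \<ge> 2" for t
  proof -
    have "integral {1..t} b = integral {1..2} b + integral {2..t} b"
      using Henstock_Kurzweil_Integration.integral_combine[of 1 2 t b] that b_int by auto
    moreover have "integral {2..t} b = integral {2..t} (\<lambda>x. 0)"
      by (intro integral_cong) (auto simp: b_zero)
    ultimately show ?thesis using that Z by (simp add: \<theta>_def Z_def)
  qed
  have mono: "integral {1..s} b \<le> integral {1..t} b" if "s \<le> t" for s t
    using that b_nonneg by (intro integral_subset_le b_int) auto
  have nonneg: "\<theta> t \<ge> 0" for t
    using Z b_nonneg by (auto simp: \<theta>_def intro!: divide_nonneg_pos integral_nonneg b_int)
  have le1: "\<theta> t \<le> 1" for t
  proof (cases "t \<ge> 2")
    case True
    then show ?thesis using one by simp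
  next
    case False
    then have "(if t \<le> 1 then 0 else integral {1..t} b) \<le> Z"
      using mono[of t 2] Z by (simp add: Z_def)
    then show ?thesis using Z by (simp add: \<theta>_def)
  qed
  show ?thesis by (rule that[OF sm nonneg le1 _ one]) (simp add: \<theta>_def)
qed

section \<open>Cutoffs of an interval with controlled derivatives\<close>

lemma deriv_eq_0_if_locally_const:
  fixes f :: "real \<Rightarrow> real"
  assumes "open U" "t \<in> U" "\<And>s. s \<in> U \<Longrightarrow> f s = c"
  shows "deriv f t = 0"
proof -
  have "((\<lambda>s. c) has_real_derivative 0) (at t)" by simp
  then have "(f has_real_derivative 0) (at t)"
    by (rule has_field_derivative_transform_within_open[OF _ assms(1,2)]) (simp add: assms(3))
  then show ?thesis by (rule DERIV_imp_deriv)
qed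

lemma continuous_bounded_Icc:
  fixes f :: "real \<Rightarrow> real"
  assumes "continuous_on {a..b} f"
  obtains B where "0 \<le> B" "\<And>t. t \<in> {a..b} \<Longrightarrow> \<bar>f t\<bar> \<le> B"
proof -
  have "compact (f ` {a..b})"
    by (intro compact_continuous_image assms) auto
  then obtain B where B: "\<forall>t\<in>{a..b}. \<bar>f t\<bar> \<le> B"
    using compact_imp_bounded[of "f ` {a..b}"] unfolding bounded_iff by fastforce
  show ?thesis
  proof (rule that[of "\<bar>B\<bar>"])
    fix t assume "t \<in> {a..b}"
    then have "\<bar>f t\<bar> \<le> B" using B by blast
    then show "\<bar>f t\<bar> \<le> \<bar>B\<bar>" by simp
  qed simp
qed

lemma continuous_vanishing_outside_bounded:
  fixes f :: "real \<Rightarrow> real"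
  assumes "continuous_on UNIV f" "\<And>t. t < a \<or> t > b \<Longrightarrow> f t = 0"
  obtains B where "0 \<le> B" "\<And>t. \<bar>f t\<bar> \<le> B"
proof -
  obtain B where B: "0 \<le> B" "\<And>t. t \<in> {a..b} \<Longrightarrow> \<bar>f t\<bar> \<le> B"
    using continuous_bounded_Icc[OF continuous_on_subset[OF assms(1)]] by blast
  have "\<bar>f t\<bar> \<le> B" for t
    using B(1) B(2)[of t] assms(2)[of t] by (cases "t \<in> {a..b}") auto
  then show ?thesis using that B(1) by blast
qed

text \<open>Product of two rescaled steps, one rising at each end. Since the step rises between 1
  and 2, the cutoff is supported at distance 1/n from the ends and is constant at distance 2/n, with
  n = \<open>Suc n\<close>; each derivative costs a factor n. The single constant \<open>C\<close>
  is independent of n.\<close>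

lemma cutoff_family:
  fixes a b :: real
  obtains \<zeta> :: "nat \<Rightarrow> real \<Rightarrow> real" and C :: real where
    "\<And>n. smooth (\<zeta> n)" "\<And>n t. 0 \<le> \<zeta> n t" "\<And>n t. \<zeta> n t \<le> 1"
    "\<And>n t. \<zeta> n t \<noteq> 0 \<Longrightarrow> t \<in> {a + 1 / Suc n .. b - 1 / Suc n}"
    "\<And>n t. t \<in> {a + 2 / Suc n <..< b - 2 / Suc n} \<Longrightarrow> \<zeta> n t = 1"
    "\<And>n t. t \<in> {a + 2 / Suc n <..< b - 2 / Suc n} \<Longrightarrow> deriv (\<zeta> n) t = 0"
    "\<And>n t. t \<in> {a + 2 / Suc n <..< b - 2 / Suc n} \<Longrightarrow> deriv (deriv (\<zeta> n)) t = 0"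
    "\<And>n t. \<bar>deriv (\<zeta> n) t\<bar> \<le> C * real (Suc n)" "\<And>n t. \<bar>deriv (deriv (\<zeta> n)) t\<bar> \<le> C * (real (Suc n))\<^sup>2"
    "0 \<le> C"
proof -
  obtain \<theta> :: "real \<Rightarrow> real" where th: "smooth \<theta>" "\<And>t. 0 \<le> \<theta> t" "\<And>t. \<theta> t \<le> 1"
    "\<And>t. t \<le> 1 \<Longrightarrow> \<theta> t = 0" "\<And>t. t \<ge> 2 \<Longrightarrow> \<theta> t = 1"
    using smooth_step by blast
  have z1: "deriv \<theta> t = 0" if "t < 1 \<or> t > 2" for t
  proof (cases "t < 1")
    case True
    then show ?thesis by (intro deriv_eq_0_if_locally_const[of "{..<1}" t \<theta> 0]) (auto simp: th)
  next
    case False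
    then show ?thesis using that by (intro deriv_eq_0_if_locally_const[of "{2<..}" t \<theta> 1]) (auto simp: th)
  qed
  have z2: "deriv (deriv \<theta>) t = 0" if "t < 1 \<or> t > 2" for t
  proof (cases "t < 1")
    case True
    then show ?thesis by (intro deriv_eq_0_if_locally_const[of "{..<1}" t _ 0]) (auto simp: z1)
  next
    case False
    then show ?thesis using that by (intro deriv_eq_0_if_locally_const[of "{2<..}" t _ 0]) (auto simp: z1)
  qed
  have sm1: "smooth (deriv \<theta>)" "smooth (deriv (deriv \<theta>))" using th(1) by (auto intro: smooth_deriv)
  obtain B1 where B1: "0 \<le> B1" "\<And>t. \<bar>deriv \<theta> t\<bar> \<le> B1"
    using continuous_vanishing_outside_bounded[OF smooth_continuous_on[OF sm1(1)] z1] by blast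
  obtain B2 where B2: "0 \<le> B2" "\<And>t. \<bar>deriv (deriv \<theta>) t\<bar> \<le> B2"
    using continuous_vanishing_outside_bounded[OF smooth_continuous_on[OF sm1(2)] z2] by blast
  \<comment> \<open>The product rule gives 2 \<open>B1\<close> for the first derivative and 2
    \<open>B2\<close> + 2 \<open>B1\<close>^2 for the second; the sum serves for both.\<close>
  define C where "C = 2 * B1 + 2 * B2 + 2 * B1 * B1"
  define \<zeta> where "\<zeta> = (\<lambda>n t. \<theta> (real (Suc n) * (t - a)) * \<theta> (real (Suc n) * (b - t)))"
  define \<zeta>1 where "\<zeta>1 = (\<lambda>n t. real (Suc n) * (deriv \<theta> (real (Suc n) * (t - a)) * \<theta> (real (Suc n) * (b - t))
      - \<theta> (real (Suc n) * (t - a)) * deriv \<theta> (real (Suc n) * (b - t))))"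
  define \<zeta>2 where "\<zeta>2 = (\<lambda>n t. (real (Suc n))\<^sup>2 *
      (deriv (deriv \<theta>) (real (Suc n) * (t - a)) * \<theta> (real (Suc n) * (b - t))
       - 2 * (deriv \<theta> (real (Suc n) * (t - a)) * deriv \<theta> (real (Suc n) * (b - t)))
       + \<theta> (real (Suc n) * (t - a)) * deriv (deriv \<theta>) (real (Suc n) * (b - t))))"
  have DA: "((\<lambda>t. f (c * (t - a))) has_real_derivative deriv f (c * (t - a)) * c) (at t)"
    and DB: "((\<lambda>t. f (c * (b - t))) has_real_derivative deriv f (c * (b - t)) * (- c)) (at t)"
    if "smooth f" for f c t
    by ((rule DERIV_chain2[OF smooth_DERIV[OF that]], auto intro!: derivative_eq_intros)[1],
        rule DERIV_chain2[OF smooth_DERIV[OF that]], auto intro!: derivative_eq_intros)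
  note DD = DA[OF th(1)] DA[OF sm1(1)] DB[OF th(1)] DB[OF sm1(1)]
  have D1: "(\<zeta> n has_real_derivative \<zeta>1 n t) (at t)" for n t
    unfolding \<zeta>_def \<zeta>1_def
    by (rule DERIV_cong, rule DERIV_mult[OF DD(1,3)]) (simp add: algebra_simps)
  have D2: "(\<zeta>1 n has_real_derivative \<zeta>2 n t) (at t)" for n t
    unfolding \<zeta>1_def \<zeta>2_def
    by (rule DERIV_cong, rule DERIV_cmult, rule DERIV_diff, rule DERIV_mult[OF DD(2,3)],
        rule DERIV_mult[OF DD(1,4)]) (simp add: algebra_simps power2_eq_square)
  have e1: "deriv (\<zeta> n) = \<zeta>1 n" for n by (rule ext) (rule DERIV_imp_deriv[OF D1])
  have e2: "deriv (\<zeta>1 n) = \<zeta>2 n" for n by (rule ext) (rule DERIV_imp_deriv[OF D2])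
  have sm: "smooth (\<zeta> n)" for n
  proof -
    have "smooth (\<lambda>t. \<theta> (real (Suc n) * t + (- real (Suc n) * a)) * \<theta> (- real (Suc n) * t + real (Suc n) * b))"
      by (intro smooth_mult smooth_affine th)
    then show ?thesis by (simp only: \<zeta>_def right_diff_distrib) (simp add: algebra_simps)
  qed
  have supp: "t \<in> {a + 1 / Suc n .. b - 1 / Suc n}" if "\<zeta> n t \<noteq> 0" for n t
  proof -
    have "\<not> real (Suc n) * (t - a) \<le> 1" "\<not> real (Suc n) * (b - t) \<le> 1"
      using that th(4) unfolding \<zeta>_def by (metis mult_zero_left, metis mult_zero_right)
    moreover have "real (Suc n) * (t - a) > 1 \<Longrightarrow> t > a + 1 / Suc n" "real (Suc n) * (b - t) > 1 \<Longrightarrow> t < b - 1 / Suc n"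
      by (auto simp: field_simps)
    ultimately show ?thesis by simp
  qed
  have one: "\<zeta> n t = 1" if "t \<in> {a + 2 / Suc n <..< b - 2 / Suc n}" for n t
  proof -
    have "real (Suc n) * (t - a) \<ge> 2" "real (Suc n) * (b - t) \<ge> 2"
      using that by (auto simp: field_simps)
    then show ?thesis by (simp add: \<zeta>_def th)
  qed
  have d0: "deriv (\<zeta> n) t = 0" if "t \<in> {a + 2 / Suc n <..< b - 2 / Suc n}" for n t
    using one by (intro deriv_eq_0_if_locally_const[OF open_greaterThanLessThan that])
  have d00: "deriv (deriv (\<zeta> n)) t = 0" if "t \<in> {a + 2 / Suc n <..< b - 2 / Suc n}" for n t
    using d0 by (intro deriv_eq_0_if_locally_const[OF open_greaterThanLessThan that])
  have ab: "\<bar>u * v\<bar> \<le> p * q" if "\<bar>u\<bar> \<le> p" "\<bar>v\<bar> \<le> q" for u v p q :: real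
    using that by (simp add: abs_mult mult_mono')
  have th1: "\<bar>\<theta> t\<bar> \<le> 1" for t using th(2,3)[of t] by simp
  have b1: "\<bar>deriv (\<zeta> n) t\<bar> \<le> C * real (Suc n)" for n t
  proof -
    have "\<bar>deriv \<theta> (real (Suc n) * (t - a)) * \<theta> (real (Suc n) * (b - t))\<bar> \<le> B1 * 1"
      "\<bar>\<theta> (real (Suc n) * (t - a)) * deriv \<theta> (real (Suc n) * (b - t))\<bar> \<le> 1 * B1"
      by (intro ab B1 th1)+
    then have "\<bar>deriv \<theta> (real (Suc n) * (t - a)) * \<theta> (real (Suc n) * (b - t))
      - \<theta> (real (Suc n) * (t - a)) * deriv \<theta> (real (Suc n) * (b - t))\<bar> \<le> C"
      using B1 B2 mult_nonneg_nonneg[OF B1(1) B1(1)] unfolding C_def by linarith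
    then show ?thesis unfolding e1 \<zeta>1_def abs_mult
      by (metis abs_of_nat mult.commute mult_left_mono of_nat_0_le_iff)
  qed
  have b2: "\<bar>deriv (deriv (\<zeta> n)) t\<bar> \<le> C * (real (Suc n))\<^sup>2" for n t
  proof -
    have "\<bar>deriv (deriv \<theta>) (real (Suc n) * (t - a)) * \<theta> (real (Suc n) * (b - t))\<bar> \<le> B2 * 1"
      "\<bar>\<theta> (real (Suc n) * (t - a)) * deriv (deriv \<theta>) (real (Suc n) * (b - t))\<bar> \<le> 1 * B2"
      "\<bar>deriv \<theta> (real (Suc n) * (t - a)) * deriv \<theta> (real (Suc n) * (b - t))\<bar> \<le> B1 * B1"
      by (intro ab B1 B2 th1)+
    then have "\<bar>deriv (deriv \<theta>) (real (Suc n) * (t - a)) * \<theta> (real (Suc n) * (b - t))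
       - 2 * (deriv \<theta> (real (Suc n) * (t - a)) * deriv \<theta> (real (Suc n) * (b - t)))
       + \<theta> (real (Suc n) * (t - a)) * deriv (deriv \<theta>) (real (Suc n) * (b - t))\<bar> \<le> C"
      using B1 B2 unfolding C_def by linarith
    then have "(real (Suc n))\<^sup>2 * \<bar>deriv (deriv \<theta>) (real (Suc n) * (t - a)) * \<theta> (real (Suc n) * (b - t))
       - 2 * (deriv \<theta> (real (Suc n) * (t - a)) * deriv \<theta> (real (Suc n) * (b - t)))
       + \<theta> (real (Suc n) * (t - a)) * deriv (deriv \<theta>) (real (Suc n) * (b - t))\<bar> \<le> (real (Suc n))\<^sup>2 * C"
      by (intro mult_left_mono) auto
    then show ?thesis unfolding e1 e2 \<zeta>2_def abs_mult by (simp add: mult.commute)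
  qed
  have "0 \<le> C" using B1 B2 by (simp add: C_def)
  have "0 \<le> \<zeta> n t" "\<zeta> n t \<le> 1" for n t
    using th(2,3) by (auto simp: \<zeta>_def intro!: mult_le_one)
  then show ?thesis
    by (rule that[OF sm _ _ supp one d0 d00 b1 b2 \<open>0 \<le> C\<close>])
qed

subsection \<open>Products of functions of one variable\<close>

definition tensor :: "(real \<Rightarrow> real) \<Rightarrow> (real \<Rightarrow> real) \<Rightarrow> real \<times> real \<Rightarrow> real" where
  "tensor a b z = a (fst z) * b (snd z)"

lemma tensor_has_derivative:
  assumes "(a has_real_derivative a') (at (fst z))" "(b has_real_derivative b') (at (snd z))"
  shows "(tensor a b has_derivative (\<lambda>h. a' * fst h * b (snd z) + a (fst z) * (b' * snd h))) (at z)"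
proof -
  have "((\<lambda>z. a (fst z)) has_derivative (\<lambda>h. a' * fst h)) (at z)"
    using has_derivative_compose[OF has_derivative_fst[OF has_derivative_ident]
      assms(1)[unfolded has_field_derivative_def]] by simp
  moreover have "((\<lambda>z. b (snd z)) has_derivative (\<lambda>h. b' * snd h)) (at z)"
    using has_derivative_compose[OF has_derivative_snd[OF has_derivative_ident]
      assms(2)[unfolded has_field_derivative_def]] by simp
  ultimately show ?thesis
    unfolding tensor_def[abs_def] by (auto intro!: derivative_eq_intros)
qed

lemma partial_tensor:
  assumes "smooth a" "smooth b"
  shows "partial_x (tensor a b) = tensor (deriv a) b" "partial_y (tensor a b) = tensor a (deriv b)"
  using frechet_derivative_at[OF tensor_has_derivative[OF smooth_DERIV[OF assms(1)] smooth_DERIV[OF assms(2)]], symmetric]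
  by (auto simp: fun_eq_iff partial_x_def partial_y_def tensor_def)

lemma smooth_funpow_deriv: "smooth a \<Longrightarrow> smooth ((deriv ^^ n) a)"
  by (induction n) (auto intro: smooth_deriv)

lemma partial_funpow_tensor:
  assumes "smooth a" "smooth b"
  shows "(partial_x ^^ i) ((partial_y ^^ j) (tensor a b)) = tensor ((deriv ^^ i) a) ((deriv ^^ j) b)"
proof -
  have "(partial_y ^^ j) (tensor a b) = tensor a ((deriv ^^ j) b)"
    by (induction j) (auto simp: partial_tensor assms smooth_funpow_deriv)
  then show ?thesis
    by (induction i) (auto simp: partial_tensor assms smooth_funpow_deriv)
qed

lemma tensor_continuous_on:
  assumes "continuous_on UNIV a" "continuous_on UNIV b"
  shows "continuous_on S (tensor a b)"
  unfolding tensor_def[abs_def]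
  by (intro continuous_intros continuous_on_compose2[OF assms(1)] continuous_on_compose2[OF assms(2)]) auto

lemma C_diff_tensor: "smooth a \<Longrightarrow> smooth b \<Longrightarrow> C_diff k (tensor a b)"
proof (induction k arbitrary: a b)
  case 0
  then show ?case by (simp add: tensor_continuous_on smooth_continuous_on)
next
  case (Suc k)
  then show ?case
    using tensor_has_derivative[OF smooth_DERIV[OF Suc.prems(1)] smooth_DERIV[OF Suc.prems(2)]]
    unfolding differentiable_def C_diff.simps partial_tensor[OF Suc.prems] by (blast intro: smooth_deriv)
qed

lemma tensor_test_functions:
  assumes "smooth a" "smooth b" "\<And>x. a x \<noteq> 0 \<Longrightarrow> x \<in> {p..q}" "\<And>y. b y \<noteq> 0 \<Longrightarrow> y \<in> {r..s}"
    "{p..q} \<times> {r..s} \<subseteq> S"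
  shows "tensor a b \<in> test_functions S"
proof -
  have "{z. tensor a b z \<noteq> 0} \<subseteq> {p..q} \<times> {r..s}"
    using assms(3,4) by (auto simp: tensor_def)
  then have sub: "closure {z. tensor a b z \<noteq> 0} \<subseteq> {p..q} \<times> {r..s}"
    by (rule closure_minimal) (intro closed_Times closed_atLeastAtMost)
  have "compact ({p..q} \<times> {r..s})"
    by (intro compact_Times compact_Icc)
  then have "compact (closure {z. tensor a b z \<noteq> 0})" "closure {z. tensor a b z \<noteq> 0} \<subseteq> S"
    using sub assms(5) compact_Int_closed[OF _ closed_closure, of "{p..q} \<times> {r..s}" "{z. tensor a b z \<noteq> 0}"]
    by (auto simp: Int_absorb1)
  then show ?thesis
    using C_diff_tensor[OF assms(1,2)] by (simp add: test_functions_def)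
qed

lemma eventually_in_shrinking_interval:
  fixes a b c t :: real
  assumes "t \<in> {a<..<b}"
  shows "\<forall>\<^sub>F n in sequentially. t \<in> {a + c / Suc n <..< b - c / Suc n}"
proof -
  have *: "(\<lambda>n. c / Suc n) \<longlonglongrightarrow> 0"
    using LIMSEQ_Suc[OF lim_const_over_n[of c]] by simp
  have "\<forall>\<^sub>F n in sequentially. c / Suc n < t - a" "\<forall>\<^sub>F n in sequentially. c / Suc n < b - t"
    using assms by (intro order_tendstoD[OF *], simp)+
  then show ?thesis by eventually_elim auto
qed

subsection \<open>Integration over the plate\<close>

abbreviation on_plate :: "real \<Rightarrow> (real \<times> real) measure" where
  "on_plate l \<equiv> lebesgue_on (plate l)"

lemma box_Pair: "box (a, c) (b, d) = {a<..<b} \<times> {c<..<d}" for a b c d :: real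
  by (force simp: box_def Basis_prod_def)

lemma plate_eq_box: "plate l = box (0, -l) (pi, l)"
  by (simp add: plate_def box_Pair)

lemma closure_plate: "l > 0 \<Longrightarrow> closure (plate l) = {0..pi} \<times> {-l..l}"
  by (simp add: plate_def closure_Times)

lemma closure_plate_cbox: "l > 0 \<Longrightarrow> closure (plate l) = cbox (0, -l) (pi, l)"
  by (simp only: closure_plate cbox_Pair_eq) (simp only: cbox_interval)

lemma plate_lmeasurable [simp]: "plate l \<in> lmeasurable"
  by (simp add: plate_eq_box)

lemma plate_lebesgue [simp]: "plate l \<in> sets lebesgue"
  by (simp add: plate_eq_box)

lemma finite_measure_plate: "finite_measure (on_plate l)"
  by (rule finite_measure_lebesgue_on) simp

lemma continuous_bounded_on_closure:
  fixes f :: "real \<times> real \<Rightarrow> real"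
  assumes "l > 0" "continuous_on (closure (plate l)) f"
  obtains B where "0 \<le> B" "\<And>z. z \<in> closure (plate l) \<Longrightarrow> \<bar>f z\<bar> \<le> B"
proof -
  have "compact (f ` closure (plate l))"
    using assms by (intro compact_continuous_image) (auto simp: closure_plate_cbox)
  then obtain B where "\<forall>z\<in>closure (plate l). \<bar>f z\<bar> \<le> B"
    using compact_imp_bounded[of "f ` closure (plate l)"] unfolding bounded_iff by fastforce
  then show ?thesis using that[of "\<bar>B\<bar>"] by fastforce
qed

lemma continuous_measurable_plate:
  fixes f :: "real \<times> real \<Rightarrow> real"
  assumes "continuous_on (closure (plate l)) f"
  shows "f \<in> borel_measurable (on_plate l)"
  by (intro continuous_imp_measurable_on_sets_lebesgue continuous_on_subset[OF assms] closure_subset) simp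

lemma bounded_integrable_plate:
  fixes f :: "real \<times> real \<Rightarrow> real"
  assumes "f \<in> borel_measurable (on_plate l)" "\<And>z. z \<in> plate l \<Longrightarrow> \<bar>f z\<bar> \<le> B"
  shows "integrable (on_plate l) f"
  by (rule finite_measure.integrable_const_bound[OF finite_measure_plate, where B = B]) (auto simp: assms)

lemma continuous_integrable_plate:
  fixes f :: "real \<times> real \<Rightarrow> real"
  assumes "l > 0" "continuous_on (closure (plate l)) f"
  shows "integrable (on_plate l) f"
proof -
  obtain B where "\<And>z. z \<in> closure (plate l) \<Longrightarrow> \<bar>f z\<bar> \<le> B"
    using continuous_bounded_on_closure[OF assms] by blast
  then show ?thesis
    using closure_subset[of "plate l"] continuous_measurable_plate[OF assms(2)]
    by (intro bounded_integrable_plate[of _ _ B]) auto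
qed

lemma integrable_mult_bounded:
  fixes f h :: "'a \<Rightarrow> real"
  assumes "integrable M f" "h \<in> borel_measurable M" "\<And>z. z \<in> space M \<Longrightarrow> \<bar>h z\<bar> \<le> B"
  shows "integrable M (\<lambda>z. f z * h z)"
proof (rule Bochner_Integration.integrable_bound)
  show "integrable M (\<lambda>z. B * f z)" using assms(1) by simp
  show "(\<lambda>z. f z * h z) \<in> borel_measurable M" using assms by measurable
  show "AE z in M. norm (f z * h z) \<le> norm (B * f z)"
  proof (rule AE_I2)
    fix z assume "z \<in> space M"
    then have "\<bar>h z\<bar> \<le> \<bar>B\<bar>" using assms(3) by fastforce
    then have "\<bar>h z\<bar> * \<bar>f z\<bar> \<le> \<bar>B\<bar> * \<bar>f z\<bar>" by (rule mult_right_mono) simp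
    then show "norm (f z * h z) \<le> norm (B * f z)"
      by (simp add: abs_mult mult.commute)
  qed
qed

lemma integrable_mult_continuous_plate:
  fixes f h :: "real \<times> real \<Rightarrow> real"
  assumes "l > 0" "integrable (on_plate l) f" "continuous_on (closure (plate l)) h"
  shows "integrable (on_plate l) (\<lambda>z. f z * h z)"
proof -
  obtain B where B: "\<And>z. z \<in> closure (plate l) \<Longrightarrow> \<bar>h z\<bar> \<le> B"
    using continuous_bounded_on_closure[OF assms(1,3)] by blast
  show ?thesis
    by (rule integrable_mult_bounded[OF assms(2) continuous_measurable_plate[OF assms(3)], of B])
      (use B closure_subset in auto)
qed

text \<open>Dominated convergence with a fixed integrable weight and a uniformly bounded varying
  factor: the form used for cutoffs, for indicators and for partial sums of modes.\<close>

lemma integral_mult_tendsto: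
  fixes h :: "'a \<Rightarrow> real" and f :: "nat \<Rightarrow> 'a \<Rightarrow> real"
  assumes "integrable M h" "\<And>n. f n \<in> borel_measurable M"
    "\<And>n z. z \<in> space M \<Longrightarrow> \<bar>f n z\<bar> \<le> B" "\<And>z. z \<in> space M \<Longrightarrow> (\<lambda>n. f n z) \<longlonglongrightarrow> F z"
  shows "(\<lambda>n. LINT z|M. h z * f n z) \<longlonglongrightarrow> (LINT z|M. h z * F z)"
proof (rule integral_dominated_convergence)
  have F [measurable]: "F \<in> borel_measurable M"
    using assms(2,4) by (rule borel_measurable_LIMSEQ_real[rotated])
  note [measurable] = assms(2)
  show "(\<lambda>z. h z * F z) \<in> borel_measurable M" "\<And>n. (\<lambda>z. h z * f n z) \<in> borel_measurable M"
    using assms(1) by measurable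
  show "integrable M (\<lambda>z. B * \<bar>h z\<bar>)" using assms(1) by simp
  show "AE z in M. (\<lambda>n. h z * f n z) \<longlonglongrightarrow> h z * F z"
    using assms(4) by (auto intro!: AE_I2 tendsto_intros)
  show "AE z in M. norm (h z * f n z) \<le> B * \<bar>h z\<bar>" for n
    using assms(3) by (auto intro!: AE_I2 simp: abs_mult mult.commute[of B] mult_left_mono)
qed

text \<open>Either order of iteration is provided, so that the fundamental theorem of calculus can
  be applied along lines parallel to either axis.\<close>

lemma integral_plate_continuous:
  fixes f :: "real \<times> real \<Rightarrow> real"
  assumes l: "l > 0" and f: "continuous_on (closure (plate l)) f"
  shows "(LINT z|on_plate l. f z) = integral {0..pi} (\<lambda>x. integral {-l..l} (\<lambda>y. f (x, y)))"
    "(LINT z|on_plate l. f z) = integral {-l..l} (\<lambda>y. integral {0..pi} (\<lambda>x. f (x, y)))"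
proof -
  have c: "continuous_on (cbox (0, -l) (pi, l)) f" using f by (simp add: closure_plate_cbox l)
  have "(LINT z|on_plate l. f z) = integral (cbox (0, -l) (pi, l)) f"
    using lebesgue_integral_eq_integral[OF continuous_integrable_plate[OF l f] plate_lebesgue]
    by (simp add: plate_eq_box integral_open_interval)
  also have *: "\<dots> = integral {0..pi} (\<lambda>x. integral {-l..l} (\<lambda>y. f (x, y)))"
    using integral_prod_continuous[OF c] by (simp add: cbox_interval)
  finally show "(LINT z|on_plate l. f z) = integral {0..pi} (\<lambda>x. integral {-l..l} (\<lambda>y. f (x, y)))" .
  then show "(LINT z|on_plate l. f z) = integral {-l..l} (\<lambda>y. integral {0..pi} (\<lambda>x. f (x, y)))"
    using integral_swap_continuous[of 0 "-l" pi l "\<lambda>x y. f (x, y)"] c by (simp add: cbox_interval)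
qed

lemma abs_le_1_plus_square: "\<bar>t\<bar> \<le> 1 + t\<^sup>2" for t :: real
proof -
  have "0 \<le> (\<bar>t\<bar> - 1)\<^sup>2" by simp
  then have "2 * \<bar>t\<bar> \<le> 1 + t\<^sup>2" by (simp add: power2_diff)
  then show ?thesis by linarith
qed

lemma L2_integrable_plate:
  assumes "f \<in> L2 (plate l)"
  shows "integrable (on_plate l) f"
proof (rule Bochner_Integration.integrable_bound)
  show "integrable (on_plate l) (\<lambda>z. 1 + (f z)\<^sup>2)"
    using assms finite_measure.integrable_const[OF finite_measure_plate]
    by (intro Bochner_Integration.integrable_add) (auto simp: L2_def)
  show "f \<in> borel_measurable (on_plate l)" using assms by (simp add: L2_def)
  show "AE z in on_plate l. norm (f z) \<le> norm (1 + (f z)\<^sup>2)" using abs_le_1_plus_square by auto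
qed

lemma bounded_L2_plate:
  assumes "f \<in> borel_measurable (on_plate l)" "\<And>z. z \<in> plate l \<Longrightarrow> \<bar>f z\<bar> \<le> B"
  shows "f \<in> L2 (plate l)"
proof -
  have "integrable (on_plate l) (\<lambda>z. f z * f z)"
    by (rule integrable_mult_bounded[OF bounded_integrable_plate[OF assms] assms(1), of B])
      (use assms(2) in auto)
  then show ?thesis using assms by (simp add: L2_def power2_eq_square)
qed

subsection \<open>Uniqueness of weak derivatives\<close>

lemma borel_measurable_lebesgue_on_indicator:
  "A \<in> sets borel \<Longrightarrow> (indicator A :: _ \<Rightarrow> real) \<in> borel_measurable (lebesgue_on S)"
  by (intro measurable_restrict_space1 borel_measurable_indicator) simp

text \<open>Products of cutoffs are test functions and converge boundedly and pointwise to the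
  indicator of an open box, so the hypothesis passes to the limit.\<close>

lemma integral_box_eq_0:
  assumes h: "integrable (on_plate l) h"
    and 0: "\<And>\<phi>. \<phi> \<in> test_functions (plate l) \<Longrightarrow> (LINT z|on_plate l. h z * \<phi> z) = 0"
  shows "(LINT z|on_plate l. h z * indicator (box p q) z) = 0"
proof -
  obtain a c b d where pq: "p = (a, c)" "q = (b, d)" by (metis surj_pair)
  \<comment> \<open>The box is intersected with the plate, so that the supports of the cutoffs lie
    inside; inside the plate the indicator is unchanged.\<close>
  define a' b' c' d' where "a' = max a 0" and "b' = min b pi" and "c' = max c (-l)" and "d' = min d l"
  obtain \<zeta> C1 where z: "\<And>n. smooth (\<zeta> n)" "\<And>n t. 0 \<le> \<zeta> n t" "\<And>n t. \<zeta> n t \<le> 1"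
    "\<And>n t. \<zeta> n t \<noteq> 0 \<Longrightarrow> t \<in> {a' + 1 / Suc n .. b' - 1 / Suc n}"
    "\<And>n t. t \<in> {a' + 2 / Suc n <..< b' - 2 / Suc n} \<Longrightarrow> \<zeta> n t = (1::real)"
    using cutoff_family[of a' b'] by metis
  obtain \<eta> C2 where e: "\<And>n. smooth (\<eta> n)" "\<And>n t. 0 \<le> \<eta> n t" "\<And>n t. \<eta> n t \<le> 1"
    "\<And>n t. \<eta> n t \<noteq> 0 \<Longrightarrow> t \<in> {c' + 1 / Suc n .. d' - 1 / Suc n}"
    "\<And>n t. t \<in> {c' + 2 / Suc n <..< d' - 2 / Suc n} \<Longrightarrow> \<eta> n t = (1::real)"
    using cutoff_family[of c' d'] by metis
  have lim: "(\<lambda>n. f n t) \<longlonglongrightarrow> indicator {r<..<s} t"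
    if "\<And>n t. f n t \<noteq> 0 \<Longrightarrow> t \<in> {r + 1 / Suc n .. s - 1 / Suc n}"
    "\<And>n t. t \<in> {r + 2 / Suc n <..< s - 2 / Suc n} \<Longrightarrow> f n t = 1"
    for f :: "nat \<Rightarrow> real \<Rightarrow> real" and r s t
  proof (cases "t \<in> {r<..<s}")
    case True
    have "\<forall>\<^sub>F n in sequentially. f n t = 1"
      using eventually_in_shrinking_interval[OF True] by eventually_elim (rule that(2))
    then show ?thesis using True by (simp add: tendsto_eventually)
  next
    case False
    have "f n t = 0" for n
    proof (rule ccontr)
      assume "f n t \<noteq> 0"
      from that(1)[OF this] have "r + 1 / Suc n \<le> t" "t \<le> s - 1 / Suc n" by auto
      moreover have "1 / real (Suc n) > 0" by simp
      ultimately have "r < t" "t < s" by linarith+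
      with False show False by simp
    qed
    then show ?thesis using False by simp
  qed
  have T: "tensor (\<zeta> n) (\<eta> n) \<in> test_functions (plate l)" for n
  proof (rule tensor_test_functions[OF z(1) e(1) z(4) e(4)])
    have "{a' + \<epsilon>..b' - \<epsilon>} \<times> {c' + \<epsilon>..d' - \<epsilon>} \<subseteq> plate l" if "\<epsilon> > 0" for \<epsilon>
    proof -
      have "0 \<le> a'" "b' \<le> pi" "-l \<le> c'" "d' \<le> l" by (auto simp: a'_def b'_def c'_def d'_def)
      then show ?thesis using that unfolding plate_def by (auto intro: less_le_trans le_less_trans)
    qed
    from this[of "1 / real (Suc n)"] show "{a' + 1 / real (Suc n)..b' - 1 / real (Suc n)} \<times> {c' + 1 / real (Suc n)..d' - 1 / real (Suc n)} \<subseteq> plate l"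
      by simp
  qed
  have "(\<lambda>n. LINT z|on_plate l. h z * tensor (\<zeta> n) (\<eta> n) z) \<longlonglongrightarrow>
      (LINT z|on_plate l. h z * (indicator {a'<..<b'} (fst z) * indicator {c'<..<d'} (snd z)))"
  proof (rule integral_mult_tendsto[OF h])
    show "tensor (\<zeta> n) (\<eta> n) \<in> borel_measurable (on_plate l)" for n
      by (intro continuous_measurable_plate tensor_continuous_on smooth_continuous_on z e)
    show "\<bar>tensor (\<zeta> n) (\<eta> n) z\<bar> \<le> 1" for n z
      using z(2,3) e(2,3) by (simp add: tensor_def abs_mult mult_le_one)
    show "(\<lambda>n. tensor (\<zeta> n) (\<eta> n) z) \<longlonglongrightarrow> indicator {a'<..<b'} (fst z) * indicator {c'<..<d'} (snd z)" for z
      unfolding tensor_def by (intro tendsto_mult lim z e)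
  qed
  moreover have "(LINT z|on_plate l. h z * (indicator {a'<..<b'} (fst z) * indicator {c'<..<d'} (snd z))) =
    (LINT z|on_plate l. h z * indicator (box p q) z)"
  proof (rule Bochner_Integration.integral_cong)
    fix z assume "z \<in> space (on_plate l)"
    then show "h z * (indicator {a'<..<b'} (fst z) * indicator {c'<..<d'} (snd z)) = h z * indicator (box p q) z"
      by (cases z) (auto simp: pq box_Pair plate_def a'_def b'_def c'_def d'_def indicator_def)
  qed simp
  ultimately show ?thesis using 0[OF T] by (simp add: LIMSEQ_const_iff)
qed

text \<open>Dynkin's argument: the boxes form an intersection-stable generator of the Borel sets,
  and the sets on which the integral vanishes are closed under complements and disjoint countable
  unions.\<close>

lemma integral_borel_eq_0:
  fixes h :: "real \<times> real \<Rightarrow> real"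
  assumes h: "integrable (on_plate l) h"
    and 0: "\<And>\<phi>. \<phi> \<in> test_functions (plate l) \<Longrightarrow> (LINT z|on_plate l. h z * \<phi> z) = 0"
    and A: "A \<in> sets borel"
  shows "(LINT z|on_plate l. h z * indicator A z) = 0"
proof -
  let ?G = "range (\<lambda>(a, b). box a b :: (real \<times> real) set)"
  have borel_eq: "sets borel = sigma_sets UNIV ?G"
    by (subst borel_eq_box) simp
  have mble: "(indicator B :: real \<times> real \<Rightarrow> real) \<in> borel_measurable (on_plate l)" if "B \<in> sets borel" for B
    using that by (rule borel_measurable_lebesgue_on_indicator)
  have int: "integrable (on_plate l) (\<lambda>z. h z * indicator B z)" if "B \<in> sets borel" for B
    by (rule integrable_mult_bounded[OF h, of _ 1]) (use mble[OF that] in \<open>auto split: split_indicator\<close>)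
  have total: "(LINT z|on_plate l. h z) = 0"
  proof -
    have "(LINT z|on_plate l. h z) = (LINT z|on_plate l. h z * indicator (box (0,-l) (pi,l)) z)"
      unfolding plate_eq_box[symmetric] by (rule Bochner_Integration.integral_cong) auto
    then show ?thesis using integral_box_eq_0[OF h 0] by simp
  qed
  from A have "A \<in> sigma_sets UNIV ?G" by (simp only: borel_eq)
  have stable: "Int_stable ?G"
    unfolding Int_stable_def
  proof (intro ballI)
    fix a b assume "a \<in> ?G" "b \<in> ?G"
    then show "a \<inter> b \<in> ?G"
      unfolding image_iff using box_Int_box by (metis (no_types, lifting) UNIV_I case_prod_conv old.prod.exhaust)
  qed
  show ?thesis
  proof (rule sigma_sets_induct_disjoint[OF stable _ \<open>A \<in> sigma_sets UNIV ?G\<close>])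
    show "?G \<subseteq> Pow UNIV" by simp
  next
    fix B assume "B \<in> ?G"
    then show "(LINT z|on_plate l. h z * indicator B z) = 0" using integral_box_eq_0[OF h 0] by force
  next
    show "(LINT z|on_plate l. h z * indicator {} z) = 0" by simp
  next
    fix B assume *: "B \<in> sigma_sets UNIV ?G" "(LINT z|on_plate l. h z * indicator B z) = 0"
    then have B: "B \<in> sets borel" by (simp only: borel_eq)
    have "(LINT z|on_plate l. h z * indicator (UNIV - B) z) = (LINT z|on_plate l. h z - h z * indicator B z)"
      by (rule Bochner_Integration.integral_cong) (auto simp: indicator_def)
    then show "(LINT z|on_plate l. h z * indicator (UNIV - B) z) = 0"
      using * total h int[OF B] by simp
  next
    fix B :: "nat \<Rightarrow> (real \<times> real) set"
    assume disj: "disjoint_family B" and sB: "range B \<subseteq> sigma_sets UNIV ?G"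
      and IH: "\<And>i. (LINT z|on_plate l. h z * indicator (B i) z) = 0"
    have B: "B i \<in> sets borel" for i using sB unfolding borel_eq by blast
    show "(LINT z|on_plate l. h z * indicator (\<Union>i. B i) z) = 0"
    \<comment> \<open>The function \<open>h\<close> has no sign, so the countable union is reached
      by dominated convergence from the finite ones.\<close>
    proof (rule LIMSEQ_unique)
      show "(\<lambda>n. LINT z|on_plate l. h z * indicator (\<Union>i<n. B i) z) \<longlonglongrightarrow>
          (LINT z|on_plate l. h z * indicator (\<Union>i. B i) z)"
      proof (rule integral_mult_tendsto[OF h, of _ 1])
        show "(indicator (\<Union>i<n. B i) :: _ \<Rightarrow> real) \<in> borel_measurable (on_plate l)" for n
          by (rule mble) (use B in auto)
        show "(\<lambda>n. indicator (\<Union>i<n. B i) z) \<longlonglongrightarrow> (indicator (\<Union>i. B i) z :: real)" for z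
          by (rule LIMSEQ_indicator_UN)
      qed (auto simp: indicator_def)
      have "(LINT z|on_plate l. h z * indicator (\<Union>i<n. B i) z) = 0" for n
      proof (induction n)
        case (Suc n)
        have "B n \<inter> B i = {}" if "i < n" for i
          using disj that unfolding disjoint_family_on_def by (metis UNIV_I less_irrefl)
        then have "B n \<inter> (\<Union>i<n. B i) = {}" by blast
        then have "(LINT z|on_plate l. h z * indicator (\<Union>i<Suc n. B i) z) =
            (LINT z|on_plate l. h z * indicator (B n) z + h z * indicator (\<Union>i<n. B i) z)"
          by (intro Bochner_Integration.integral_cong)
            (simp_all add: lessThan_Suc indicator_disj_union distrib_left)
        also have "\<dots> = (LINT z|on_plate l. h z * indicator (B n) z) + (LINT z|on_plate l. h z * indicator (\<Union>i<n. B i) z)"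
        proof (rule Bochner_Integration.integral_add)
          show "integrable (on_plate l) (\<lambda>z. h z * indicator (B n) z)" by (rule int[OF B])
          show "integrable (on_plate l) (\<lambda>z. h z * indicator (\<Union>i<n. B i) z)" by (rule int) (use B in auto)
        qed
        finally show ?case using Suc IH by simp
      qed simp
      then show "(\<lambda>n. LINT z|on_plate l. h z * indicator (\<Union>i<n. B i) z) \<longlonglongrightarrow> 0" by simp
    qed
  qed
qed

text \<open>An integrable function is determined almost everywhere by its integrals over measurable
  sets. A Lebesgue set differs from a Borel set by part of a null set, which reduces the claim to
  \<open>integral_borel_eq_0\<close>.\<close>

lemma fundamental_lemma_plate:
  fixes h :: "real \<times> real \<Rightarrow> real"
  assumes h: "integrable (on_plate l) h"
    and 0: "\<And>\<phi>. \<phi> \<in> test_functions (plate l) \<Longrightarrow> (LINT z|on_plate l. h z * \<phi> z) = 0"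
  shows "AE z in on_plate l. h z = 0"
proof (rule density_unique_real)
  fix A assume "A \<in> sets (on_plate l)"
  then have "A \<in> sets lebesgue"
    by (auto simp: sets_restrict_space_iff)
  then obtain S N N' where A: "A = S \<union> N" "N \<subseteq> N'" "N' \<in> null_sets lborel" "S \<in> sets lborel"
    by (rule sets_completionE)
  have "AE z in lebesgue. z \<notin> N'"
    using AE_not_in[OF null_sets_completionI[OF A(3)]] .
  then have "AE z in on_plate l. z \<notin> N'"
    by (auto simp: AE_restrict_space_iff elim: eventually_mono)
  then have "AE z in on_plate l. indicator A z *\<^sub>R h z = h z * indicator S z"
    by eventually_elim (use A(1,2) in \<open>auto simp: indicator_def\<close>)
  moreover have "(\<lambda>z. indicator A z *\<^sub>R h z) \<in> borel_measurable (on_plate l)"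
    using h \<open>A \<in> sets (on_plate l)\<close> by measurable
  moreover have "(indicator S :: _ \<Rightarrow> real) \<in> borel_measurable (on_plate l)"
    using A(4) borel_measurable_lebesgue_on_indicator by simp
  ultimately have "(LINT z|on_plate l. indicator A z *\<^sub>R h z) = (LINT z|on_plate l. h z * indicator S z)"
    using h by (intro integral_cong_AE) auto
  also have "\<dots> = 0" using integral_borel_eq_0[OF h 0] A(4) by simp
  finally show "(LINT z:A|on_plate l. h z) = (LINT z:A|on_plate l. 0)"
    by (simp add: set_lebesgue_integral_def)
qed (use h in auto)

section \<open>Test functions, and classical derivatives of products as weak derivatives\<close>

lemma test_function_zero: "\<phi> \<in> test_functions S \<Longrightarrow> z \<notin> S \<Longrightarrow> \<phi> z = 0"
proof (rule ccontr)
  assume "\<phi> \<in> test_functions S" "z \<notin> S" "\<phi> z \<noteq> 0"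
  then have "closure {z. \<phi> z \<noteq> 0} \<subseteq> S" "z \<in> {z. \<phi> z \<noteq> 0}" "z \<notin> S"
    unfolding test_functions_def by blast+
  then show False using closure_subset by (metis subsetD)
qed

lemma test_function_C_diff: "\<phi> \<in> test_functions S \<Longrightarrow> C_diff k \<phi>"
  unfolding test_functions_def by blast

lemma C_diff_Suc_differentiable: "C_diff (Suc k) \<phi> \<Longrightarrow> \<phi> differentiable (at z)"
  unfolding C_diff.simps by (elim conjE allE)

lemmas test_function_differentiable = C_diff_Suc_differentiable[OF test_function_C_diff]

lemma C_diff_continuous: assumes "C_diff k \<phi>" shows "continuous_on S \<phi>"
proof (cases k)
  case 0
  then show ?thesis using assms continuous_on_subset[of UNIV \<phi> S] by simp
next
  case (Suc n)
  have "\<phi> differentiable (at z)" for z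
    using assms unfolding Suc by (rule C_diff_Suc_differentiable)
  then show ?thesis
    by (intro continuous_at_imp_continuous_on ballI differentiable_imp_continuous_within)
qed

lemma test_function_continuous: "\<phi> \<in> test_functions S \<Longrightarrow> continuous_on T \<phi>"
  by (rule C_diff_continuous[OF test_function_C_diff])

text \<open>The complement of the closed support is open and the function is 0 on it, so the
  derivatives vanish there as well and supports can only shrink.\<close>

lemma partial_test_functions:
  assumes "\<phi> \<in> test_functions S"
  shows "partial_x \<phi> \<in> test_functions S" "partial_y \<phi> \<in> test_functions S"
proof -
  let ?K = "closure {z. \<phi> z \<noteq> 0}"
  have D0: "(\<phi> has_derivative (\<lambda>_. 0)) (at z)" if "z \<notin> ?K" for z
  proof -
    have "((\<lambda>_. 0) has_derivative (\<lambda>_. 0)) (at z)" by simp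
    then show ?thesis
      by (rule has_derivative_transform_within_open[of _ _ _ _ "- ?K"])
        (use that closure_subset in \<open>auto simp: subset_eq\<close>)
  qed
  have z: "partial_x \<phi> z = 0 \<and> partial_y \<phi> z = 0" if "z \<notin> ?K" for z
    using frechet_derivative_at[OF D0[OF that], symmetric] by (simp add: partial_x_def partial_y_def)
  have K: "compact ?K" "?K \<subseteq> S" and C: "C_diff (Suc k) \<phi>" for k
    using assms unfolding test_functions_def by blast+
  have *: "f \<in> test_functions S" if f: "\<And>z. z \<notin> ?K \<Longrightarrow> f z = 0" "\<And>k. C_diff k f" for f
  proof -
    have sub: "closure {z. f z \<noteq> 0} \<subseteq> ?K"
      using f(1) by (intro closure_minimal) auto
    then have "compact (closure {z. f z \<noteq> 0})"
      using compact_Int_closed[OF K(1) closed_closure, of "{z. f z \<noteq> 0}"] by (simp add: Int_absorb1)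
    moreover have "closure {z. f z \<noteq> 0} \<subseteq> S" using sub K(2) by (rule subset_trans)
    ultimately show ?thesis unfolding test_functions_def using f(2) by blast
  qed
  show "partial_x \<phi> \<in> test_functions S" "partial_y \<phi> \<in> test_functions S"
    by (rule *; use z C in simp)+
qed

lemma partial_funpow_test_functions:
  assumes "\<phi> \<in> test_functions S"
  shows "(partial_x ^^ i) ((partial_y ^^ j) \<phi>) \<in> test_functions S"
proof -
  have "(partial_y ^^ j) \<phi> \<in> test_functions S" by (induction j) (auto simp: assms partial_test_functions)
  then show ?thesis by (induction i) (auto simp: partial_test_functions)
qed

lemma partial_has_real_derivative:
  assumes "\<phi> differentiable (at (x, y))"
  shows "((\<lambda>t. \<phi> (t, y)) has_real_derivative partial_x \<phi> (x, y)) (at x)"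
    "((\<lambda>t. \<phi> (x, t)) has_real_derivative partial_y \<phi> (x, y)) (at y)"
proof -
  let ?D = "frechet_derivative \<phi> (at (x, y))"
  have D: "(\<phi> has_derivative ?D) (at (x, y))"
    by (rule frechet_derivative_works[THEN iffD1, OF assms])
  have lin: "linear ?D" by (rule has_derivative_linear[OF D])
  have e: "?D (h, 0) = partial_x \<phi> (x, y) * h" "?D (0, h) = partial_y \<phi> (x, y) * h" for h
  proof -
    have "(h, 0::real) = h *\<^sub>R (1, 0)" "(0::real, h) = h *\<^sub>R (0, 1)" by simp_all
    then show "?D (h, 0) = partial_x \<phi> (x, y) * h" "?D (0, h) = partial_y \<phi> (x, y) * h"
      unfolding partial_x_def partial_y_def
      by (simp_all only: linear_scale[OF lin] real_scaleR_def mult.commute)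
  qed
  have "((\<lambda>t. (t, y)) has_derivative (\<lambda>h. (h, 0))) (at x)" "((\<lambda>t. (x, t)) has_derivative (\<lambda>h. (0, h))) (at y)"
    by (auto intro!: derivative_eq_intros)
  note d = this[THEN has_derivative_compose, OF D]
  show "((\<lambda>t. \<phi> (t, y)) has_real_derivative partial_x \<phi> (x, y)) (at x)"
    using d(1) unfolding has_field_derivative_def e .
  show "((\<lambda>t. \<phi> (x, t)) has_real_derivative partial_y \<phi> (x, y)) (at y)"
    using d(2) unfolding has_field_derivative_def e .
qed

lemma integral_derivative_eq_0:
  fixes F :: "real \<Rightarrow> real"
  assumes "a \<le> b" "\<And>x. (F has_real_derivative f x) (at x)" "F a = 0" "F b = 0"
  shows "integral {a..b} f = 0"
proof -
  have "(f has_integral (F b - F a)) {a..b}"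
    using assms by (intro fundamental_theorem_of_calculus)
      (auto simp: has_real_derivative_iff_has_vector_derivative[symmetric] intro: DERIV_subset)
  then show ?thesis using assms by (simp add: integral_unique)
qed

text \<open>Each line integral is that of the derivative of a product with \<phi>, which vanishes on
  all four edges.\<close>

lemma integral_by_parts_test_function:
  assumes l: "l > 0" and ab: "smooth a" "smooth b" and \<phi>: "\<phi> \<in> test_functions (plate l)"
  shows "(LINT z|on_plate l. tensor a b z * partial_x \<phi> z) = - (LINT z|on_plate l. tensor (deriv a) b z * \<phi> z)"
    "(LINT z|on_plate l. tensor a b z * partial_y \<phi> z) = - (LINT z|on_plate l. tensor a (deriv b) z * \<phi> z)"
proof -
  note cont = smooth_continuous_on smooth_deriv ab tensor_continuous_on
    test_function_continuous[OF \<phi>] test_function_continuous[OF partial_test_functions(1)[OF \<phi>]]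
    test_function_continuous[OF partial_test_functions(2)[OF \<phi>]]
  have zero: "\<phi> (0, y) = 0" "\<phi> (pi, y) = 0" "\<phi> (x, l) = 0" "\<phi> (x, -l) = 0" for x y
    by (rule test_function_zero[OF \<phi>], simp add: plate_def)+
  have "(LINT z|on_plate l. tensor a b z * partial_x \<phi> z + tensor (deriv a) b z * \<phi> z) = 0"
  proof -
    have "integral {0..pi} (\<lambda>x. tensor a b (x, y) * partial_x \<phi> (x, y) + tensor (deriv a) b (x, y) * \<phi> (x, y)) = 0" for y
      by (rule integral_derivative_eq_0[of 0 pi "\<lambda>x. tensor a b (x, y) * \<phi> (x, y)"])
        (auto simp: zero tensor_def intro!: derivative_eq_intros smooth_DERIV[OF ab(1)]
          partial_has_real_derivative test_function_differentiable[OF \<phi>])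
    then show ?thesis
      by (subst integral_plate_continuous(2)[OF l]) (auto intro!: continuous_intros cont)
  qed
  moreover have "(LINT z|on_plate l. tensor a b z * partial_x \<phi> z + tensor (deriv a) b z * \<phi> z) =
      (LINT z|on_plate l. tensor a b z * partial_x \<phi> z) + (LINT z|on_plate l. tensor (deriv a) b z * \<phi> z)"
    by (intro Bochner_Integration.integral_add continuous_integrable_plate[OF l] continuous_intros cont)
  ultimately show "(LINT z|on_plate l. tensor a b z * partial_x \<phi> z) = - (LINT z|on_plate l. tensor (deriv a) b z * \<phi> z)"
    by linarith
  have "(LINT z|on_plate l. tensor a b z * partial_y \<phi> z + tensor a (deriv b) z * \<phi> z) = 0"
  proof -
    have "integral {-l..l} (\<lambda>y. tensor a b (x, y) * partial_y \<phi> (x, y) + tensor a (deriv b) (x, y) * \<phi> (x, y)) = 0" for x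
      using l by (intro integral_derivative_eq_0[of "-l" l "\<lambda>y. tensor a b (x, y) * \<phi> (x, y)"])
        (auto simp: zero tensor_def intro!: derivative_eq_intros smooth_DERIV[OF ab(2)]
          partial_has_real_derivative test_function_differentiable[OF \<phi>])
    then show ?thesis
      by (subst integral_plate_continuous(1)[OF l]) (auto intro!: continuous_intros cont)
  qed
  moreover have "(LINT z|on_plate l. tensor a b z * partial_y \<phi> z + tensor a (deriv b) z * \<phi> z) =
      (LINT z|on_plate l. tensor a b z * partial_y \<phi> z) + (LINT z|on_plate l. tensor a (deriv b) z * \<phi> z)"
    by (intro Bochner_Integration.integral_add continuous_integrable_plate[OF l] continuous_intros cont)
  ultimately show "(LINT z|on_plate l. tensor a b z * partial_y \<phi> z) = - (LINT z|on_plate l. tensor a (deriv b) z * \<phi> z)"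
    by linarith
qed

lemma tensor_has_weak_derivative:
  assumes l: "l > 0" and ab: "smooth a" "smooth b"
  shows "has_weak_derivative (plate l) i j (tensor a b) (tensor ((deriv ^^ i) a) ((deriv ^^ j) b))"
  unfolding has_weak_derivative_def
proof
  fix \<phi> assume \<phi>: "\<phi> \<in> test_functions (plate l)"
  have y: "(LINT z|on_plate l. tensor a b z * (partial_y ^^ j) \<phi> z) =
      (-1) ^ j * (LINT z|on_plate l. tensor a ((deriv ^^ j) b) z * \<phi> z)"
    if "smooth a" "smooth b" "\<phi> \<in> test_functions (plate l)" for a b \<phi>
    using that
  proof (induction j arbitrary: \<phi>)
    case (Suc j)
    have "(LINT z|on_plate l. tensor a b z * (partial_y ^^ Suc j) \<phi> z) =
        (-1) ^ j * (LINT z|on_plate l. tensor a ((deriv ^^ j) b) z * partial_y \<phi> z)"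
      using Suc.IH[OF Suc.prems(1,2) partial_test_functions(2)[OF Suc.prems(3)]]
      by (simp only: funpow_Suc_right o_apply)
    then show ?case
      using integral_by_parts_test_function(2)[OF l Suc.prems(1) smooth_funpow_deriv[OF Suc.prems(2)] Suc.prems(3)]
      by simp
  qed simp
  have x: "(LINT z|on_plate l. tensor a b z * (partial_x ^^ i) \<phi> z) =
      (-1) ^ i * (LINT z|on_plate l. tensor ((deriv ^^ i) a) b z * \<phi> z)"
    if "smooth a" "smooth b" "\<phi> \<in> test_functions (plate l)" for a b \<phi>
    using that
  proof (induction i arbitrary: \<phi>)
    case (Suc i)
    have "(LINT z|on_plate l. tensor a b z * (partial_x ^^ Suc i) \<phi> z) =
        (-1) ^ i * (LINT z|on_plate l. tensor ((deriv ^^ i) a) b z * partial_x \<phi> z)"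
      using Suc.IH[OF Suc.prems(1,2) partial_test_functions(1)[OF Suc.prems(3)]]
      by (simp only: funpow_Suc_right o_apply)
    then show ?case
      using integral_by_parts_test_function(1)[OF l smooth_funpow_deriv[OF Suc.prems(1)] Suc.prems(2,3)]
      by simp
  qed simp
  show "(LINT z|on_plate l. tensor a b z * (partial_x ^^ i) ((partial_y ^^ j) \<phi>) z) =
      (-1) ^ (i + j) * (LINT z|on_plate l. tensor ((deriv ^^ i) a) ((deriv ^^ j) b) z * \<phi> z)"
    \<comment> \<open>The x-derivatives are moved first, with the j-th y-derivative of \<phi> as the
      test function; the y-derivatives are then moved against the i-th derivative of
      \<open>a\<close>.\<close>
    using x[OF ab partial_funpow_test_functions[OF \<phi>, of 0 j, simplified]]
      y[OF smooth_funpow_deriv[OF ab(1)] ab(2) \<phi>]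
    by (simp add: power_add)
qed

text \<open>The representative in \<open>weak_derivative\<close> is an arbitrary choice; the
  fundamental lemma pins it down almost everywhere, which is enough under an integral.\<close>

lemma weak_derivative_AE:
  assumes l: "l > 0" and w: "w \<in> L2 (plate l)" "has_weak_derivative (plate l) i j u w"
  shows "weak_derivative (plate l) i j u \<in> L2 (plate l)"
    "has_weak_derivative (plate l) i j u (weak_derivative (plate l) i j u)"
    "AE z in on_plate l. weak_derivative (plate l) i j u z = w z"
proof -
  let ?w = "weak_derivative (plate l) i j u"
  have "?w \<in> L2 (plate l) \<and> has_weak_derivative (plate l) i j u ?w"
    unfolding weak_derivative_def
    by (rule someI[of "\<lambda>w. w \<in> L2 (plate l) \<and> has_weak_derivative (plate l) i j u w" w]) (simp add: w)
  then show W: "?w \<in> L2 (plate l)" "has_weak_derivative (plate l) i j u ?w" by auto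
  note int = L2_integrable_plate[OF W(1)] L2_integrable_plate[OF w(1)]
  have "AE z in on_plate l. ?w z - w z = 0"
  proof (rule fundamental_lemma_plate)
    show "integrable (on_plate l) (\<lambda>z. ?w z - w z)" using int by simp
    fix \<phi> assume \<phi>: "\<phi> \<in> test_functions (plate l)"
    have "(-1) ^ (i + j) * (LINT z|on_plate l. ?w z * \<phi> z) = (-1) ^ (i + j) * (LINT z|on_plate l. w z * \<phi> z)"
      using bspec[OF w(2)[unfolded has_weak_derivative_def] \<phi>]
        bspec[OF W(2)[unfolded has_weak_derivative_def] \<phi>] by simp
    then have "(LINT z|on_plate l. ?w z * \<phi> z) = (LINT z|on_plate l. w z * \<phi> z)" by simp
    moreover have "(LINT z|on_plate l. ?w z * \<phi> z - w z * \<phi> z) =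
        (LINT z|on_plate l. ?w z * \<phi> z) - (LINT z|on_plate l. w z * \<phi> z)"
      by (intro Bochner_Integration.integral_diff integrable_mult_continuous_plate[OF l] int test_function_continuous[OF \<phi>])
    ultimately show "(LINT z|on_plate l. (?w z - w z) * \<phi> z) = 0" by (simp add: left_diff_distrib)
  qed
  then show "AE z in on_plate l. ?w z = w z" by eventually_elim simp
qed

lemma H2_weak_derivative:
  assumes "l > 0" "u \<in> H2 (plate l)" "i + j \<le> 2"
  shows "weak_derivative (plate l) i j u \<in> L2 (plate l)"
    "has_weak_derivative (plate l) i j u (weak_derivative (plate l) i j u)"
proof -
  from assms(2,3) obtain w where w: "w \<in> L2 (plate l)" "has_weak_derivative (plate l) i j u w"
    unfolding H2_def by blast
  then show "weak_derivative (plate l) i j u \<in> L2 (plate l)"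
    "has_weak_derivative (plate l) i j u (weak_derivative (plate l) i j u)"
    using weak_derivative_AE[OF assms(1) w] by blast+
qed

subsection \<open>Green's formula against functions with weak second derivatives\<close>

text \<open>A kernel of size n on a set of measure of order 1/n has bounded mass, while
  \<open>W\<close> becomes uniformly small on these sets.\<close>

lemma concentrating_kernel_tendsto_0:
  fixes W :: "'a \<Rightarrow> real" and K :: "nat \<Rightarrow> 'a \<Rightarrow> real"
  assumes fin: "finite_measure M"
    and W: "W \<in> borel_measurable M" and K: "\<And>n. K n \<in> borel_measurable M" and E: "\<And>n. E n \<in> sets M"
    and small: "\<And>n. measure M (E n) \<le> D / Suc n"
    and bound: "\<And>n z. z \<in> E n \<Longrightarrow> \<bar>K n z\<bar> \<le> C * real (Suc n)"
    and supp: "\<And>n z. z \<in> space M \<Longrightarrow> z \<notin> E n \<Longrightarrow> K n z = 0"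
    and W0: "\<And>e. e > 0 \<Longrightarrow> \<forall>\<^sub>F n in sequentially. \<forall>z\<in>E n. \<bar>W z\<bar> \<le> e"
    and "0 \<le> C"
  shows "(\<lambda>n. LINT z|M. W z * K n z) \<longlonglongrightarrow> 0"
proof (rule tendstoI)
  fix \<epsilon> :: real assume "\<epsilon> > 0"
  interpret finite_measure M by (rule fin)
  \<comment> \<open>The mass is at most \<open>C * \<bar>D\<bar>\<close>; the summand 1 keeps the
    denominator positive.\<close>
  define e where "e = \<epsilon> / (2 * (C * \<bar>D\<bar> + 1))"
  have p: "C * \<bar>D\<bar> + 1 > 0" using \<open>0 \<le> C\<close> by (simp add: add_nonneg_pos)
  then have e: "e > 0" using \<open>\<epsilon> > 0\<close> by (simp add: e_def)
  have "e * (C * \<bar>D\<bar>) \<le> e * (C * \<bar>D\<bar> + 1)" using e by simp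
  also have "\<dots> = \<epsilon> / 2" using p by (simp add: e_def divide_simps)
  also have "\<dots> < \<epsilon>" using \<open>\<epsilon> > 0\<close> by simp
  finally have lt: "e * (C * \<bar>D\<bar>) < \<epsilon>" .
  from W0[OF e] show "\<forall>\<^sub>F n in sequentially. dist (LINT z|M. W z * K n z) 0 < \<epsilon>"
  proof eventually_elim
    case (elim n)
    let ?B = "\<lambda>z. e * (C * real (Suc n)) * indicator (E n) z"
    have le: "\<bar>W z * K n z\<bar> \<le> ?B z" if "z \<in> space M" for z
    proof (cases "z \<in> E n")
      case True
      then have "\<bar>W z\<bar> * \<bar>K n z\<bar> \<le> e * (C * real (Suc n))"
        using elim bound e by (intro mult_mono) auto
      then show ?thesis using True by (simp add: abs_mult)
    next
      case False
      then show ?thesis using supp[OF that] by simp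
    qed
    have int: "integrable M ?B" by (intro integrable_mult_right integrable_real_indicator E) (simp add: less_top[symmetric])
    have intWK: "integrable M (\<lambda>z. W z * K n z)"
      using W K le by (intro Bochner_Integration.integrable_bound[OF int]) (auto intro!: AE_I2 intro: order_trans[OF _ abs_ge_self])
    have "\<bar>LINT z|M. W z * K n z\<bar> \<le> (LINT z|M. \<bar>W z * K n z\<bar>)"
      by (rule integral_abs_bound)
    also have "\<dots> \<le> (LINT z|M. ?B z)"
      using le by (intro integral_mono integrable_abs intWK int) auto
    also have "\<dots> = e * (C * real (Suc n)) * measure M (E n)" using E by simp
    also have "\<dots> \<le> e * (C * real (Suc n)) * (\<bar>D\<bar> / Suc n)"
      using small[of n] e \<open>0 \<le> C\<close>
      by (intro mult_left_mono) (auto intro: order_trans[OF _ divide_right_mono[OF abs_ge_self]])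
    also have "\<dots> = e * (C * \<bar>D\<bar>)" by (simp add: field_simps del: of_nat_Suc)
    finally show ?case using lt by simp
  qed
qed

text \<open>The concentration sets are the two strips of width 2/n along opposite edges. The
  coordinate \<open>p\<close> selects the vertical or the horizontal pair, so that one proof serves
  for both directions; uniform continuity makes \<open>W\<close> small near an edge on which it
  vanishes.\<close>

lemma strip_kernel_tendsto_0:
  fixes W :: "real \<times> real \<Rightarrow> real" and K :: "nat \<Rightarrow> real \<times> real \<Rightarrow> real" and p :: "real \<times> real \<Rightarrow> real"
  assumes l: "l > 0" and W: "continuous_on (closure (plate l)) W"
    and K: "\<And>n. continuous_on (closure (plate l)) (K n)"
    and p: "p = fst \<and> a = 0 \<and> b = pi \<and> (\<forall>y\<in>{-l..l}. W (0, y) = 0 \<and> W (pi, y) = 0) \<or>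
      p = snd \<and> a = -l \<and> b = l \<and> (\<forall>x\<in>{0..pi}. W (x, -l) = 0 \<and> W (x, l) = 0)"
    and bound: "\<And>n z. z \<in> plate l \<Longrightarrow> \<bar>K n z\<bar> \<le> C * real (Suc n)"
    and supp: "\<And>n z. z \<in> plate l \<Longrightarrow> p z \<in> {a + 2 / Suc n <..< b - 2 / Suc n} \<Longrightarrow> K n z = 0"
    and C: "0 \<le> C"
  shows "(\<lambda>n. LINT z|on_plate l. W z * K n z) \<longlonglongrightarrow> 0"
\<comment> \<open>Two vertical strips of width 2/n have total area 8 l / n, two horizontal ones 4 pi
  / n; the sum covers both cases.\<close>
proof (rule concentrating_kernel_tendsto_0[where E = "\<lambda>n. {z \<in> plate l. p z \<le> a + 2 / Suc n \<or> p z \<ge> b - 2 / Suc n}"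
      and C = C and D = "8 * l + 4 * pi"])
  define E where "E = (\<lambda>n. {z \<in> plate l. p z \<le> a + 2 / Suc n \<or> p z \<ge> b - 2 / Suc n})"
  have pc: "continuous_on UNIV p" using p by (auto intro: continuous_intros)
  have "{z \<in> space (on_plate l). p z \<le> a + 2 / Suc n \<or> p z \<ge> b - 2 / Suc n} \<in> sets (on_plate l)" for n
  proof -
    have [measurable]: "p \<in> borel_measurable (on_plate l)"
      by (rule continuous_measurable_plate[OF continuous_on_subset[OF pc]]) simp
    show ?thesis by measurable
  qed
  then show Es: "{z \<in> plate l. p z \<le> a + 2 / Suc n \<or> p z \<ge> b - 2 / Suc n} \<in> sets (on_plate l)" for n
    by simp
  show "measure (on_plate l) {z \<in> plate l. p z \<le> a + 2 / Suc n \<or> p z \<ge> b - 2 / Suc n} \<le> (8 * l + 4 * pi) / Suc n" for n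
  proof -
    let ?r = "2 / real (Suc n)"
    have r: "?r > 0" by simp
    have Eleb: "E n \<in> sets lebesgue" using Es[of n] by (auto simp: sets_restrict_space_iff E_def)
    have "measure (on_plate l) (E n) = measure lebesgue (E n)"
      by (rule measure_restrict_space) (auto simp: E_def)
    also have "\<dots> \<le> (8 * l + 4 * pi) / Suc n"
    proof (cases "p = fst")
      case True
      then have ab: "a = 0" "b = pi" using p by (auto simp: fun_eq_iff)
      have "measure lebesgue (E n) \<le> measure lebesgue (cbox (0, -l) (?r, l) \<union> cbox (pi - ?r, -l) (pi, l))"
        by (rule measure_mono_fmeasurable[OF _ Eleb fmeasurable.Un[OF lmeasurable_cbox lmeasurable_cbox]])
          (auto simp: E_def True ab plate_def cbox_Pair_eq)
      also have "\<dots> \<le> measure lebesgue (cbox (0, -l) (?r, l)) + measure lebesgue (cbox (pi - ?r, -l) (pi, l))"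
        by (rule measure_Un_le) auto
      also have "\<dots> = 8 * l / Suc n" using r l by (simp add: content_Pair del: of_nat_Suc)
      also have "\<dots> \<le> (8 * l + 4 * pi) / Suc n" by (intro divide_right_mono) auto
      finally show ?thesis .
    next
      case False
      then have ab: "p = snd" "a = -l" "b = l" using p by auto
      have "measure lebesgue (E n) \<le> measure lebesgue (cbox (0, -l) (pi, -l + ?r) \<union> cbox (0, l - ?r) (pi, l))"
        by (rule measure_mono_fmeasurable[OF _ Eleb fmeasurable.Un[OF lmeasurable_cbox lmeasurable_cbox]])
          (auto simp: E_def ab plate_def cbox_Pair_eq)
      also have "\<dots> \<le> measure lebesgue (cbox (0, -l) (pi, -l + ?r)) + measure lebesgue (cbox (0, l - ?r) (pi, l))"
        by (rule measure_Un_le) auto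
      also have "\<dots> = 4 * pi / Suc n" using r l by (simp add: content_Pair del: of_nat_Suc)
      also have "\<dots> \<le> (8 * l + 4 * pi) / Suc n" using l by (intro divide_right_mono) auto
      finally show ?thesis .
    qed
    finally show ?thesis by (simp add: E_def)
  qed
  fix e :: real assume "e > 0"
  have "uniformly_continuous_on (closure (plate l)) W"
    by (rule compact_uniformly_continuous[OF W]) (simp add: closure_plate_cbox l)
  then obtain d where d: "d > 0" "\<And>z z'. z \<in> closure (plate l) \<Longrightarrow> z' \<in> closure (plate l) \<Longrightarrow> dist z' z < d \<Longrightarrow> dist (W z') (W z) < e"
    unfolding uniformly_continuous_on_def using \<open>e > 0\<close> by metis
  have "(\<lambda>n. 2 / Suc n) \<longlonglongrightarrow> 0"
    using LIMSEQ_Suc[OF lim_const_over_n[of 2]] by simp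
  then have "\<forall>\<^sub>F n in sequentially. 2 / Suc n < d" using d(1) by (rule order_tendstoD)
  then show "\<forall>\<^sub>F n in sequentially. \<forall>z\<in>{z \<in> plate l. p z \<le> a + 2 / Suc n \<or> p z \<ge> b - 2 / Suc n}. \<bar>W z\<bar> \<le> e"
  proof eventually_elim
    case (elim n)
    show ?case
    proof
      fix z assume z: "z \<in> {z \<in> plate l. p z \<le> a + 2 / Suc n \<or> p z \<ge> b - 2 / Suc n}"
      obtain x y where xy: "z = (x, y)" by fastforce
      have in1: "x \<in> {0<..<pi}" "y \<in> {-l<..<l}" using z xy by (auto simp: plate_def)
      \<comment> \<open>The projection of \<open>z\<close> onto the nearby edge is at distance at
        most 2/n, and \<open>W\<close> vanishes there.\<close>
      obtain z' where z': "z' \<in> closure (plate l)" "W z' = 0" "dist z' z < d"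
      proof (cases "p z \<le> a + 2 / Suc n")
        case True
        show ?thesis
          using p True in1 elim that[of "(0, y)"] that[of "(x, -l)"]
          by (auto simp: closure_plate[OF l] xy dist_Pair_Pair dist_real_def)
      next
        case False
        then have "p z \<ge> b - 2 / Suc n" using z by simp
        then show ?thesis
          using p in1 elim that[of "(pi, y)"] that[of "(x, l)"]
          by (auto simp: closure_plate[OF l] xy dist_Pair_Pair dist_real_def)
      qed
      have "z \<in> closure (plate l)" using z closure_subset by blast
      from d(2)[OF this z'(1,3)] z'(2) show "\<bar>W z\<bar> \<le> e" by (simp add: dist_real_def)
    qed
  qed
next
  show "z \<in> {z \<in> plate l. p z \<le> a + 2 / Suc n \<or> p z \<ge> b - 2 / Suc n} \<Longrightarrow> \<bar>K n z\<bar> \<le> C * real (Suc n)" for n z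
    using bound by blast
  show "z \<in> space (on_plate l) \<Longrightarrow> z \<notin> {z \<in> plate l. p z \<le> a + 2 / Suc n \<or> p z \<ge> b - 2 / Suc n} \<Longrightarrow> K n z = 0" for n z
    using supp by auto
qed (use assms in \<open>auto intro: continuous_measurable_plate finite_measure_plate\<close>)

text \<open>A factor vanishing at the end points compensates one order of blow-up of a cutoff.\<close>

lemma vanishing_mult_cutoff_bound:
  fixes F :: "real \<Rightarrow> real" and \<zeta>' :: "nat \<Rightarrow> real \<Rightarrow> real"
  assumes F: "smooth F" "F a = 0" "F b = 0"
    and z: "\<And>n t. t \<in> {a + 2 / Suc n <..< b - 2 / Suc n} \<Longrightarrow> \<zeta>' n t = 0"
      "\<And>n t. \<bar>\<zeta>' n t\<bar> \<le> C * real (Suc n) ^ Suc k" "0 \<le> C"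
  obtains B where "0 \<le> B" "\<And>n t. t \<in> {a..b} \<Longrightarrow> \<bar>F t * \<zeta>' n t\<bar> \<le> B * real (Suc n) ^ k"
proof -
  obtain B where B: "0 \<le> B" "\<And>t. t \<in> {a..b} \<Longrightarrow> \<bar>deriv F t\<bar> \<le> B"
    using continuous_bounded_Icc[OF smooth_continuous_on[OF smooth_deriv[OF F(1)]]] by blast
  have lip: "\<bar>F t - F s\<bar> \<le> B * \<bar>t - s\<bar>" if "s \<in> {a..b}" "t \<in> {a..b}" for s t
    using field_differentiable_bound[of "{a..b}" F "deriv F" B t s] B that
      has_field_derivative_at_within[OF smooth_DERIV[OF F(1)]]
    by (simp add: convex_real_interval)
  show ?thesis
  \<comment> \<open>In the margins, \<open>F\<close> is at most its Lipschitz constant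
    \<open>B\<close> times the width 2/n, which turns one of the factors n in the bound
    \<open>C * real (Suc n) ^ Suc k\<close> into a constant.\<close>
  proof (rule that[of "2 * B * C"])
    show "0 \<le> 2 * B * C" using B z by simp
    fix n t assume t: "t \<in> {a..b}"
    show "\<bar>F t * \<zeta>' n t\<bar> \<le> 2 * B * C * real (Suc n) ^ k"
    proof (cases "t \<in> {a + 2 / Suc n <..< b - 2 / Suc n}")
      case True
      then show ?thesis using z B by simp
    next
      case False
      have "\<bar>F t\<bar> \<le> B * (2 / Suc n)"
      proof (cases "t \<le> a + 2 / Suc n")
        case True
        have "\<bar>F t\<bar> \<le> B * \<bar>t - a\<bar>" using lip[of a t] t F by simp
        also have "\<dots> \<le> B * (2 / Suc n)" using B True t by (intro mult_left_mono) auto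
        finally show ?thesis .
      next
        case 2: False
        have "\<bar>F t\<bar> \<le> B * \<bar>t - b\<bar>" using lip[of b t] t F by simp
        also have "\<dots> \<le> B * (2 / Suc n)" using B False 2 t by (intro mult_left_mono) auto
        finally show ?thesis .
      qed
      then have "\<bar>F t\<bar> * \<bar>\<zeta>' n t\<bar> \<le> (B * (2 / Suc n)) * (C * real (Suc n) ^ Suc k)"
        using z B by (intro mult_mono) auto
      also have "\<dots> = 2 * B * C * real (Suc n) ^ k" by (simp add: field_simps del: of_nat_Suc)
      finally show ?thesis by (simp add: abs_mult)
    qed
  qed
qed

lemma deriv_mult_smooth:
  assumes "smooth f" "smooth g"
  shows "deriv (\<lambda>t. f t * g t) = (\<lambda>t. deriv f t * g t + f t * deriv g t)"
  by (rule ext, rule DERIV_imp_deriv, rule DERIV_cong,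
      rule DERIV_mult[OF smooth_DERIV[OF assms(1)] smooth_DERIV[OF assms(2)]]) (simp add: mult.commute)

lemma deriv_deriv_mult_smooth:
  assumes "smooth f" "smooth g"
  shows "deriv (deriv (\<lambda>t. f t * g t)) = (\<lambda>t. deriv (deriv f) t * g t + (2 * (deriv f t * deriv g t) + f t * deriv (deriv g) t))"
proof
  fix t
  have "(deriv (\<lambda>t. f t * g t) has_real_derivative
      (deriv (deriv f) t * g t + deriv g t * deriv f t) + (deriv f t * deriv g t + deriv (deriv g) t * f t)) (at t)"
    unfolding deriv_mult_smooth[OF assms]
    by (intro DERIV_add DERIV_mult smooth_DERIV smooth_deriv assms)
  then show "deriv (deriv (\<lambda>t. f t * g t)) t =
      deriv (deriv f) t * g t + (2 * (deriv f t * deriv g t) + f t * deriv (deriv g) t)"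
    by (simp add: DERIV_imp_deriv algebra_simps)
qed

lemma eventually_const_tendsto:
  fixes f :: "nat \<Rightarrow> real \<Rightarrow> real"
  assumes "\<And>n t. t \<in> {a + 2 / Suc n <..< b - 2 / Suc n} \<Longrightarrow> f n t = c" "t \<in> {a<..<b}"
  shows "(\<lambda>n. f n t) \<longlonglongrightarrow> c"
proof (rule tendsto_eventually)
  show "\<forall>\<^sub>F n in sequentially. f n t = c"
    using eventually_in_shrinking_interval[OF assms(2)] by eventually_elim (rule assms(1))
qed

lemma H2_star_D:
  assumes "v \<in> H2_star l"
  shows "v \<in> H2 (plate l)" "continuous_on (closure (plate l)) v"
  using assms by (auto simp: H2_star_def)

text \<open>\<open>H2_star\<close> prescribes the zero values on the open sides only; continuity on
  the closed rectangle adds the corners.\<close>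

lemma H2_star_zero_sides:
  assumes l: "l > 0" and v: "v \<in> H2_star l" and y: "y \<in> {-l..l}"
  shows "v (0, y) = 0" "v (pi, y) = 0"
proof -
  have "v (x, y) = 0" if x: "x = 0 \<or> x = pi" for x
  proof (rule continuous_constant_on_closure[where S = "{-l<..<l}" and f = "\<lambda>y. v (x, y)"])
    show "continuous_on (closure {-l<..<l}) (\<lambda>y. v (x, y))"
      using l x by (intro continuous_on_compose2[OF H2_star_D(2)[OF v]] continuous_intros)
        (auto simp: closure_plate)
    show "v (x, t) = 0" if "t \<in> {-l<..<l}" for t
      using v x that by (auto simp: H2_star_def)
    show "y \<in> closure {-l<..<l}" using y l by simp
  qed
  then show "v (0, y) = 0" "v (pi, y) = 0" by auto
qed

context
  fixes l :: real and v v20 v11 v02 :: "real \<times> real \<Rightarrow> real"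
  assumes l: "l > 0" and v: "v \<in> H2_star l"
    and v20: "v20 \<in> L2 (plate l)" "has_weak_derivative (plate l) 2 0 v v20"
    and v11: "v11 \<in> L2 (plate l)" "has_weak_derivative (plate l) 1 1 v v11"
    and v02: "v02 \<in> L2 (plate l)" "has_weak_derivative (plate l) 0 2 v v02"
begin

text \<open>The starting point for all integrations by parts: both factors have compact support
  inside, and for order two the sign in the definition of weak derivatives is positive.\<close>

lemma weak_derivative_tensor:
  assumes "smooth a" "smooth b" "\<And>x. a x \<noteq> 0 \<Longrightarrow> x \<in> {p..q}" "\<And>y. b y \<noteq> 0 \<Longrightarrow> y \<in> {r..s}"
    "0 < p" "q < pi" "-l < r" "s < l"
  shows "(LINT z|on_plate l. v z * tensor (deriv (deriv a)) b z) = (LINT z|on_plate l. v20 z * tensor a b z)"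
    "(LINT z|on_plate l. v z * tensor (deriv a) (deriv b) z) = (LINT z|on_plate l. v11 z * tensor a b z)"
    "(LINT z|on_plate l. v z * tensor a (deriv (deriv b)) z) = (LINT z|on_plate l. v02 z * tensor a b z)"
proof -
  have T: "tensor a b \<in> test_functions (plate l)"
    using assms by (intro tensor_test_functions[OF assms(1-4)]) (auto simp: plate_def)
  show "(LINT z|on_plate l. v z * tensor (deriv (deriv a)) b z) = (LINT z|on_plate l. v20 z * tensor a b z)"
    using bspec[OF v20(2)[unfolded has_weak_derivative_def] T, unfolded partial_funpow_tensor[OF assms(1,2)]]
    by (simp add: numeral_2_eq_2)
  show "(LINT z|on_plate l. v z * tensor (deriv a) (deriv b) z) = (LINT z|on_plate l. v11 z * tensor a b z)"
    using bspec[OF v11(2)[unfolded has_weak_derivative_def] T, unfolded partial_funpow_tensor[OF assms(1,2)]]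
    by simp
  show "(LINT z|on_plate l. v z * tensor a (deriv (deriv b)) z) = (LINT z|on_plate l. v02 z * tensor a b z)"
    using bspec[OF v02(2)[unfolded has_weak_derivative_def] T, unfolded partial_funpow_tensor[OF assms(1,2)]]
    by (simp add: numeral_2_eq_2)
qed

text \<open>The factor \<open>b\<close> keeps its compact support, while the restriction on the
  support of \<open>a\<close> is removed by cutoffs in x. Only the pure second x-derivative needs
  \<open>a\<close> to vanish at 0 and pi: the second derivative of the cutoff is of size n^2, and
  the zero of \<open>a\<close> brings it down to n. One derivative of the cutoff is of size n
  already, and none occurs for the y-derivatives. What remains of size n is removed by the zeros of
  \<open>v\<close> on the sides.\<close>

lemma green_x:
  assumes a: "smooth a" and b: "smooth b" "\<And>y. b y \<noteq> 0 \<Longrightarrow> y \<in> {r..s}" "-l < r" "s < l"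
  shows "a 0 = 0 \<Longrightarrow> a pi = 0 \<Longrightarrow>
      (LINT z|on_plate l. v20 z * tensor a b z) = (LINT z|on_plate l. v z * tensor (deriv (deriv a)) b z)"
    "(LINT z|on_plate l. v11 z * tensor a b z) = (LINT z|on_plate l. v z * tensor (deriv a) (deriv b) z)"
    "(LINT z|on_plate l. v02 z * tensor a b z) = (LINT z|on_plate l. v z * tensor a (deriv (deriv b)) z)"
proof -
  obtain \<zeta> C where z: "\<And>n. smooth (\<zeta> n)" "\<And>n t. 0 \<le> \<zeta> n t" "\<And>n t. \<zeta> n t \<le> 1"
    "\<And>n t. \<zeta> n t \<noteq> 0 \<Longrightarrow> t \<in> {0 + 1 / Suc n .. pi - 1 / Suc n}"
    "\<And>n t. t \<in> {0 + 2 / Suc n <..< pi - 2 / Suc n} \<Longrightarrow> \<zeta> n t = 1"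
    "\<And>n t. t \<in> {0 + 2 / Suc n <..< pi - 2 / Suc n} \<Longrightarrow> deriv (\<zeta> n) t = 0"
    "\<And>n t. t \<in> {0 + 2 / Suc n <..< pi - 2 / Suc n} \<Longrightarrow> deriv (deriv (\<zeta> n)) t = 0"
    "\<And>n t. \<bar>deriv (\<zeta> n) t\<bar> \<le> C * real (Suc n)" "\<And>n t. \<bar>deriv (deriv (\<zeta> n)) t\<bar> \<le> C * (real (Suc n))\<^sup>2"
    "0 \<le> C"
    by (rule cutoff_family[of 0 pi]) blast
  note sm = a b(1) z(1) smooth_mult smooth_add smooth_const smooth_deriv
  note cont = continuous_intros tensor_continuous_on smooth_continuous_on sm
  have vint: "integrable (on_plate l) v"
    by (rule continuous_integrable_plate[OF l H2_star_D(2)[OF v]])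
  have lim: "(\<lambda>n. LINT z|on_plate l. h z * tensor (\<lambda>t. f t * \<zeta> n t) g z) \<longlonglongrightarrow> (LINT z|on_plate l. h z * tensor f g z)"
    if h: "integrable (on_plate l) h" and fg: "smooth f" "smooth g" for h f g
  proof -
    obtain B where B: "\<And>z. z \<in> closure (plate l) \<Longrightarrow> \<bar>tensor f g z\<bar> \<le> B"
      using continuous_bounded_on_closure[OF l tensor_continuous_on] fg smooth_continuous_on by metis
    show ?thesis
    proof (rule integral_mult_tendsto[OF h, where B = B])
      show "tensor (\<lambda>t. f t * \<zeta> n t) g \<in> borel_measurable (on_plate l)" for n
        by (intro continuous_measurable_plate cont fg)
      fix z assume "z \<in> space (on_plate l)"
      then have "z \<in> plate l" by simp
      then have z1: "z \<in> closure (plate l)" "fst z \<in> {0<..<pi}"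
        using subsetD[OF closure_subset, of z "plate l"] by (simp, auto simp: plate_def)
      show "\<bar>tensor (\<lambda>t. f t * \<zeta> n t) g z\<bar> \<le> B" for n
      proof -
        have "\<bar>tensor f g z\<bar> * \<zeta> n (fst z) \<le> \<bar>tensor f g z\<bar> * 1"
          using z(3) by (intro mult_left_mono) auto
        moreover have "\<bar>tensor (\<lambda>t. f t * \<zeta> n t) g z\<bar> = \<bar>tensor f g z\<bar> * \<zeta> n (fst z)"
          using z(2) by (simp add: tensor_def abs_mult)
        ultimately show ?thesis using B[OF z1(1)] by linarith
      qed
      show "(\<lambda>n. tensor (\<lambda>t. f t * \<zeta> n t) g z) \<longlonglongrightarrow> tensor f g z"
        unfolding tensor_def
        using eventually_const_tendsto[where f = \<zeta>, OF z(5) z1(2)]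
        by (auto intro!: tendsto_eq_intros)
    qed
  qed
  \<comment> \<open>Here the hinge condition enters: \<open>v\<close> vanishes on the vertical
    edges, where the kernels concentrate.\<close>
  have kernel: "(\<lambda>n. LINT z|on_plate l. v z * tensor (\<kappa> n) g z) \<longlonglongrightarrow> 0"
    if k: "\<And>n. continuous_on UNIV (\<kappa> n)" "\<And>n t. t \<in> {0..pi} \<Longrightarrow> \<bar>\<kappa> n t\<bar> \<le> D * real (Suc n)" "0 \<le> D"
      "\<And>n t. t \<in> {0 + 2 / Suc n <..< pi - 2 / Suc n} \<Longrightarrow> \<kappa> n t = 0" and g: "smooth g"
    for \<kappa> :: "nat \<Rightarrow> real \<Rightarrow> real" and D g
  proof -
    obtain B where B: "0 \<le> B" "\<And>t. t \<in> {-l..l} \<Longrightarrow> \<bar>g t\<bar> \<le> B"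
      using continuous_bounded_Icc[OF smooth_continuous_on[OF g]] by blast
    show ?thesis
    proof (rule strip_kernel_tendsto_0[OF l H2_star_D(2)[OF v], where p = fst and a = 0 and b = pi and C = "D * B"])
      show "continuous_on (closure (plate l)) (tensor (\<kappa> n) g)" for n
        by (intro tensor_continuous_on k smooth_continuous_on g)
      show "\<bar>tensor (\<kappa> n) g z\<bar> \<le> D * B * real (Suc n)" if "z \<in> plate l" for n z
      proof -
        have "\<bar>\<kappa> n (fst z)\<bar> * \<bar>g (snd z)\<bar> \<le> (D * real (Suc n)) * B"
          using that k B by (intro mult_mono) (auto simp: plate_def)
        then show ?thesis by (simp add: tensor_def abs_mult mult_ac)
      qed
      show "tensor (\<kappa> n) g z = 0" if "fst z \<in> {0 + 2 / real (Suc n)<..<pi - 2 / real (Suc n)}" for n z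
        using k(4)[OF that] by (simp add: tensor_def)
    qed (use H2_star_zero_sides[OF l v] k B in auto)
  qed
  have supp: "a t * \<zeta> n t \<noteq> 0 \<Longrightarrow> t \<in> {0 + 1 / Suc n .. pi - 1 / Suc n}" for n t
    using z(4)[of n t] by auto
  have weak:
    "(LINT z|on_plate l. v20 z * tensor (\<lambda>t. a t * \<zeta> n t) b z) = (LINT z|on_plate l. v z * tensor (deriv (deriv (\<lambda>t. a t * \<zeta> n t))) b z)"
    "(LINT z|on_plate l. v11 z * tensor (\<lambda>t. a t * \<zeta> n t) b z) = (LINT z|on_plate l. v z * tensor (deriv (\<lambda>t. a t * \<zeta> n t)) (deriv b) z)"
    "(LINT z|on_plate l. v02 z * tensor (\<lambda>t. a t * \<zeta> n t) b z) = (LINT z|on_plate l. v z * tensor (\<lambda>t. a t * \<zeta> n t) (deriv (deriv b)) z)"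
    for n
  proof -
    have pq: "0 < 0 + 1 / real (Suc n)" "pi - 1 / real (Suc n) < pi" by simp_all
    note w = weak_derivative_tensor[OF smooth_mult[OF a z(1)[of n]] b(1) _ _ pq b(3,4), symmetric]
    show "(LINT z|on_plate l. v20 z * tensor (\<lambda>t. a t * \<zeta> n t) b z) = (LINT z|on_plate l. v z * tensor (deriv (deriv (\<lambda>t. a t * \<zeta> n t))) b z)"
      by (rule w(1)) (fact supp, fact b(2))
    show "(LINT z|on_plate l. v11 z * tensor (\<lambda>t. a t * \<zeta> n t) b z) = (LINT z|on_plate l. v z * tensor (deriv (\<lambda>t. a t * \<zeta> n t)) (deriv b) z)"
      by (rule w(2)) (fact supp, fact b(2))
    show "(LINT z|on_plate l. v02 z * tensor (\<lambda>t. a t * \<zeta> n t) b z) = (LINT z|on_plate l. v z * tensor (\<lambda>t. a t * \<zeta> n t) (deriv (deriv b)) z)"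
      by (rule w(3)) (fact supp, fact b(2))
  qed
  show "(LINT z|on_plate l. v20 z * tensor a b z) = (LINT z|on_plate l. v z * tensor (deriv (deriv a)) b z)"
    if a0: "a 0 = 0" "a pi = 0"
  proof (rule LIMSEQ_unique)
    show "(\<lambda>n. LINT z|on_plate l. v20 z * tensor (\<lambda>t. a t * \<zeta> n t) b z) \<longlonglongrightarrow> (LINT z|on_plate l. v20 z * tensor a b z)"
      by (intro lim L2_integrable_plate v20 sm)
    have "(\<lambda>n. (LINT z|on_plate l. v z * tensor (\<lambda>t. deriv (deriv a) t * \<zeta> n t) b z) +
        (LINT z|on_plate l. v z * tensor (\<lambda>t. 2 * (deriv a t * deriv (\<zeta> n) t) + a t * deriv (deriv (\<zeta> n)) t) b z)) \<longlonglongrightarrow>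
        (LINT z|on_plate l. v z * tensor (deriv (deriv a)) b z) + 0"
    proof (intro tendsto_add lim vint sm)
      obtain B1 where B1: "0 \<le> B1" "\<And>t. t \<in> {0..pi} \<Longrightarrow> \<bar>deriv a t\<bar> \<le> B1"
        using continuous_bounded_Icc[OF smooth_continuous_on[OF smooth_deriv[OF a]]] by blast
      obtain B2 where B2: "0 \<le> B2" "\<And>n t. t \<in> {0..pi} \<Longrightarrow> \<bar>a t * deriv (deriv (\<zeta> n)) t\<bar> \<le> B2 * real (Suc n) ^ 1"
        using vanishing_mult_cutoff_bound[OF a a0, of "\<lambda>n. deriv (deriv (\<zeta> n))" C 1] z(7,9,10)
        by (auto simp: numeral_2_eq_2)
      show "(\<lambda>n. LINT z|on_plate l. v z * tensor (\<lambda>t. 2 * (deriv a t * deriv (\<zeta> n) t) + a t * deriv (deriv (\<zeta> n)) t) b z) \<longlonglongrightarrow> 0"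
      proof (rule kernel[where D = "2 * (B1 * C) + B2"])
        fix n t assume t: "t \<in> {0..pi}"
        have "\<bar>deriv a t * deriv (\<zeta> n) t\<bar> \<le> B1 * (C * real (Suc n))"
          unfolding abs_mult using B1 z(8) t by (intro mult_mono) auto
        then show "\<bar>2 * (deriv a t * deriv (\<zeta> n) t) + a t * deriv (deriv (\<zeta> n)) t\<bar> \<le> (2 * (B1 * C) + B2) * real (Suc n)"
          using B2(2)[OF t, of n] by (simp only: distrib_right power_one_right mult.assoc)
      qed (use z B1 B2 in \<open>auto intro!: cont\<close>)
    qed
    moreover have "(LINT z|on_plate l. v20 z * tensor (\<lambda>t. a t * \<zeta> n t) b z) =
        (LINT z|on_plate l. v z * tensor (\<lambda>t. deriv (deriv a) t * \<zeta> n t) b z) +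
        (LINT z|on_plate l. v z * tensor (\<lambda>t. 2 * (deriv a t * deriv (\<zeta> n) t) + a t * deriv (deriv (\<zeta> n)) t) b z)" for n
    proof -
      have "(LINT z|on_plate l. v20 z * tensor (\<lambda>t. a t * \<zeta> n t) b z) =
        (LINT z|on_plate l. v z * tensor (\<lambda>t. deriv (deriv a) t * \<zeta> n t) b z +
           v z * tensor (\<lambda>t. 2 * (deriv a t * deriv (\<zeta> n) t) + a t * deriv (deriv (\<zeta> n)) t) b z)"
        unfolding weak(1) deriv_deriv_mult_smooth[OF a z(1)]
        by (simp add: tensor_def distrib_left distrib_right)
      also have "\<dots> = (LINT z|on_plate l. v z * tensor (\<lambda>t. deriv (deriv a) t * \<zeta> n t) b z) +
        (LINT z|on_plate l. v z * tensor (\<lambda>t. 2 * (deriv a t * deriv (\<zeta> n) t) + a t * deriv (deriv (\<zeta> n)) t) b z)"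
        by (intro Bochner_Integration.integral_add continuous_integrable_plate[OF l] cont H2_star_D[OF v])
      finally show ?thesis .
    qed
    ultimately show "(\<lambda>n. LINT z|on_plate l. v20 z * tensor (\<lambda>t. a t * \<zeta> n t) b z) \<longlonglongrightarrow>
      (LINT z|on_plate l. v z * tensor (deriv (deriv a)) b z)" by simp
  qed
  show "(LINT z|on_plate l. v11 z * tensor a b z) = (LINT z|on_plate l. v z * tensor (deriv a) (deriv b) z)"
  proof (rule LIMSEQ_unique)
    show "(\<lambda>n. LINT z|on_plate l. v11 z * tensor (\<lambda>t. a t * \<zeta> n t) b z) \<longlonglongrightarrow> (LINT z|on_plate l. v11 z * tensor a b z)"
      by (intro lim L2_integrable_plate v11 sm)
    have "(\<lambda>n. (LINT z|on_plate l. v z * tensor (\<lambda>t. deriv a t * \<zeta> n t) (deriv b) z) +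
        (LINT z|on_plate l. v z * tensor (\<lambda>t. a t * deriv (\<zeta> n) t) (deriv b) z)) \<longlonglongrightarrow>
        (LINT z|on_plate l. v z * tensor (deriv a) (deriv b) z) + 0"
    proof (intro tendsto_add lim vint sm)
      obtain B1 where B1: "0 \<le> B1" "\<And>t. t \<in> {0..pi} \<Longrightarrow> \<bar>a t\<bar> \<le> B1"
        using continuous_bounded_Icc[OF smooth_continuous_on[OF a]] by blast
      show "(\<lambda>n. LINT z|on_plate l. v z * tensor (\<lambda>t. a t * deriv (\<zeta> n) t) (deriv b) z) \<longlonglongrightarrow> 0"
      proof (rule kernel[where D = "B1 * C"])
        fix n t assume t: "t \<in> {0..pi}"
        have "\<bar>a t * deriv (\<zeta> n) t\<bar> \<le> B1 * (C * real (Suc n))"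
          unfolding abs_mult using B1 z(8) t by (intro mult_mono) auto
        then show "\<bar>a t * deriv (\<zeta> n) t\<bar> \<le> B1 * C * real (Suc n)"
          by (simp only: mult.assoc)
      qed (use z B1 in \<open>auto intro!: cont\<close>)
    qed
    moreover have "(LINT z|on_plate l. v11 z * tensor (\<lambda>t. a t * \<zeta> n t) b z) =
        (LINT z|on_plate l. v z * tensor (\<lambda>t. deriv a t * \<zeta> n t) (deriv b) z) +
        (LINT z|on_plate l. v z * tensor (\<lambda>t. a t * deriv (\<zeta> n) t) (deriv b) z)" for n
    proof -
      have "(LINT z|on_plate l. v11 z * tensor (\<lambda>t. a t * \<zeta> n t) b z) =
        (LINT z|on_plate l. v z * tensor (\<lambda>t. deriv a t * \<zeta> n t) (deriv b) z +
           v z * tensor (\<lambda>t. a t * deriv (\<zeta> n) t) (deriv b) z)"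
        unfolding weak(2) deriv_mult_smooth[OF a z(1)]
        by (simp add: tensor_def distrib_left distrib_right)
      also have "\<dots> = (LINT z|on_plate l. v z * tensor (\<lambda>t. deriv a t * \<zeta> n t) (deriv b) z) +
        (LINT z|on_plate l. v z * tensor (\<lambda>t. a t * deriv (\<zeta> n) t) (deriv b) z)"
        by (intro Bochner_Integration.integral_add continuous_integrable_plate[OF l] cont H2_star_D[OF v])
      finally show ?thesis .
    qed
    ultimately show "(\<lambda>n. LINT z|on_plate l. v11 z * tensor (\<lambda>t. a t * \<zeta> n t) b z) \<longlonglongrightarrow>
      (LINT z|on_plate l. v z * tensor (deriv a) (deriv b) z)" by simp
  qed
  show "(LINT z|on_plate l. v02 z * tensor a b z) = (LINT z|on_plate l. v z * tensor a (deriv (deriv b)) z)"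
  proof (rule LIMSEQ_unique)
    show "(\<lambda>n. LINT z|on_plate l. v02 z * tensor (\<lambda>t. a t * \<zeta> n t) b z) \<longlonglongrightarrow> (LINT z|on_plate l. v02 z * tensor a b z)"
      by (intro lim L2_integrable_plate v02 sm)
    show "(\<lambda>n. LINT z|on_plate l. v02 z * tensor (\<lambda>t. a t * \<zeta> n t) b z) \<longlonglongrightarrow>
      (LINT z|on_plate l. v z * tensor a (deriv (deriv b)) z)"
      unfolding weak(3) by (intro lim vint sm)
  qed
qed

text \<open>Two boundary terms survive the cutoff \<open>\<eta>\<close> in \<open>y\<close>. The one with the factor \<open>deriv Q - m * R\<close>
  stays bounded by the boundary conditions. The other one contains the derivative of \<open>Q * deriv \<eta>\<close>,
  which concentrates at the edges; it is treated by subtracting from \<open>v\<close> the affine interpolation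
  in \<open>y\<close> of its values at the edges, for which one more integration by parts is possible.\<close>

lemma green_formula:
  assumes s: "smooth s" "s 0 = 0" "s pi = 0" "\<And>x. deriv (deriv s) x = - m\<^sup>2 * s x"
    and c: "smooth c" "\<And>x. deriv c x = - m * s x"
    and PQR: "smooth P" "smooth Q" "smooth R" "Q l = 0" "Q (-l) = 0"
      "deriv Q l = m * R l" "deriv Q (-l) = m * R (-l)"
  shows "(LINT z|on_plate l. v20 z * tensor s P z) + (LINT z|on_plate l. v02 z * tensor s Q z) +
      (LINT z|on_plate l. v11 z * tensor c R z) =
    (LINT z|on_plate l. v z * tensor s (\<lambda>y. - m\<^sup>2 * P y + deriv (deriv Q) y - m * deriv R y) z)"
proof -
  obtain \<eta> C where e: "\<And>n. smooth (\<eta> n)" "\<And>n t. 0 \<le> \<eta> n t" "\<And>n t. \<eta> n t \<le> 1"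
    "\<And>n t. \<eta> n t \<noteq> 0 \<Longrightarrow> t \<in> {-l + 1 / Suc n .. l - 1 / Suc n}"
    "\<And>n t. t \<in> {-l + 2 / Suc n <..< l - 2 / Suc n} \<Longrightarrow> \<eta> n t = 1"
    "\<And>n t. t \<in> {-l + 2 / Suc n <..< l - 2 / Suc n} \<Longrightarrow> deriv (\<eta> n) t = 0"
    "\<And>n t. t \<in> {-l + 2 / Suc n <..< l - 2 / Suc n} \<Longrightarrow> deriv (deriv (\<eta> n)) t = 0"
    "\<And>n t. \<bar>deriv (\<eta> n) t\<bar> \<le> C * real (Suc n)" "\<And>n t. \<bar>deriv (deriv (\<eta> n)) t\<bar> \<le> C * (real (Suc n))\<^sup>2"
    "0 \<le> C"
    by (rule cutoff_family[of "-l" l]) blast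
  \<comment> \<open>The terms of the product rule are sorted by the cutoff: \<open>F\<close>
    multiplies \<eta>, \<open>G\<close> multiplies its derivative, and \<kappa> is the derivative of
    Q times the derivative of \<eta>. Of the two copies of \<open>deriv Q * deriv \<eta>\<close> one
    goes into \<open>G\<close> and one into \<kappa>.\<close>
  define F where "F = (\<lambda>y. - m\<^sup>2 * P y + deriv (deriv Q) y + (- m) * deriv R y)"
  define G where "G = (\<lambda>y. deriv Q y + (- m) * R y)"
  define \<kappa> where "\<kappa> = (\<lambda>n y. deriv Q y * deriv (\<eta> n) y + Q y * deriv (deriv (\<eta> n)) y)"
  note sm = s(1) c(1) PQR(1-3) e(1) smooth_mult smooth_add smooth_const smooth_deriv
  have "smooth F" "smooth G" unfolding F_def G_def by (intro sm)+
  then have FG: "smooth F" "smooth G" "G (-l) = 0" "G l = 0"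
    using PQR by (simp_all add: G_def)
  note cont = continuous_intros tensor_continuous_on smooth_continuous_on sm FG(1,2)
  have vc: "continuous_on (closure (plate l)) v" by (rule H2_star_D(2)[OF v])
  have vint: "integrable (on_plate l) v"
    by (rule continuous_integrable_plate[OF l vc])
  have lim: "(\<lambda>n. LINT z|on_plate l. h z * tensor f (\<lambda>t. g t * \<psi> n t) z) \<longlonglongrightarrow> (LINT z|on_plate l. h z * tensor f (\<lambda>t. g t * d) z)"
    if h: "integrable (on_plate l) h" and f: "smooth f"
      and g: "smooth g" "\<And>n. smooth (\<psi> n)" "\<And>n t. t \<in> {-l..l} \<Longrightarrow> \<bar>g t * \<psi> n t\<bar> \<le> B"
        "\<And>n t. t \<in> {-l + 2 / Suc n <..< l - 2 / Suc n} \<Longrightarrow> \<psi> n t = d"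
    for h f g B d and \<psi> :: "nat \<Rightarrow> real \<Rightarrow> real"
  proof -
    obtain A where A: "0 \<le> A" "\<And>t. t \<in> {0..pi} \<Longrightarrow> \<bar>f t\<bar> \<le> A"
      using continuous_bounded_Icc[OF smooth_continuous_on[OF f]] by blast
    show ?thesis
    proof (rule integral_mult_tendsto[OF h, where B = "A * B"])
      show "tensor f (\<lambda>t. g t * \<psi> n t) \<in> borel_measurable (on_plate l)" for n
        by (intro continuous_measurable_plate cont f g)
      fix z assume "z \<in> space (on_plate l)"
      then have z1: "fst z \<in> {0..pi}" "snd z \<in> {-l<..<l}" "snd z \<in> {-l..l}"
        by (auto simp: plate_def)
      show "\<bar>tensor f (\<lambda>t. g t * \<psi> n t) z\<bar> \<le> A * B" for n
        unfolding tensor_def abs_mult[of "f _"] using A g(3) z1 by (intro mult_mono) auto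
      show "(\<lambda>n. tensor f (\<lambda>t. g t * \<psi> n t) z) \<longlonglongrightarrow> tensor f (\<lambda>t. g t * d) z"
        unfolding tensor_def
        by (intro tendsto_mult tendsto_const eventually_const_tendsto[where f = \<psi>, OF g(4) z1(2)])
    qed
  qed
  have lim1: "(\<lambda>n. LINT z|on_plate l. h z * tensor f (\<lambda>t. g t * \<eta> n t) z) \<longlonglongrightarrow> (LINT z|on_plate l. h z * tensor f g z)"
    if h: "integrable (on_plate l) h" and f: "smooth f" and g: "smooth g" for h f g
  proof -
    obtain B where B: "0 \<le> B" "\<And>t. t \<in> {-l..l} \<Longrightarrow> \<bar>g t\<bar> \<le> B"
      using continuous_bounded_Icc[OF smooth_continuous_on[OF g]] by blast
    have "\<bar>g t * \<eta> n t\<bar> \<le> B" if "t \<in> {-l..l}" for n t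
    proof -
      have "\<bar>g t\<bar> * \<bar>\<eta> n t\<bar> \<le> B * 1"
        using B e(2,3)[of n t] that by (intro mult_mono) auto
      then show ?thesis by (simp add: abs_mult)
    qed
    from lim[of h f g \<eta> B 1, OF h f g e(1) this e(5)] show ?thesis by simp
  qed
  \<comment> \<open>A zero of \<open>g\<close> at both ends makes \<open>g\<close> times the
    derivative of \<eta> uniformly bounded, and this product is eventually 0 at each interior
    point.\<close>
  have lim0: "(\<lambda>n. LINT z|on_plate l. h z * tensor f (\<lambda>t. g t * deriv (\<eta> n) t) z) \<longlonglongrightarrow> 0"
    if h: "integrable (on_plate l) h" and f: "smooth f" and g: "smooth g" "g (-l) = 0" "g l = 0" for h f g
  proof -
    obtain B where B: "0 \<le> B" "\<And>n t. t \<in> {-l..l} \<Longrightarrow> \<bar>g t * deriv (\<eta> n) t\<bar> \<le> B * real (Suc n) ^ 0"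
      using vanishing_mult_cutoff_bound[OF g, of "\<lambda>n. deriv (\<eta> n)" C 0] e(6,8,10) by auto
    then have "\<bar>g t * deriv (\<eta> n) t\<bar> \<le> B" if "t \<in> {-l..l}" for n t using that by simp
    from lim[of h f g "\<lambda>n. deriv (\<eta> n)" B 0, OF h f g(1) smooth_deriv[OF e(1)] this e(6)] show ?thesis
      by (simp add: tensor_def)
  qed
  have T3: "(\<lambda>n. LINT z|on_plate l. v z * tensor s (\<kappa> n) z) \<longlonglongrightarrow> 0"
  proof -
    \<comment> \<open>\<open>L\<close> is affine in y with slope \<open>q\<close>, and q depends on
      x only and is merely continuous; no x-derivative of it is ever taken.\<close>
    define q where "q = (\<lambda>x. (v (x, l) - v (x, -l)) / (2 * l))"
    define L where "L = (\<lambda>z. (v (fst z, l) + v (fst z, -l)) / 2 + snd z * q (fst z))"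
    have vc': "continuous_on (closure (plate l)) (\<lambda>z. v (fst z, t))" if "t \<in> {-l..l}" for t
      by (rule continuous_on_compose2[OF vc])
        (use that in \<open>auto intro!: continuous_intros simp: closure_plate[OF l]\<close>)
    have qc: "continuous_on (closure (plate l)) (\<lambda>z. q (fst z))"
      unfolding q_def using l by (intro continuous_intros vc') auto
    have Lc: "continuous_on (closure (plate l)) L"
      unfolding L_def using l by (intro continuous_intros vc' qc) auto
    have \<kappa>c: "smooth (\<kappa> n)" for n unfolding \<kappa>_def by (intro sm)
    obtain A where A: "0 \<le> A" "\<And>t. t \<in> {0..pi} \<Longrightarrow> \<bar>s t\<bar> \<le> A"
      using continuous_bounded_Icc[OF smooth_continuous_on[OF s(1)]] by blast
    obtain B1 where B1: "0 \<le> B1" "\<And>t. t \<in> {-l..l} \<Longrightarrow> \<bar>deriv Q t\<bar> \<le> B1"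
      using continuous_bounded_Icc[OF smooth_continuous_on[OF smooth_deriv[OF PQR(2)]]] by blast
    obtain B2 where B2: "0 \<le> B2" "\<And>n t. t \<in> {-l..l} \<Longrightarrow> \<bar>Q t * deriv (deriv (\<eta> n)) t\<bar> \<le> B2 * real (Suc n) ^ 1"
      using vanishing_mult_cutoff_bound[OF PQR(2,5,4), of "\<lambda>n. deriv (deriv (\<eta> n))" C 1] e(7,9,10)
      by (auto simp: numeral_2_eq_2)
    have \<kappa>b: "\<bar>\<kappa> n t\<bar> \<le> (B1 * C + B2) * real (Suc n)" if t: "t \<in> {-l..l}" for n t
    proof -
      have "\<bar>deriv Q t * deriv (\<eta> n) t\<bar> \<le> B1 * (C * real (Suc n))"
        unfolding abs_mult using B1 e(8) t by (intro mult_mono) auto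
      then show ?thesis
        using B2(2)[OF t, of n] unfolding \<kappa>_def by (simp only: distrib_right power_one_right mult.assoc)
    qed
    have "(\<lambda>n. LINT z|on_plate l. (v z - L z) * tensor s (\<kappa> n) z) \<longlonglongrightarrow> 0"
    proof (rule strip_kernel_tendsto_0[OF l _ _, where p = snd and a = "-l" and b = l and C = "A * (B1 * C + B2)"])
      show "continuous_on (closure (plate l)) (\<lambda>z. v z - L z)" by (intro continuous_intros vc Lc)
      show "continuous_on (closure (plate l)) (tensor s (\<kappa> n))" for n by (intro cont \<kappa>c)
      show "\<bar>tensor s (\<kappa> n) z\<bar> \<le> A * (B1 * C + B2) * real (Suc n)" if z: "z \<in> plate l" for n z
      proof -
        have "\<bar>s (fst z)\<bar> * \<bar>\<kappa> n (snd z)\<bar> \<le> A * ((B1 * C + B2) * real (Suc n))"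
          using A \<kappa>b z by (intro mult_mono) (auto simp: plate_def)
        then show ?thesis by (simp add: tensor_def abs_mult mult_ac)
      qed
      show "tensor s (\<kappa> n) z = 0" if "snd z \<in> {-l + 2 / real (Suc n)<..<l - 2 / real (Suc n)}" for n z
        using e(6,7)[OF that] by (simp add: tensor_def \<kappa>_def)
      have "v (x, -l) - L (x, -l) = 0 \<and> v (x, l) - L (x, l) = 0" for x
        using l by (simp add: L_def q_def field_simps)
      then show "snd = fst \<and> -l = 0 \<and> l = pi \<and> (\<forall>y\<in>{-l..l}. v (0, y) - L (0, y) = 0 \<and> v (pi, y) - L (pi, y) = 0) \<or>
          snd = snd \<and> -l = -l \<and> l = l \<and> (\<forall>x\<in>{0..pi}. v (x, -l) - L (x, -l) = 0 \<and> v (x, l) - L (x, l) = 0)"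
        by blast
    qed (use A B1 B2 e in auto)
    moreover have "(\<lambda>n. LINT z|on_plate l. L z * tensor s (\<kappa> n) z) \<longlonglongrightarrow> 0"
    proof -
      have qint: "integrable (on_plate l) (\<lambda>z. q (fst z))" by (rule continuous_integrable_plate[OF l qc])
      \<comment> \<open>Since \<kappa> is a y-derivative, it can be integrated by parts against
        \<open>L\<close>: the boundary terms vanish with \<open>Q\<close>, and the remaining term
        has the bounded factor treated by \<open>lim0\<close>.\<close>
      have "(LINT z|on_plate l. L z * tensor s (\<kappa> n) z) = - (LINT z|on_plate l. q (fst z) * tensor s (\<lambda>t. Q t * deriv (\<eta> n) t) z)" for n
      proof -
        have "integral {-l..l} (\<lambda>y. L (x, y) * tensor s (\<kappa> n) (x, y) + q x * tensor s (\<lambda>t. Q t * deriv (\<eta> n) t) (x, y)) = 0" for x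
        proof (rule integral_derivative_eq_0[where F = "\<lambda>y. L (x, y) * (s x * (Q y * deriv (\<eta> n) y))"])
          fix y
          show "((\<lambda>y. L (x, y) * (s x * (Q y * deriv (\<eta> n) y))) has_real_derivative
              L (x, y) * tensor s (\<kappa> n) (x, y) + q x * tensor s (\<lambda>t. Q t * deriv (\<eta> n) t) (x, y)) (at y)"
            unfolding L_def tensor_def \<kappa>_def fst_conv snd_conv
            by (rule derivative_eq_intros smooth_DERIV[OF PQR(2)] smooth_DERIV[OF smooth_deriv[OF e(1)]] refl)+
              (simp add: algebra_simps)
        qed (use l PQR in auto)
        then have "(LINT z|on_plate l. L z * tensor s (\<kappa> n) z + q (fst z) * tensor s (\<lambda>t. Q t * deriv (\<eta> n) t) z) = 0"
          by (subst integral_plate_continuous(1)[OF l]) (auto intro!: cont Lc qc \<kappa>c)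
        moreover have "(LINT z|on_plate l. L z * tensor s (\<kappa> n) z + q (fst z) * tensor s (\<lambda>t. Q t * deriv (\<eta> n) t) z) =
            (LINT z|on_plate l. L z * tensor s (\<kappa> n) z) + (LINT z|on_plate l. q (fst z) * tensor s (\<lambda>t. Q t * deriv (\<eta> n) t) z)"
          by (intro Bochner_Integration.integral_add continuous_integrable_plate[OF l] cont Lc qc \<kappa>c)
        ultimately show ?thesis by linarith
      qed
      then show ?thesis using tendsto_minus[OF lim0[OF qint s(1) PQR(2,5,4)]] by simp
    qed
    ultimately have "(\<lambda>n. (LINT z|on_plate l. (v z - L z) * tensor s (\<kappa> n) z) + (LINT z|on_plate l. L z * tensor s (\<kappa> n) z)) \<longlonglongrightarrow> 0 + 0"
      by (rule tendsto_add)
    moreover have "(LINT z|on_plate l. (v z - L z) * tensor s (\<kappa> n) z) + (LINT z|on_plate l. L z * tensor s (\<kappa> n) z) =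
        (LINT z|on_plate l. v z * tensor s (\<kappa> n) z)" for n
    proof -
      have "(LINT z|on_plate l. (v z - L z) * tensor s (\<kappa> n) z) + (LINT z|on_plate l. L z * tensor s (\<kappa> n) z) =
        (LINT z|on_plate l. (v z - L z) * tensor s (\<kappa> n) z + L z * tensor s (\<kappa> n) z)"
        by (rule Bochner_Integration.integral_add[symmetric]; intro continuous_integrable_plate[OF l] cont Lc vc \<kappa>c)
      then show ?thesis by (simp add: algebra_simps)
    qed
    ultimately show ?thesis by simp
  qed
  have identity: "(LINT z|on_plate l. v20 z * tensor s (\<lambda>t. P t * \<eta> n t) z) + (LINT z|on_plate l. v02 z * tensor s (\<lambda>t. Q t * \<eta> n t) z) +
      (LINT z|on_plate l. v11 z * tensor c (\<lambda>t. R t * \<eta> n t) z) =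
      (LINT z|on_plate l. v z * tensor s (\<lambda>t. F t * \<eta> n t) z) + (LINT z|on_plate l. v z * tensor s (\<lambda>t. G t * deriv (\<eta> n) t) z)
      + (LINT z|on_plate l. v z * tensor s (\<kappa> n) z)" for n
  proof -
    \<comment> \<open>With the cutoff in y in place, the second factors satisfy the support
      condition of \<open>green_x\<close>.\<close>
    have r: "-l < -l + 1 / Suc n" "l - 1 / Suc n < l" by simp_all
    note g = green_x[OF _ _ _ r]
    have g1: "(LINT z|on_plate l. v20 z * tensor s (\<lambda>t. P t * \<eta> n t) z) =
        (LINT z|on_plate l. v z * tensor (deriv (deriv s)) (\<lambda>t. P t * \<eta> n t) z)"
      by (rule g(1)) (auto simp: s sm dest!: e(4))
    have g2: "(LINT z|on_plate l. v11 z * tensor c (\<lambda>t. R t * \<eta> n t) z) =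
        (LINT z|on_plate l. v z * tensor (deriv c) (deriv (\<lambda>t. R t * \<eta> n t)) z)"
      by (rule g(2)) (auto simp: sm dest!: e(4))
    have g3: "(LINT z|on_plate l. v02 z * tensor s (\<lambda>t. Q t * \<eta> n t) z) =
        (LINT z|on_plate l. v z * tensor s (deriv (deriv (\<lambda>t. Q t * \<eta> n t))) z)"
      by (rule g(3)) (auto simp: sm dest!: e(4))
    have \<kappa>s: "smooth (\<kappa> n)" unfolding \<kappa>_def by (intro sm)
    have "(LINT z|on_plate l. v20 z * tensor s (\<lambda>t. P t * \<eta> n t) z) + (LINT z|on_plate l. v02 z * tensor s (\<lambda>t. Q t * \<eta> n t) z) +
      (LINT z|on_plate l. v11 z * tensor c (\<lambda>t. R t * \<eta> n t) z) =
      (LINT z|on_plate l. v z * tensor (deriv (deriv s)) (\<lambda>t. P t * \<eta> n t) z + v z * tensor s (deriv (deriv (\<lambda>t. Q t * \<eta> n t))) z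
        + v z * tensor (deriv c) (deriv (\<lambda>t. R t * \<eta> n t)) z)"
      unfolding g1 g2 g3
      by (subst Bochner_Integration.integral_add Bochner_Integration.integral_add; (intro Bochner_Integration.integrable_add continuous_integrable_plate[OF l] cont vc)?)+ simp
    also have "\<dots> = (LINT z|on_plate l. v z * tensor s (\<lambda>t. F t * \<eta> n t) z + v z * tensor s (\<lambda>t. G t * deriv (\<eta> n) t) z + v z * tensor s (\<kappa> n) z)"
      unfolding deriv_mult_smooth[OF PQR(3) e(1)] deriv_deriv_mult_smooth[OF PQR(2) e(1)]
      by (rule Bochner_Integration.integral_cong) (simp_all add: tensor_def s(4) c(2) F_def G_def \<kappa>_def algebra_simps)
    also have "\<dots> = (LINT z|on_plate l. v z * tensor s (\<lambda>t. F t * \<eta> n t) z) + (LINT z|on_plate l. v z * tensor s (\<lambda>t. G t * deriv (\<eta> n) t) z)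
      + (LINT z|on_plate l. v z * tensor s (\<kappa> n) z)"
      by (subst Bochner_Integration.integral_add Bochner_Integration.integral_add; (intro Bochner_Integration.integrable_add continuous_integrable_plate[OF l] cont vc \<kappa>s)?)+ simp
    finally show ?thesis .
  qed
  have "(LINT z|on_plate l. v20 z * tensor s P z) + (LINT z|on_plate l. v02 z * tensor s Q z) +
      (LINT z|on_plate l. v11 z * tensor c R z) = (LINT z|on_plate l. v z * tensor s F z) + 0 + 0"
  proof (rule LIMSEQ_unique)
    show "(\<lambda>n. (LINT z|on_plate l. v20 z * tensor s (\<lambda>t. P t * \<eta> n t) z) + (LINT z|on_plate l. v02 z * tensor s (\<lambda>t. Q t * \<eta> n t) z) +
      (LINT z|on_plate l. v11 z * tensor c (\<lambda>t. R t * \<eta> n t) z)) \<longlonglongrightarrow>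
      (LINT z|on_plate l. v20 z * tensor s P z) + (LINT z|on_plate l. v02 z * tensor s Q z) +
      (LINT z|on_plate l. v11 z * tensor c R z)"
      by (intro tendsto_add lim1 L2_integrable_plate v20 v02 v11 sm)
    show "(\<lambda>n. (LINT z|on_plate l. v20 z * tensor s (\<lambda>t. P t * \<eta> n t) z) + (LINT z|on_plate l. v02 z * tensor s (\<lambda>t. Q t * \<eta> n t) z) +
      (LINT z|on_plate l. v11 z * tensor c (\<lambda>t. R t * \<eta> n t) z)) \<longlonglongrightarrow> (LINT z|on_plate l. v z * tensor s F z) + 0 + 0"
      unfolding identity by (intro tendsto_add lim1 lim0 T3 vint s FG)
  qed
  then show ?thesis by (simp add: F_def)
qed

end

subsection \<open>Completeness of the functions $\sin (i x) e^{k y}$\<close>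

text \<open>Only the frequency in x is bounded: the remainder of a sine series is orthogonal to the
  first n sines times arbitrary exponentials in y.\<close>

definition sine_exp_orthogonal :: "real \<Rightarrow> (real \<times> real \<Rightarrow> real) \<Rightarrow> nat \<Rightarrow> bool" where
  "sine_exp_orthogonal l H n \<longleftrightarrow> integrable (on_plate l) H \<and>
     (\<forall>k. \<forall>i\<in>{1..n}. (LINT z|on_plate l. H z * (sin (real i * fst z) * exp (real k * snd z))) = 0)"

lemma continuous_on_plate_elementary:
  "continuous_on S (\<lambda>z::real \<times> real. sin (c * fst z))" "continuous_on S (\<lambda>z::real \<times> real. cos (fst z))"
  "continuous_on S (\<lambda>z::real \<times> real. exp (c * snd z))" "continuous_on S (\<lambda>z::real \<times> real. exp (snd z))"
  by (auto intro!: continuous_intros)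

lemma sine_exp_orthogonalD:
  "sine_exp_orthogonal l H n \<Longrightarrow> 1 \<le> i \<Longrightarrow> i \<le> n \<Longrightarrow>
    (LINT z|on_plate l. H z * (sin (real i * fst z) * exp (real k * snd z))) = 0"
  by (simp add: sine_exp_orthogonal_def)

lemma sine_exp_orthogonal_mono:
  "sine_exp_orthogonal l H n \<Longrightarrow> k \<le> n \<Longrightarrow> sine_exp_orthogonal l H k"
  by (auto simp: sine_exp_orthogonal_def)

lemma sine_exp_orthogonal_integrable:
  assumes "l > 0" "sine_exp_orthogonal l H n" "continuous_on (closure (plate l)) f"
  shows "integrable (on_plate l) (\<lambda>z. H z * f z)"
  using assms by (intro integrable_mult_continuous_plate) (auto simp: sine_exp_orthogonal_def)

text \<open>Multiplication by a function of the following algebra lowers the order of orthogonality by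
  a fixed amount only.\<close>

definition degree_lowering :: "real \<Rightarrow> (real \<times> real \<Rightarrow> real) set" where
  "degree_lowering l = {f. continuous_on (closure (plate l)) f \<and>
     (\<exists>N. \<forall>H n. sine_exp_orthogonal l H (n + N) \<longrightarrow> sine_exp_orthogonal l (\<lambda>z. H z * f z) n)}"

lemma degree_loweringI:
  assumes "continuous_on (closure (plate l)) f"
    "\<And>H n. sine_exp_orthogonal l H (n + N) \<Longrightarrow> sine_exp_orthogonal l (\<lambda>z. H z * f z) n"
  shows "f \<in> degree_lowering l"
  unfolding degree_lowering_def mem_Collect_eq by (intro conjI exI[of _ N] allI impI assms)

lemma degree_loweringE:
  assumes "f \<in> degree_lowering l"
  obtains N where "\<forall>H n. sine_exp_orthogonal l H (n + N) \<longrightarrow> sine_exp_orthogonal l (\<lambda>z. H z * f z) n"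
  using assms unfolding degree_lowering_def by auto

lemma degree_lowering_continuous: "f \<in> degree_lowering l \<Longrightarrow> continuous_on (closure (plate l)) f"
  by (simp add: degree_lowering_def)

lemma degree_lowering_const:
  assumes l: "l > 0" shows "(\<lambda>_. c) \<in> degree_lowering l"
proof -
  have "sine_exp_orthogonal l (\<lambda>z. H z * c) n" if H: "sine_exp_orthogonal l H (n + 0)" for H n
  proof -
    have "(LINT z|on_plate l. H z * c * (sin (real i * fst z) * exp (real k * snd z))) = 0"
      if i: "i \<in> {1..n}" for i k
    proof -
      have "(LINT z|on_plate l. H z * c * (sin (real i * fst z) * exp (real k * snd z))) =
          (LINT z|on_plate l. c * (H z * (sin (real i * fst z) * exp (real k * snd z))))"
        by (rule Bochner_Integration.integral_cong) simp_all
      then show ?thesis using sine_exp_orthogonalD[OF H, of i k] i by simp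
    qed
    then show ?thesis using H by (simp add: sine_exp_orthogonal_def)
  qed
  then show ?thesis by (rule degree_loweringI[OF continuous_on_const])
qed

lemma degree_lowering_add:
  assumes l: "l > 0" and f: "f \<in> degree_lowering l" and g: "g \<in> degree_lowering l"
  shows "(\<lambda>z. f z + g z) \<in> degree_lowering l"
proof -
  obtain N1 where N1: "\<forall>H n. sine_exp_orthogonal l H (n + N1) \<longrightarrow> sine_exp_orthogonal l (\<lambda>z. H z * f z) n"
    by (rule degree_loweringE[OF f])
  obtain N2 where N2: "\<forall>H n. sine_exp_orthogonal l H (n + N2) \<longrightarrow> sine_exp_orthogonal l (\<lambda>z. H z * g z) n"
    by (rule degree_loweringE[OF g])
  have fg: "continuous_on (closure (plate l)) f" "continuous_on (closure (plate l)) g"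
    by (rule degree_lowering_continuous[OF f], rule degree_lowering_continuous[OF g])
  have "sine_exp_orthogonal l (\<lambda>z. H z * (f z + g z)) n" if H: "sine_exp_orthogonal l H (n + (N1 + N2))" for H n
  proof -
    have f': "sine_exp_orthogonal l (\<lambda>z. H z * f z) n" by (rule N1[rule_format, OF sine_exp_orthogonal_mono[OF H]]) simp
    have g': "sine_exp_orthogonal l (\<lambda>z. H z * g z) n" by (rule N2[rule_format, OF sine_exp_orthogonal_mono[OF H]]) simp
    have "(LINT z|on_plate l. H z * (f z + g z) * (sin (real i * fst z) * exp (real k * snd z))) = 0"
      if "i \<in> {1..n}" for i k
    proof -
      have "(LINT z|on_plate l. H z * (f z + g z) * (sin (real i * fst z) * exp (real k * snd z))) =
        (LINT z|on_plate l. H z * f z * (sin (real i * fst z) * exp (real k * snd z)) +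
          H z * g z * (sin (real i * fst z) * exp (real k * snd z)))"
        by (simp add: algebra_simps)
      also have "\<dots> = (LINT z|on_plate l. H z * f z * (sin (real i * fst z) * exp (real k * snd z))) +
          (LINT z|on_plate l. H z * g z * (sin (real i * fst z) * exp (real k * snd z)))"
        by (intro Bochner_Integration.integral_add sine_exp_orthogonal_integrable[OF l f']
            sine_exp_orthogonal_integrable[OF l g'] continuous_on_mult continuous_on_plate_elementary)
      finally show ?thesis using f' g' that by (simp add: sine_exp_orthogonal_def)
    qed
    then show ?thesis
      using sine_exp_orthogonal_integrable[OF l H continuous_on_add[OF fg]]
      by (simp add: sine_exp_orthogonal_def)
  qed
  then show ?thesis by (rule degree_loweringI[OF continuous_on_add[OF fg]])
qed

lemma degree_lowering_mult:
  assumes l: "l > 0" and f: "f \<in> degree_lowering l" and g: "g \<in> degree_lowering l"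
  shows "(\<lambda>z. f z * g z) \<in> degree_lowering l"
proof -
  obtain N1 where N1: "\<forall>H n. sine_exp_orthogonal l H (n + N1) \<longrightarrow> sine_exp_orthogonal l (\<lambda>z. H z * f z) n"
    by (rule degree_loweringE[OF f])
  obtain N2 where N2: "\<forall>H n. sine_exp_orthogonal l H (n + N2) \<longrightarrow> sine_exp_orthogonal l (\<lambda>z. H z * g z) n"
    by (rule degree_loweringE[OF g])
  have fg: "continuous_on (closure (plate l)) f" "continuous_on (closure (plate l)) g"
    by (rule degree_lowering_continuous[OF f], rule degree_lowering_continuous[OF g])
  have "sine_exp_orthogonal l (\<lambda>z. H z * (f z * g z)) n" if H: "sine_exp_orthogonal l H (n + (N2 + N1))" for H n
    using N2[rule_format, OF N1[rule_format, of H "n + N2"]] H by (simp add: mult.assoc add.assoc)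
  then show ?thesis by (rule degree_loweringI[OF continuous_on_mult[OF fg]])
qed

text \<open>Multiplication by cos x turns sin (i x) into half the sum of its two neighbours, so
  exactly one order is lost.\<close>

lemma degree_lowering_cos:
  assumes l: "l > 0" shows "(\<lambda>z. cos (fst z)) \<in> degree_lowering l"
proof -
  have "sine_exp_orthogonal l (\<lambda>z. H z * cos (fst z)) n" if H: "sine_exp_orthogonal l H (n + 1)" for H n
  proof -
    have "(LINT z|on_plate l. H z * cos (fst z) * (sin (real i * fst z) * exp (real k * snd z))) = 0"
      if i: "i \<in> {1..n}" for i k
    proof -
      have e: "H z * cos (fst z) * (sin (real i * fst z) * exp (real k * snd z)) =
          (1/2) * (H z * (sin (real (i + 1) * fst z) * exp (real k * snd z)) +
            H z * (sin (real (i - 1) * fst z) * exp (real k * snd z)))" for z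
      proof -
        have "real (i + 1) * fst z = real i * fst z + fst z" "real (i - 1) * fst z = real i * fst z - fst z"
          using i by (auto simp: algebra_simps of_nat_diff)
        then show ?thesis by (simp only: sin_add sin_diff) (simp add: algebra_simps)
      qed
      have "(LINT z|on_plate l. H z * cos (fst z) * (sin (real i * fst z) * exp (real k * snd z))) =
         (1/2) * ((LINT z|on_plate l. H z * (sin (real (i + 1) * fst z) * exp (real k * snd z))) +
            (LINT z|on_plate l. H z * (sin (real (i - 1) * fst z) * exp (real k * snd z))))"
        unfolding e integral_mult_right_zero
        by (subst Bochner_Integration.integral_add)
          (intro sine_exp_orthogonal_integrable[OF l H] continuous_on_mult continuous_on_plate_elementary refl)+
      moreover have "(LINT z|on_plate l. H z * (sin (real (i + 1) * fst z) * exp (real k * snd z))) = 0"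
        using i by (intro sine_exp_orthogonalD[OF H]) auto
      \<comment> \<open>For i = 1 the lower neighbour is sin 0, outside the range of the
        orthogonality but trivially harmless.\<close>
      moreover have "(LINT z|on_plate l. H z * (sin (real (i - 1) * fst z) * exp (real k * snd z))) = 0"
      proof (cases "i = 1")
        case False
        then show ?thesis using i by (intro sine_exp_orthogonalD[OF H]) auto
      qed simp
      ultimately show ?thesis by simp
    qed
    then show ?thesis
      using sine_exp_orthogonal_integrable[OF l H continuous_on_plate_elementary(2)]
      by (simp add: sine_exp_orthogonal_def)
  qed
  then show ?thesis by (rule degree_loweringI[OF continuous_on_plate_elementary(2)])
qed

text \<open>Multiplication by e^y raises \<open>k\<close> by one; as \<open>k\<close> is
  unrestricted, no order is lost.\<close>

lemma degree_lowering_exp: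
  assumes l: "l > 0" shows "(\<lambda>z. exp (snd z)) \<in> degree_lowering l"
proof -
  have "sine_exp_orthogonal l (\<lambda>z. H z * exp (snd z)) n" if H: "sine_exp_orthogonal l H (n + 0)" for H n
  proof -
    have "(LINT z|on_plate l. H z * exp (snd z) * (sin (real i * fst z) * exp (real k * snd z))) = 0"
      if i: "i \<in> {1..n}" for i k
    proof -
      have "H z * exp (snd z) * (sin (real i * fst z) * exp (real k * snd z)) =
          H z * (sin (real i * fst z) * exp (real (Suc k) * snd z))" for z
      proof -
        have "real (Suc k) * snd z = snd z + real k * snd z" by (simp add: algebra_simps)
        then show ?thesis by (simp only: exp_add mult_ac)
      qed
      then show ?thesis using i by (simp only:) (intro sine_exp_orthogonalD[OF H], auto)
    qed
    then show ?thesis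
      using sine_exp_orthogonal_integrable[OF l H continuous_on_plate_elementary(4)]
      by (simp add: sine_exp_orthogonal_def)
  qed
  then show ?thesis by (rule degree_loweringI[OF continuous_on_plate_elementary(4)])
qed

text \<open>Stone--Weierstrass: cos is injective on [0, pi] and exp on the line, so together they
  separate the points of the closed rectangle.\<close>

lemma degree_lowering_dense:
  assumes l: "l > 0" and F: "continuous_on (closure (plate l)) F" and e: "e > 0"
  obtains f where "f \<in> degree_lowering l" "\<And>z. z \<in> closure (plate l) \<Longrightarrow> \<bar>F z - f z\<bar> < e"
proof -
  interpret R: function_ring_on "degree_lowering l" "closure (plate l)"
  proof
    show "compact (closure (plate l))" by (simp add: closure_plate_cbox l)
    show "\<exists>f\<in>degree_lowering l. f z \<noteq> f w"
      if zw: "z \<in> closure (plate l)" "w \<in> closure (plate l)" "z \<noteq> w" for z w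
    proof (cases "snd z = snd w")
      case True
      then have "fst z \<noteq> fst w" using zw(3) by (simp add: prod_eq_iff)
      then have "cos (fst z) \<noteq> cos (fst w)"
        using zw(1,2) cos_inj_pi[of "fst z" "fst w"] by (auto simp: closure_plate[OF l])
      then show ?thesis using degree_lowering_cos[OF l] by (intro bexI)
    next
      case False
      then have "exp (snd z) \<noteq> exp (snd w)" by simp
      then show ?thesis using degree_lowering_exp[OF l] by (intro bexI)
    qed
  qed (fact degree_lowering_continuous degree_lowering_const[OF l] degree_lowering_add[OF l] degree_lowering_mult[OF l])+
  from R.Stone_Weierstrass_basic[OF F e] show ?thesis using that by blast
qed

text \<open>Orthogonality of all orders survives every multiplier, so h = H sin x is orthogonal to
  the whole dense algebra and hence to itself. Inside the plate sin x is positive, and continuity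
  reaches the closure.\<close>

lemma sine_exp_complete:
  assumes l: "l > 0" and H: "continuous_on (closure (plate l)) H" and orth: "\<And>n. sine_exp_orthogonal l H n"
    and z: "z \<in> closure (plate l)"
  shows "H z = 0"
proof -
  define h where "h = (\<lambda>z. H z * sin (1 * fst z))"
  have hc: "continuous_on (closure (plate l)) h"
    unfolding h_def by (intro continuous_on_mult H continuous_on_plate_elementary)
  have hint: "integrable (on_plate l) h" by (rule continuous_integrable_plate[OF l hc])
  have le: "(LINT z|on_plate l. h z * h z) \<le> e * (LINT z|on_plate l. \<bar>h z\<bar>)" if e: "e > 0" for e
  proof -
    obtain f where f: "f \<in> degree_lowering l" "\<And>z. z \<in> closure (plate l) \<Longrightarrow> \<bar>h z - f z\<bar> < e"
      using degree_lowering_dense[OF l hc e] by blast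
    have fc: "continuous_on (closure (plate l)) f" by (rule degree_lowering_continuous[OF f(1)])
    obtain N where N: "\<forall>H n. sine_exp_orthogonal l H (n + N) \<longrightarrow> sine_exp_orthogonal l (\<lambda>z. H z * f z) n"
      by (rule degree_loweringE[OF f(1)])
    from N[rule_format, OF orth, of 1] have "(LINT z|on_plate l. H z * f z * (sin (real 1 * fst z) * exp (real 0 * snd z))) = 0"
      by (rule sine_exp_orthogonalD) simp_all
    moreover have "(LINT z|on_plate l. h z * f z) = (LINT z|on_plate l. H z * f z * (sin (real 1 * fst z) * exp (real 0 * snd z)))"
      unfolding h_def by (rule Bochner_Integration.integral_cong) (simp_all add: mult_ac)
    ultimately have 0: "(LINT z|on_plate l. h z * f z) = 0" by simp
    have "(LINT z|on_plate l. h z * (h z - f z)) = (LINT z|on_plate l. h z * h z - h z * f z)"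
      by (simp add: algebra_simps)
    also have "\<dots> = (LINT z|on_plate l. h z * h z) - (LINT z|on_plate l. h z * f z)"
      by (intro Bochner_Integration.integral_diff integrable_mult_continuous_plate[OF l] hint hc fc)
    finally have "(LINT z|on_plate l. h z * h z) = (LINT z|on_plate l. h z * (h z - f z))" using 0 by simp
    also have "\<dots> \<le> (LINT z|on_plate l. e * \<bar>h z\<bar>)"
    proof (rule integral_mono)
      show "integrable (on_plate l) (\<lambda>z. h z * (h z - f z))"
        by (intro integrable_mult_continuous_plate[OF l] hint continuous_on_diff hc fc)
      show "integrable (on_plate l) (\<lambda>z. e * \<bar>h z\<bar>)" using hint by simp
      fix z assume "z \<in> space (on_plate l)"
      then have "\<bar>h z - f z\<bar> \<le> e" using f(2)[of z] closure_subset[of "plate l"] by force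
      then have "\<bar>h z\<bar> * \<bar>h z - f z\<bar> \<le> \<bar>h z\<bar> * e" by (rule mult_left_mono) simp
      then have "\<bar>h z * (h z - f z)\<bar> \<le> e * \<bar>h z\<bar>" by (simp add: abs_mult mult.commute)
      then show "h z * (h z - f z) \<le> e * \<bar>h z\<bar>" by linarith
    qed
    finally show ?thesis by simp
  qed
  have "(LINT z|on_plate l. h z * h z) \<le> 0"
  proof (rule field_le_epsilon)
    fix e :: real assume e: "e > 0"
    define A where "A = (LINT z|on_plate l. \<bar>h z\<bar>)"
    have A: "A \<ge> 0" unfolding A_def by (rule Bochner_Integration.integral_nonneg) simp
    have "(LINT z|on_plate l. h z * h z) \<le> e / (A + 1) * A"
      using le[of "e / (A + 1)"] e A by (simp add: A_def[symmetric])
    also have "\<dots> \<le> e" using e A by (simp add: field_simps)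
    finally show "(LINT z|on_plate l. h z * h z) \<le> 0 + e" by simp
  qed
  moreover have "0 \<le> (LINT z|on_plate l. h z * h z)" by (rule Bochner_Integration.integral_nonneg) simp
  ultimately have int0: "(LINT z|on_plate l. h z * h z) = 0" by simp
  have hhc: "continuous_on (cbox (0, -l) (pi, l)) (\<lambda>z. h z * h z)"
    using continuous_on_mult[OF hc hc] by (simp add: closure_plate_cbox l)
  have "integral (cbox (0, -l) (pi, l)) (\<lambda>z. h z * h z) = 0"
    using lebesgue_integral_eq_integral[OF integrable_mult_continuous_plate[OF l hint hc] plate_lebesgue] int0
    by (simp add: plate_eq_box integral_open_interval)
  moreover have "(pi / 2, 0) \<in> box (0, -l) (pi, l)" using l by (simp add: box_Pair)
  ultimately have h0: "h z = 0" if "z \<in> cbox (0, -l) (pi, l)" for z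
    using integral_cbox_eq_0_iff[OF hhc] that by auto
  have H0: "H z = 0" if "z \<in> plate l" for z
  proof -
    have "sin (fst z) > 0" using that by (intro sin_gt_zero) (auto simp: plate_def)
    moreover have "h z = 0"
      using that closure_subset[of "plate l"] by (intro h0) (auto simp del: mem_box simp: closure_plate_cbox[OF l])
    ultimately show ?thesis by (simp add: h_def)
  qed
  show ?thesis by (rule continuous_constant_on_closure[OF H H0 z])
qed

text \<open>The quotient of \<open>v\<close> by sin x need not be continuous, so it is regularised
  to v / (sin x + \<delta>) before the density result is used. The regularisation error v \<delta> /
  (sin x + \<delta>) is small near the sides because \<open>v\<close> is, and elsewhere because
  \<delta> is small against sin x.\<close>

lemma approx_vanishing_on_sides:
  assumes l: "l > 0" and v: "continuous_on (closure (plate l)) v"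
    and v0: "\<And>y. y \<in> {-l..l} \<Longrightarrow> v (0, y) = 0 \<and> v (pi, y) = 0" and e: "e > 0"
  obtains f where "f \<in> degree_lowering l" "\<And>z. z \<in> closure (plate l) \<Longrightarrow> \<bar>v z - sin (fst z) * f z\<bar> \<le> e"
proof -
  have "uniformly_continuous_on (closure (plate l)) v"
    by (rule compact_uniformly_continuous[OF v]) (simp add: closure_plate_cbox l)
  then obtain d where d: "d > 0" "\<And>z z'. z \<in> closure (plate l) \<Longrightarrow> z' \<in> closure (plate l) \<Longrightarrow> dist z' z < d \<Longrightarrow> dist (v z') (v z) < e / 2"
    unfolding uniformly_continuous_on_def using half_gt_zero[OF e] by metis
  obtain B where B: "0 \<le> B" "\<And>z. z \<in> closure (plate l) \<Longrightarrow> \<bar>v z\<bar> \<le> B"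
    using continuous_bounded_on_closure[OF l v] by blast
  \<comment> \<open>Within distance \<open>r\<close> of a side, \<open>v\<close> is below e/2;
    elsewhere sin x is at least s = sin r, which needs r \<le> pi/2.\<close>
  define r where "r = min d (pi / 2)"
  have r: "0 < r" "r \<le> d" "r \<le> pi / 2" using d by (auto simp: r_def)
  define s where "s = sin r"
  have s: "s > 0" unfolding s_def using r pi_gt_zero by (intro sin_gt_zero) linarith+
  \<comment> \<open>Chosen such that \<delta> times the bound of \<open>v\<close> is at most s e /
    2.\<close>
  define \<delta> where "\<delta> = e * s / (2 * (B + 1))"
  have \<delta>: "\<delta> > 0" using e s B by (simp add: \<delta>_def)
  have "\<delta> * B \<le> \<delta> * (B + 1)" using \<delta> by simp
  also have "\<dots> = e / 2 * s" using B by (simp add: \<delta>_def field_simps)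
  finally have \<delta>B: "\<delta> * B \<le> e / 2 * s" .
  have sin0: "sin (fst z) \<ge> 0" if "z \<in> closure (plate l)" for z
    using that by (intro sin_ge_zero) (auto simp: closure_plate[OF l])
  have "continuous_on (closure (plate l)) (\<lambda>z. v z / (sin (fst z) + \<delta>))"
    using sin0 \<delta> by (intro continuous_intros v) (fastforce simp: add_nonneg_pos)
  then obtain f where f: "f \<in> degree_lowering l"
    "\<And>z. z \<in> closure (plate l) \<Longrightarrow> \<bar>v z / (sin (fst z) + \<delta>) - f z\<bar> < e / 2"
    using degree_lowering_dense[OF l _ half_gt_zero[OF e]] by blast
  show ?thesis
  proof (rule that[OF f(1)])
    fix z assume z: "z \<in> closure (plate l)"
    obtain x y where xy: "z = (x, y)" by fastforce
    have in1: "x \<in> {0..pi}" "y \<in> {-l..l}" using z by (auto simp: closure_plate[OF l] xy)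
    have sx: "sin x \<ge> 0" "sin x \<le> 1" using sin0[OF z] by (auto simp: xy)
    have "\<bar>v z\<bar> * \<delta> \<le> e / 2 * (sin x + \<delta>)"
    proof (cases "x < r \<or> pi - r < x")
      case True
      have "\<bar>v z\<bar> < e / 2"
      proof (cases "x < r")
        case True
        have "dist (0, y) z < d" using True r in1 by (simp add: xy dist_Pair_Pair dist_real_def)
        with d(2)[OF z, of "(0, y)"] in1 v0[of y] l show ?thesis
          by (simp add: closure_plate[OF l] dist_real_def)
      next
        case False
        with True have "pi - r < x" by simp
        then have "dist (pi, y) z < d" using r in1 by (simp add: xy dist_Pair_Pair dist_real_def)
        with d(2)[OF z, of "(pi, y)"] in1 v0[of y] l show ?thesis
          by (simp add: closure_plate[OF l] dist_real_def)
      qed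
      then have "\<bar>v z\<bar> * \<delta> \<le> e / 2 * \<delta>" using \<delta> by simp
      also have "\<dots> \<le> e / 2 * (sin x + \<delta>)" using e sx by (intro mult_left_mono) auto
      finally show ?thesis .
    next
      case False
      have "s \<le> sin x"
      proof (cases "x \<le> pi / 2")
        case True
        then show ?thesis unfolding s_def using False r pi_gt_zero by (intro sin_monotone_2pi_le) auto
      next
        case 2: False
        have "sin r \<le> sin (pi - x)" using False 2 r in1 pi_gt_zero by (intro sin_monotone_2pi_le) auto
        then show ?thesis by (simp add: s_def)
      qed
      have "\<bar>v z\<bar> * \<delta> \<le> \<delta> * B" using B(2)[OF z] \<delta> by (simp add: mult.commute mult_left_mono)
      also have "\<dots> \<le> e / 2 * s" by (rule \<delta>B)
      also have "\<dots> \<le> e / 2 * (sin x + \<delta>)" using e \<open>s \<le> sin x\<close> \<delta> by (intro mult_left_mono) auto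
      finally show ?thesis .
    qed
    moreover have p: "sin x + \<delta> > 0" using sx \<delta> by simp
    ultimately have a: "\<bar>v z * \<delta> / (sin x + \<delta>)\<bar> \<le> e / 2"
      using \<delta> by (simp add: abs_mult divide_le_eq)
    have b: "\<bar>sin x * (v z / (sin x + \<delta>) - f z)\<bar> \<le> 1 * (e / 2)"
      unfolding abs_mult using f(2)[OF z] sx by (intro mult_mono) (auto simp: xy)
    have eq: "v z - sin (fst z) * f z = v z * \<delta> / (sin x + \<delta>) + sin x * (v z / (sin x + \<delta>) - f z)"
    proof -
      have "v z * \<delta> / (sin x + \<delta>) + sin x * (v z / (sin x + \<delta>)) = v z * (sin x + \<delta>) / (sin x + \<delta>)"
        by (simp add: distrib_left add_divide_distrib mult.commute)
      also have "\<dots> = v z" using p by simp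
      finally show ?thesis by (simp add: xy right_diff_distrib)
    qed
    show "\<bar>v z - sin (fst z) * f z\<bar> \<le> e"
      unfolding eq by (rule order_trans[OF abs_triangle_ineq order_trans[OF add_mono[OF a b]]]) simp
  qed
qed

text \<open>Replace \<open>v\<close> by sin x times a multiplier f. For n beyond the loss of order
  of f the integral against this product is exactly 0, and the error is at most e times the uniform
  bound \<open>C\<close> on the mass.\<close>

lemma sine_exp_orthogonal_tendsto_0:
  assumes l: "l > 0" and v: "continuous_on (closure (plate l)) v"
    and v0: "\<And>y. y \<in> {-l..l} \<Longrightarrow> v (0, y) = 0 \<and> v (pi, y) = 0"
    and H: "\<And>n. sine_exp_orthogonal l (H n) n" and C: "\<And>n. (LINT z|on_plate l. \<bar>H n z\<bar>) \<le> C"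
  shows "(\<lambda>n. LINT z|on_plate l. H n z * v z) \<longlonglongrightarrow> 0"
proof (rule tendstoI)
  fix \<epsilon> :: real assume \<epsilon>: "\<epsilon> > 0"
  have "0 \<le> (LINT z|on_plate l. \<bar>H 0 z\<bar>)" by (rule Bochner_Integration.integral_nonneg) simp
  then have C0: "0 \<le> C" using C[of 0] by linarith
  define e where "e = \<epsilon> / (C + 1)"
  have e: "e > 0" "e * C < \<epsilon>" using C0 \<epsilon> by (auto simp: e_def field_simps)
  obtain f where f: "f \<in> degree_lowering l" "\<And>z. z \<in> closure (plate l) \<Longrightarrow> \<bar>v z - sin (fst z) * f z\<bar> \<le> e"
    using approx_vanishing_on_sides[OF l v v0 e(1)] by blast
  have fc: "continuous_on (closure (plate l)) f" by (rule degree_lowering_continuous[OF f(1)])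
  obtain N where N: "\<forall>H n. sine_exp_orthogonal l H (n + N) \<longrightarrow> sine_exp_orthogonal l (\<lambda>z. H z * f z) n"
    by (rule degree_loweringE[OF f(1)])
  have sfc: "continuous_on (closure (plate l)) (\<lambda>z. sin (fst z) * f z)"
    using continuous_on_plate_elementary(1)[of _ 1] by (intro continuous_on_mult fc) simp
  have "\<forall>n\<ge>N + 1. dist (LINT z|on_plate l. H n z * v z) 0 < \<epsilon>"
  proof (intro allI impI)
    fix n assume "n \<ge> N + 1"
    then have "sine_exp_orthogonal l (H n) (1 + N)" by (intro sine_exp_orthogonal_mono[OF H]) simp
    from N[rule_format, OF this] have "(LINT z|on_plate l. H n z * f z * (sin (real 1 * fst z) * exp (real 0 * snd z))) = 0"
      by (rule sine_exp_orthogonalD) simp_all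
    moreover have "(LINT z|on_plate l. H n z * (sin (fst z) * f z)) = (LINT z|on_plate l. H n z * f z * (sin (real 1 * fst z) * exp (real 0 * snd z)))"
      by (rule Bochner_Integration.integral_cong) (simp_all add: mult_ac)
    ultimately have 0: "(LINT z|on_plate l. H n z * (sin (fst z) * f z)) = 0" by simp
    note int = sine_exp_orthogonal_integrable[OF l H]
    have "(LINT z|on_plate l. H n z * (v z - sin (fst z) * f z)) =
        (LINT z|on_plate l. H n z * v z - H n z * (sin (fst z) * f z))"
      by (simp add: algebra_simps)
    also have "\<dots> = (LINT z|on_plate l. H n z * v z) - (LINT z|on_plate l. H n z * (sin (fst z) * f z))"
      by (intro Bochner_Integration.integral_diff int v sfc)
    finally have eq: "(LINT z|on_plate l. H n z * v z) = (LINT z|on_plate l. H n z * (v z - sin (fst z) * f z))"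
      using 0 by simp
    have intd: "integrable (on_plate l) (\<lambda>z. H n z * (v z - sin (fst z) * f z))"
      by (intro int continuous_on_diff v sfc)
    have "\<bar>LINT z|on_plate l. H n z * (v z - sin (fst z) * f z)\<bar> \<le>
        (LINT z|on_plate l. \<bar>H n z * (v z - sin (fst z) * f z)\<bar>)"
      by (rule integral_abs_bound)
    also have "\<dots> \<le> (LINT z|on_plate l. e * \<bar>H n z\<bar>)"
    proof (rule integral_mono[OF integrable_abs[OF intd]])
      show "integrable (on_plate l) (\<lambda>z. e * \<bar>H n z\<bar>)" using H[of n] by (simp add: sine_exp_orthogonal_def)
      fix z assume "z \<in> space (on_plate l)"
      then have "\<bar>v z - sin (fst z) * f z\<bar> \<le> e" using f(2)[of z] closure_subset[of "plate l"] by force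
      then have "\<bar>H n z\<bar> * \<bar>v z - sin (fst z) * f z\<bar> \<le> \<bar>H n z\<bar> * e" by (rule mult_left_mono) simp
      then show "\<bar>H n z * (v z - sin (fst z) * f z)\<bar> \<le> e * \<bar>H n z\<bar>" by (simp add: abs_mult mult.commute)
    qed
    also have "\<dots> \<le> e * C" using C[of n] e by simp
    finally show "dist (LINT z|on_plate l. H n z * v z) 0 < \<epsilon>" using eq e by simp
  qed
  then show "\<forall>\<^sub>F n in sequentially. dist (LINT z|on_plate l. H n z * v z) 0 < \<epsilon>"
    unfolding eventually_sequentially by blast
qed

subsection \<open>Products of integrable functions of one variable\<close>

text \<open>Fubini's theorem is applied to the product Borel structure, while \<open>a\<close> is
  only Lebesgue measurable; hence the passage through a Borel representative
  \<open>a'\<close>.\<close>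

lemma integral_product_plate:
  fixes a b :: "real \<Rightarrow> real"
  assumes a: "integrable (lebesgue_on {0<..<pi}) a" and b: "continuous_on UNIV b"
  shows "integrable (on_plate l) (\<lambda>z. a (fst z) * b (snd z))"
    "(LINT z|on_plate l. a (fst z) * b (snd z)) =
      (LINT x|lebesgue_on {0<..<pi}. a x) * integral {-l..l} b"
proof -
  define A where "A = (\<lambda>x. indicator {0<..<pi} x * a x)"
  define B where "B = (\<lambda>y. indicator {-l<..<l} y * b y)"
  have A: "integrable lebesgue A" "integral\<^sup>L lebesgue A = (LINT x|lebesgue_on {0<..<pi}. a x)"
    using a by (simp_all add: A_def integrable_restrict_space integral_restrict_space)
  have bI: "integrable (lebesgue_on {-l<..<l}) b"
  proof -
    have "b absolutely_integrable_on {-l<..<l}"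
      by (rule set_integrable_subset[OF absolutely_integrable_continuous_real[of "-l" l]])
        (auto intro: continuous_on_subset[OF b])
    then show ?thesis by (simp add: set_integrable_def integrable_restrict_space)
  qed
  have Bm: "B \<in> borel_measurable borel"
    unfolding B_def using borel_measurable_continuous_onI[OF b] by measurable
  have B: "integrable lborel B" "integral\<^sup>L lborel B = integral {-l..l} b"
  proof -
    have "integrable lebesgue B" using bI by (simp add: B_def integrable_restrict_space)
    then show "integrable lborel B" using Bm by (simp add: integrable_completion)
    have "integral\<^sup>L lborel B = integral\<^sup>L lebesgue B" using Bm by (simp add: integral_completion)
    also have "\<dots> = integral\<^sup>L (lebesgue_on {-l<..<l}) b" by (simp add: B_def integral_restrict_space)
    also have "\<dots> = integral {-l..l} b"
      using lebesgue_integral_eq_integral[OF bI] by (simp add: integral_open_interval_real)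
    finally show "integral\<^sup>L lborel B = integral {-l..l} b" .
  qed
  obtain a' where a'm: "a' \<in> borel_measurable lborel" and a': "AE x in lborel. A x = a' x"
    using completion_ex_borel_measurable_real[of A lborel] A(1) by auto
  have a'I: "integrable lborel a'" "integral\<^sup>L lborel a' = (LINT x|lebesgue_on {0<..<pi}. a x)"
  proof -
    have m: "a' \<in> borel_measurable lebesgue" using a'm by (rule measurable_completion)
    have AE: "AE x in lebesgue. A x = a' x" using a' by (rule AE_completion)
    show "integrable lborel a'"
      using integrable_cong_AE_imp[OF A(1) m] AE a'm by (simp add: integrable_completion eq_commute)
    have "integral\<^sup>L lborel a' = integral\<^sup>L lebesgue a'" using a'm by (simp add: integral_completion)
    also have "\<dots> = integral\<^sup>L lebesgue A"
      using AE A(1) m by (intro integral_cong_AE) (auto simp: eq_commute)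
    finally show "integral\<^sup>L lborel a' = (LINT x|lebesgue_on {0<..<pi}. a x)" using A(2) by simp
  qed
  define F where "F = (\<lambda>z::real \<times> real. a' (fst z) * B (snd z))"
  have Fm: "F \<in> borel_measurable (lborel \<Otimes>\<^sub>M lborel)"
    unfolding F_def using a'm Bm by measurable
  have FI: "integrable (lborel \<Otimes>\<^sub>M lborel) F"
  proof (rule lborel_pair.Fubini_integrable[OF Fm])
    show "integrable lborel (\<lambda>x. LINT y|lborel. norm (F (x, y)))"
      unfolding F_def using a'I(1) by (simp add: abs_mult)
    show "AE x in lborel. integrable lborel (\<lambda>y. F (x, y))"
      unfolding F_def using B(1) by simp
  qed
  have Fint: "integral\<^sup>L (lborel \<Otimes>\<^sub>M lborel) F = integral\<^sup>L lborel a' * integral\<^sup>L lborel B"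
    by (subst lborel_pair.integral_fst'[OF FI, symmetric]) (simp add: F_def)
  have Fb: "F \<in> borel_measurable lborel" "integrable lborel F"
    "integral\<^sup>L lborel F = integral\<^sup>L lborel a' * integral\<^sup>L lborel B"
    using Fm FI Fint by (simp_all only: lborel_prod)
  have AE2: "AE z in lborel. A (fst z) * B (snd z) = F z"
  proof -
    obtain N where N: "N \<in> null_sets lborel" "{x. A x \<noteq> a' x} \<subseteq> N"
      using a' by (auto simp: eventually_ae_filter)
    \<comment> \<open>The exceptional set in the plane is contained in a null set of abscissas times
      the whole line.\<close>
    have "emeasure (lborel \<Otimes>\<^sub>M lborel) (N \<times> (UNIV :: real set)) = emeasure lborel N * emeasure lborel (UNIV :: real set)"
      using N by (intro lborel.emeasure_pair_measure_Times) auto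
    then have "N \<times> (UNIV :: real set) \<in> null_sets (lborel \<Otimes>\<^sub>M lborel)"
      using N by (intro null_setsI) auto
    then have "AE z in lborel. z \<notin> N \<times> (UNIV :: real set)"
      unfolding lborel_prod by (rule AE_not_in)
    then show ?thesis
      by eventually_elim (use N in \<open>auto simp: F_def\<close>)
  qed
  have AE3: "AE z in lebesgue. F z = indicator (plate l) z * (a (fst z) * b (snd z))"
  proof -
    have "A (fst z) * B (snd z) = indicator (plate l) z * (a (fst z) * b (snd z))" for z
      by (cases z) (auto simp: A_def B_def plate_def indicator_def)
    then show ?thesis using AE_completion[OF AE2] by (simp add: eq_commute)
  qed
  have Fl: "F \<in> borel_measurable lebesgue" "integrable lebesgue F"
    "integral\<^sup>L lebesgue F = integral\<^sup>L lborel F"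
    using Fb by (simp_all add: measurable_completion integrable_completion integral_completion)
  \<comment> \<open>Completeness of the Lebesgue measure transfers measurability from
    \<open>F\<close> across an almost everywhere equality.\<close>
  have m: "(\<lambda>z. indicator (plate l) z * (a (fst z) * b (snd z))) \<in> borel_measurable lebesgue"
  proof (rule measurableI)
    fix U :: "real set" assume U: "U \<in> sets borel"
    have "F -` U \<in> sets lebesgue" using measurable_sets[OF Fl(1) U] by simp
    then have "(\<lambda>z. indicator (plate l) z * (a (fst z) * b (snd z))) -` U \<in> sets lebesgue"
      by (rule completion.in_sets_AE[rotated]) (use AE3 in \<open>auto elim!: eventually_mono\<close>)
    then show "(\<lambda>z. indicator (plate l) z * (a (fst z) * b (snd z))) -` U \<inter> space lebesgue \<in> sets lebesgue"
      by simp
  qed simp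
  have I: "integrable lebesgue (\<lambda>z. indicator (plate l) z * (a (fst z) * b (snd z)))"
    using integrable_cong_AE_imp[OF Fl(2) m] AE3 by (simp add: eq_commute)
  then show "integrable (on_plate l) (\<lambda>z. a (fst z) * b (snd z))"
    by (simp add: integrable_restrict_space)
  have "(LINT z|on_plate l. a (fst z) * b (snd z)) = (LINT z|lebesgue. indicator (plate l) z * (a (fst z) * b (snd z)))"
    by (simp add: integral_restrict_space)
  also have "\<dots> = integral\<^sup>L lebesgue F"
    by (rule integral_cong_AE[OF m Fl(1)]) (use AE3 in \<open>auto simp: eq_commute\<close>)
  finally show "(LINT z|on_plate l. a (fst z) * b (snd z)) =
      (LINT x|lebesgue_on {0<..<pi}. a x) * integral {-l..l} b"
    by (simp add: Fl Fb a'I B)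
qed

subsection \<open>Bessel's inequality for the sine coefficients\<close>

lemma integral_lebesgue_on_Ioo:
  fixes f F :: "real \<Rightarrow> real"
  assumes "a < b" "\<And>x. (F has_real_derivative f x) (at x)" "continuous_on UNIV f"
  shows "integrable (lebesgue_on {a<..<b}) f" "(LINT x|lebesgue_on {a<..<b}. f x) = F b - F a"
proof -
  have "f absolutely_integrable_on {a<..<b}"
    by (rule set_integrable_subset[OF absolutely_integrable_continuous_real[of a b]])
      (auto intro: continuous_on_subset[OF assms(3)])
  then show I: "integrable (lebesgue_on {a<..<b}) f"
    by (simp add: set_integrable_def integrable_restrict_space)
  have "(f has_integral (F b - F a)) {a..b}"
    using assms by (intro fundamental_theorem_of_calculus)
      (auto simp: has_real_derivative_iff_has_vector_derivative[symmetric] intro: DERIV_subset)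
  then show "(LINT x|lebesgue_on {a<..<b}. f x) = F b - F a"
    using lebesgue_integral_eq_integral[OF I] by (simp add: integral_open_interval_real[symmetric] integral_unique)
qed

abbreviation "on_Ipi \<equiv> lebesgue_on {0<..<pi}"

lemma sine_orthogonality:
  assumes "1 \<le> i" "1 \<le> j"
  shows "integrable on_Ipi (\<lambda>x. sin (real i * x) * sin (real j * x))"
    "(LINT x|on_Ipi. sin (real i * x) * sin (real j * x)) = (if i = j then pi / 2 else 0)"
proof -
  let ?f = "\<lambda>x. sin (real i * x) * sin (real j * x)"
  have c: "continuous_on UNIV ?f" by (intro continuous_intros)
  \<comment> \<open>Antiderivative obtained from the product-to-sum formula for two sines.\<close>
  define F where "F = (\<lambda>x. if i = j then x / 2 - sin (2 * real i * x) / (4 * real i)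
    else sin ((real i - real j) * x) / (2 * (real i - real j)) - sin ((real i + real j) * x) / (2 * (real i + real j)))"
  have D: "(F has_real_derivative ?f x) (at x)" for x
  proof (cases "i = j")
    case True
    have "((\<lambda>x. x / 2 - sin (2 * real i * x) / (4 * real i)) has_real_derivative
        1 / 2 - cos (2 * real i * x) * (2 * real i) / (4 * real i)) (at x)"
      using assms by (auto intro!: derivative_eq_intros)
    moreover have "1 / 2 - cos (2 * real i * x) * (2 * real i) / (4 * real i) = ?f x"
      using assms True cos_double_sin[of "real i * x"] by (simp add: power2_eq_square mult.assoc field_simps)
    ultimately show ?thesis using True by (simp add: F_def)
  next
    case False
    have "((\<lambda>x. sin ((real i - real j) * x) / (2 * (real i - real j)) - sin ((real i + real j) * x) / (2 * (real i + real j)))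
        has_real_derivative cos ((real i - real j) * x) * (real i - real j) / (2 * (real i - real j)) -
          cos ((real i + real j) * x) * (real i + real j) / (2 * (real i + real j))) (at x)"
      using assms False by (auto intro!: derivative_eq_intros)
    moreover have "cos ((real i - real j) * x) * (real i - real j) / (2 * (real i - real j)) -
          cos ((real i + real j) * x) * (real i + real j) / (2 * (real i + real j)) = ?f x"
    proof -
      have r: "c * d / (2 * d) = c / 2" if "d \<noteq> 0" for c d :: real using that by simp
      have "real i - real j \<noteq> 0" "real i + real j \<noteq> 0" using assms False by auto
      then show ?thesis unfolding r[OF \<open>real i - real j \<noteq> 0\<close>] r[OF \<open>real i + real j \<noteq> 0\<close>]
        by (simp add: left_diff_distrib distrib_right cos_add cos_diff field_simps)
    qed
    ultimately show ?thesis using False by (simp add: F_def)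
  qed
  show "integrable on_Ipi ?f" by (rule integral_lebesgue_on_Ioo(1)[OF pi_gt_zero D c])
  have s: "sin (real n * pi) = 0" "sin (real_of_int k * pi) = 0" for n k
    by (simp_all add: sin_zero_iff_int2)
  have "sin ((real i - real j) * pi) = 0" "sin ((real i + real j) * pi) = 0" "sin (2 * real i * pi) = 0"
    using s(2)[of "int i - int j"] s(1)[of "i + j"] s(1)[of "2 * i"] by simp_all
  then have "F pi - F 0 = (if i = j then pi / 2 else 0)"
    by (simp add: F_def)
  then show "(LINT x|on_Ipi. ?f x) = (if i = j then pi / 2 else 0)"
    using integral_lebesgue_on_Ioo(2)[OF pi_gt_zero D c] by simp
qed

lemma finite_measure_Ipi: "finite_measure on_Ipi"
  by (rule finite_measure_lebesgue_on) (simp add: box_real[symmetric] del: box_real)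

lemma sin_measurable_Ipi: "(\<lambda>x. sin (c * x)) \<in> borel_measurable on_Ipi"
  by (intro continuous_imp_measurable_on_sets_lebesgue continuous_intros) simp

definition sine_remainder :: "(real \<Rightarrow> real) \<Rightarrow> nat \<Rightarrow> real \<Rightarrow> real" where
  "sine_remainder g n x = g x - (\<Sum>i=1..n. sine_coeff g i * sin (real i * x))"

context
  fixes g :: "real \<Rightarrow> real"
  assumes g: "g \<in> L2 {0<..<pi}"
begin

lemma L2_Ipi_integrable: "integrable on_Ipi g" "integrable on_Ipi (\<lambda>x. (g x)\<^sup>2)"
proof -
  show 2: "integrable on_Ipi (\<lambda>x. (g x)\<^sup>2)" using g by (simp add: L2_def)
  show "integrable on_Ipi g"
  proof (rule Bochner_Integration.integrable_bound)
    show "integrable on_Ipi (\<lambda>x. 1 + (g x)\<^sup>2)"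
      using 2 finite_measure.integrable_const[OF finite_measure_Ipi]
      by (intro Bochner_Integration.integrable_add) auto
    show "g \<in> borel_measurable on_Ipi" using g by (simp add: L2_def)
    show "AE x in on_Ipi. norm (g x) \<le> norm (1 + (g x)\<^sup>2)" using abs_le_1_plus_square by auto
  qed
qed

lemma integrable_mult_sin: "integrable on_Ipi f \<Longrightarrow> integrable on_Ipi (\<lambda>x. f x * sin (c * x))"
  by (rule integrable_mult_bounded[OF _ sin_measurable_Ipi, of _ _ 1]) simp_all

lemma integral_g_sin: "(LINT x|on_Ipi. g x * sin (real m * x)) = pi / 2 * sine_coeff g m"
  by (simp add: sine_coeff_def)

lemma remainder_integrable: "integrable on_Ipi (sine_remainder g n)"
  unfolding sine_remainder_def[abs_def]
  by (intro Bochner_Integration.integrable_diff L2_Ipi_integrable Bochner_Integration.integrable_sum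
      integrable_mult_right) (use integrable_mult_sin[OF finite_measure.integrable_const[OF finite_measure_Ipi, of 1]] in simp)

lemma remainder_orthogonal:
  assumes "1 \<le> j" "j \<le> n"
  shows "(LINT x|on_Ipi. sine_remainder g n x * sin (real j * x)) = 0"
proof -
  have I: "integrable on_Ipi (\<lambda>x. sine_coeff g i * (sin (real i * x) * sin (real j * x)))" if "i \<in> {1..n}" for i
    using that assms by (intro integrable_mult_right sine_orthogonality) auto
  have "(LINT x|on_Ipi. sine_remainder g n x * sin (real j * x)) =
      (LINT x|on_Ipi. g x * sin (real j * x) - (\<Sum>i=1..n. sine_coeff g i * (sin (real i * x) * sin (real j * x))))"
    by (simp add: sine_remainder_def left_diff_distrib sum_distrib_right mult.assoc)
  also have "\<dots> = (LINT x|on_Ipi. g x * sin (real j * x)) -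
      (LINT x|on_Ipi. (\<Sum>i=1..n. sine_coeff g i * (sin (real i * x) * sin (real j * x))))"
    by (intro Bochner_Integration.integral_diff integrable_mult_sin L2_Ipi_integrable Bochner_Integration.integrable_sum I)
  also have "(LINT x|on_Ipi. (\<Sum>i=1..n. sine_coeff g i * (sin (real i * x) * sin (real j * x)))) =
      (\<Sum>i=1..n. LINT x|on_Ipi. sine_coeff g i * (sin (real i * x) * sin (real j * x)))"
    by (rule Bochner_Integration.integral_sum[OF I])
  also have "\<dots> = (\<Sum>i=1..n. sine_coeff g i * (if i = j then pi / 2 else 0))"
    using assms by (intro sum.cong refl) (simp add: sine_orthogonality)
  also have "\<dots> = (\<Sum>i=1..n. if i = j then sine_coeff g j * (pi / 2) else 0)"
    by (intro sum.cong) auto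
  also have "\<dots> = pi / 2 * sine_coeff g j" using assms by simp
  finally show ?thesis by (simp add: integral_g_sin)
qed

text \<open>Pythagoras: the remainder is orthogonal to the partial sum subtracted from
  \<open>g\<close>. Nonnegativity of the left side of the second identity is Bessel's
  inequality.\<close>

lemma remainder_square:
  "integrable on_Ipi (\<lambda>x. (sine_remainder g n x)\<^sup>2)"
  "(LINT x|on_Ipi. (sine_remainder g n x)\<^sup>2) = (LINT x|on_Ipi. (g x)\<^sup>2) - pi / 2 * (\<Sum>i=1..n. (sine_coeff g i)\<^sup>2)"
proof -
  \<comment> \<open>With r = g - S for the partial sum S, the square of r is g^2 - g S - r S; the
    last term integrates to 0.\<close>
  have sq: "(sine_remainder g n x)\<^sup>2 = (g x)\<^sup>2 - (\<Sum>i=1..n. sine_coeff g i * (g x * sin (real i * x)))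
      - (\<Sum>i=1..n. sine_coeff g i * (sine_remainder g n x * sin (real i * x)))" for x
  proof -
    define S where "S = (\<Sum>i=1..n. sine_coeff g i * sin (real i * x))"
    have r: "sine_remainder g n x = g x - S" by (simp add: sine_remainder_def S_def)
    have "(\<Sum>i=1..n. sine_coeff g i * (t * sin (real i * x))) = t * S" for t
      by (simp add: S_def sum_distrib_left mult_ac)
    from this[of "g x"] this[of "sine_remainder g n x"] show ?thesis
      by (simp only:) (simp add: r power2_eq_square algebra_simps)
  qed
  have I1: "integrable on_Ipi (\<lambda>x. sine_coeff g i * (g x * sin (real i * x)))"
    and I2: "integrable on_Ipi (\<lambda>x. sine_coeff g i * (sine_remainder g n x * sin (real i * x)))" for i
    by (intro integrable_mult_right integrable_mult_sin L2_Ipi_integrable remainder_integrable)+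
  show "integrable on_Ipi (\<lambda>x. (sine_remainder g n x)\<^sup>2)"
    unfolding sq by (intro Bochner_Integration.integrable_diff Bochner_Integration.integrable_sum L2_Ipi_integrable I1 I2)
  have "(LINT x|on_Ipi. (sine_remainder g n x)\<^sup>2) = (LINT x|on_Ipi. (g x)\<^sup>2)
      - (LINT x|on_Ipi. (\<Sum>i=1..n. sine_coeff g i * (g x * sin (real i * x))))
      - (LINT x|on_Ipi. (\<Sum>i=1..n. sine_coeff g i * (sine_remainder g n x * sin (real i * x))))"
    unfolding sq
    by (subst Bochner_Integration.integral_diff Bochner_Integration.integral_diff;
        (intro Bochner_Integration.integrable_diff Bochner_Integration.integrable_sum L2_Ipi_integrable I1 I2)?)+ simp
  also have "(LINT x|on_Ipi. (\<Sum>i=1..n. sine_coeff g i * (g x * sin (real i * x)))) = pi / 2 * (\<Sum>i=1..n. (sine_coeff g i)\<^sup>2)"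
    by (subst Bochner_Integration.integral_sum[OF I1])
      (simp only: integral_mult_right_zero integral_g_sin, simp add: sum_distrib_left power2_eq_square mult_ac)
  also have "(LINT x|on_Ipi. (\<Sum>i=1..n. sine_coeff g i * (sine_remainder g n x * sin (real i * x)))) = 0"
    by (subst Bochner_Integration.integral_sum[OF I2]) (simp add: remainder_orthogonal)
  finally show "(LINT x|on_Ipi. (sine_remainder g n x)\<^sup>2) = (LINT x|on_Ipi. (g x)\<^sup>2) - pi / 2 * (\<Sum>i=1..n. (sine_coeff g i)\<^sup>2)"
    by simp
qed

lemma bessel_summable: "summable (\<lambda>n. (sine_coeff g (Suc n))\<^sup>2)"
proof (rule bounded_imp_summable)
  show "0 \<le> (sine_coeff g (Suc n))\<^sup>2" for n by simp
  fix n
  have "0 \<le> (LINT x|on_Ipi. (sine_remainder g (Suc n) x)\<^sup>2)" by (rule Bochner_Integration.integral_nonneg) simp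
  then have "pi / 2 * (\<Sum>i=1..Suc n. (sine_coeff g i)\<^sup>2) \<le> (LINT x|on_Ipi. (g x)\<^sup>2)"
    using remainder_square(2)[of "Suc n"] by simp
  moreover have "(\<Sum>i=1..Suc n. (sine_coeff g i)\<^sup>2) = (\<Sum>k\<le>n. (sine_coeff g (Suc k))\<^sup>2)"
    using sum.shift_bounds_cl_Suc_ivl[of "\<lambda>i. (sine_coeff g i)\<^sup>2" 0 n] by (simp add: atMost_atLeast0)
  ultimately show "(\<Sum>k\<le>n. (sine_coeff g (Suc k))\<^sup>2) \<le> 2 / pi * (LINT x|on_Ipi. (g x)\<^sup>2)"
    by (simp only:) (simp add: field_simps)
qed

text \<open>The error after n terms is the integral of \<open>v\<close> against the n-th remainder
  times an exponential; these loads are orthogonal up to order n and bounded in mass.\<close>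

lemma sine_series_against_continuous:
  assumes l: "l > 0" and v: "continuous_on (closure (plate l)) v"
    and v0: "\<And>y. y \<in> {-l..l} \<Longrightarrow> v (0, y) = 0 \<and> v (pi, y) = 0"
  shows "(\<lambda>n. sine_coeff g (Suc n) * (LINT z|on_plate l. exp (\<alpha> * snd z) * sin (real (Suc n) * fst z) * v z)) sums
    (LINT z|on_plate l. exp (\<alpha> * snd z) * g (fst z) * v z)"
proof -
  define H where "H = (\<lambda>n (z :: real \<times> real). sine_remainder g n (fst z) * exp (\<alpha> * snd z))"
  have bc: "continuous_on UNIV (\<lambda>y. exp (\<alpha> * y))" for \<alpha> :: real by (intro continuous_intros)
  have HI: "integrable (on_plate l) (H n)" for n
    unfolding H_def by (rule integral_product_plate(1)[OF remainder_integrable bc])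
  have orth: "sine_exp_orthogonal l (H n) n" for n
    unfolding sine_exp_orthogonal_def
  proof (intro conjI HI allI ballI)
    fix k i assume i: "i \<in> {1..n}"
    have "(LINT z|on_plate l. H n z * (sin (real i * fst z) * exp (real k * snd z))) =
        (LINT z|on_plate l. (sine_remainder g n (fst z) * sin (real i * fst z)) * exp ((\<alpha> + real k) * snd z))"
      by (simp add: H_def distrib_right exp_add mult.assoc mult.left_commute[of "sin _"] mult.commute[of "sin _"])
    also have "\<dots> = 0"
      using integral_product_plate(2)[OF integrable_mult_sin[OF remainder_integrable] bc]
        remainder_orthogonal[of i n] i by simp
    finally show "(LINT z|on_plate l. H n z * (sin (real i * fst z) * exp (real k * snd z))) = 0" .
  qed
  \<comment> \<open>Uniform in n: the absolute value of the remainder is at most 1 plus its square,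
    and the square has integral at most that of g^2.\<close>
  have bound: "(LINT z|on_plate l. \<bar>H n z\<bar>) \<le> (pi + (LINT x|on_Ipi. (g x)\<^sup>2)) * integral {-l..l} (\<lambda>y. exp (\<alpha> * y))" for n
  proof -
    have J: "0 \<le> integral {-l..l} (\<lambda>y. exp (\<alpha> * y))"
      by (intro integral_nonneg integrable_continuous_real continuous_intros) simp
    have "(LINT z|on_plate l. \<bar>H n z\<bar>) = (LINT z|on_plate l. \<bar>sine_remainder g n (fst z)\<bar> * exp (\<alpha> * snd z))"
      by (simp add: H_def abs_mult)
    also have "\<dots> = (LINT x|on_Ipi. \<bar>sine_remainder g n x\<bar>) * integral {-l..l} (\<lambda>y. exp (\<alpha> * y))"
      by (rule integral_product_plate(2)[OF integrable_abs[OF remainder_integrable] bc])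
    also have "\<dots> \<le> (pi + (LINT x|on_Ipi. (g x)\<^sup>2)) * integral {-l..l} (\<lambda>y. exp (\<alpha> * y))"
    proof (rule mult_right_mono[OF _ J])
      note c = finite_measure.integrable_const[OF finite_measure_Ipi, of "1::real"]
      have "(LINT x|on_Ipi. \<bar>sine_remainder g n x\<bar>) \<le> (LINT x|on_Ipi. 1 + (sine_remainder g n x)\<^sup>2)"
        by (intro integral_mono integrable_abs remainder_integrable Bochner_Integration.integrable_add c remainder_square)
          (rule abs_le_1_plus_square)
      also have "\<dots> = (LINT x|on_Ipi. 1) + (LINT x|on_Ipi. (sine_remainder g n x)\<^sup>2)"
        by (intro Bochner_Integration.integral_add c remainder_square)
      also have "(LINT x|on_Ipi. (sine_remainder g n x)\<^sup>2) \<le> (LINT x|on_Ipi. (g x)\<^sup>2)"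
        unfolding remainder_square by (simp add: sum_nonneg)
      also have "(LINT x|on_Ipi. 1) = pi"
        using integral_lebesgue_on_Ioo(2)[OF pi_gt_zero, of "\<lambda>x. x" "\<lambda>x. 1"] by simp
      finally show "(LINT x|on_Ipi. \<bar>sine_remainder g n x\<bar>) \<le> pi + (LINT x|on_Ipi. (g x)\<^sup>2)" by simp
    qed
    finally show ?thesis .
  qed
  have lim: "(\<lambda>n. LINT z|on_plate l. H n z * v z) \<longlonglongrightarrow> 0"
    by (rule sine_exp_orthogonal_tendsto_0[OF l v v0 orth bound])
  let ?E = "LINT z|on_plate l. exp (\<alpha> * snd z) * g (fst z) * v z"
  let ?T = "\<lambda>i. sine_coeff g i * (LINT z|on_plate l. exp (\<alpha> * snd z) * sin (real i * fst z) * v z)"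
  have "?E - (LINT z|on_plate l. H n z * v z) = (\<Sum>i=1..n. ?T i)" for n
  proof -
    have gI: "integrable (on_plate l) (\<lambda>z. g (fst z) * exp (\<alpha> * snd z))"
      by (rule integral_product_plate(1)[OF L2_Ipi_integrable(1) bc])
    have tI: "integrable (on_plate l) (\<lambda>z. sine_coeff g i * (exp (\<alpha> * snd z) * sin (real i * fst z) * v z))" for i
      by (intro continuous_integrable_plate[OF l] continuous_intros v)
    have "?E = (LINT z|on_plate l. H n z * v z + (\<Sum>i=1..n. sine_coeff g i * (exp (\<alpha> * snd z) * sin (real i * fst z) * v z)))"
    proof (rule Bochner_Integration.integral_cong)
      fix z :: "real \<times> real"
      have "g (fst z) = sine_remainder g n (fst z) + (\<Sum>i=1..n. sine_coeff g i * sin (real i * fst z))"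
        by (simp add: sine_remainder_def)
      then have "exp (\<alpha> * snd z) * g (fst z) * v z =
          H n z * v z + (\<Sum>i=1..n. sine_coeff g i * sin (real i * fst z)) * (exp (\<alpha> * snd z) * v z)"
        by (simp add: H_def algebra_simps)
      then show "exp (\<alpha> * snd z) * g (fst z) * v z =
          H n z * v z + (\<Sum>i=1..n. sine_coeff g i * (exp (\<alpha> * snd z) * sin (real i * fst z) * v z))"
        by (simp only: sum_distrib_right mult.assoc mult.left_commute[of "sin _"] mult.commute[of "sin _"])
    qed simp
    also have "\<dots> = (LINT z|on_plate l. H n z * v z) + (LINT z|on_plate l. (\<Sum>i=1..n. sine_coeff g i * (exp (\<alpha> * snd z) * sin (real i * fst z) * v z)))"
      by (intro Bochner_Integration.integral_add Bochner_Integration.integrable_sum tI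
          integrable_mult_continuous_plate[OF l] HI v)
    also have "(LINT z|on_plate l. (\<Sum>i=1..n. sine_coeff g i * (exp (\<alpha> * snd z) * sin (real i * fst z) * v z))) = (\<Sum>i=1..n. ?T i)"
      by (subst Bochner_Integration.integral_sum[OF tI]) simp
    finally show ?thesis by simp
  qed
  moreover have "(\<lambda>n. ?E - (LINT z|on_plate l. H n z * v z)) \<longlonglongrightarrow> ?E - 0"
    by (intro tendsto_diff lim tendsto_const)
  ultimately have "(\<lambda>n. \<Sum>i=1..n. ?T i) \<longlonglongrightarrow> ?E" by simp
  moreover have "(\<Sum>i=1..n. ?T i) = (\<Sum>i<n. ?T (Suc i))" for n
    using sum.atLeast1_atMost_eq[of ?T n] by simp
  ultimately show ?thesis by (simp add: sums_def)
qed

end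

subsection \<open>Superposition of modes\<close>

lemma deriv_sin_mode: "deriv (\<lambda>x. sin (c * x)) = (\<lambda>x. c * cos (c * x))"
  by (rule ext, rule DERIV_imp_deriv) (auto intro!: derivative_eq_intros)

lemma deriv_cos_mode: "deriv (\<lambda>x. cos (c * x)) = (\<lambda>x. - c * sin (c * x))"
  by (rule ext, rule DERIV_imp_deriv) (auto intro!: derivative_eq_intros)

lemma deriv_deriv_sin_mode: "deriv (deriv (\<lambda>x. sin (c * x))) = (\<lambda>x. - c\<^sup>2 * sin (c * x))"
  unfolding deriv_sin_mode
  by (rule ext, rule DERIV_imp_deriv) (auto intro!: derivative_eq_intros simp: power2_eq_square)

lemma sin_of_nat_mult_pi: "sin (real m * pi) = 0"
  using sin_npi[of m] by (simp add: mult.commute)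

definition mode :: "(nat \<Rightarrow> real \<Rightarrow> real) \<Rightarrow> nat \<Rightarrow> nat \<Rightarrow> nat \<Rightarrow> real \<times> real \<Rightarrow> real" where
  "mode p i j n = tensor ((deriv ^^ i) (\<lambda>x. sin (real (Suc n) * x))) ((deriv ^^ j) (p n))"

lemma funpow_2: "(f ^^ 2) x = f (f x)"
  by (simp add: numeral_2_eq_2)

lemma mode_simps:
  "mode p 0 0 n = tensor (\<lambda>x. sin (real (Suc n) * x)) (p n)"
  "mode p 2 0 n = tensor (\<lambda>x. - (real (Suc n))\<^sup>2 * sin (real (Suc n) * x)) (p n)"
  "mode p 0 2 n = tensor (\<lambda>x. sin (real (Suc n) * x)) (deriv (deriv (p n)))"
  "mode p 1 1 n = tensor (\<lambda>x. real (Suc n) * cos (real (Suc n) * x)) (deriv (p n))"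
  by (simp_all only: mode_def funpow_2 One_nat_def funpow.simps o_apply id_apply deriv_deriv_sin_mode)
    (simp_all only: deriv_sin_mode)

text \<open>A single summable majorant for all derivatives of order at most two. The powers of
  \<open>Suc n\<close> account for the x-derivatives of the sine, so mixed and pure derivatives are
  treated alike.\<close>

locale mode_series =
  fixes l :: real and p :: "nat \<Rightarrow> real \<Rightarrow> real" and Mb :: "nat \<Rightarrow> real"
  assumes l: "l > 0" and p_smooth: "\<And>n. smooth (p n)" and Mb: "summable Mb"
    and bound0: "\<And>n y. y \<in> {-l..l} \<Longrightarrow> (real (Suc n))\<^sup>2 * \<bar>p n y\<bar> \<le> Mb n"
    and bound1: "\<And>n y. y \<in> {-l..l} \<Longrightarrow> real (Suc n) * \<bar>deriv (p n) y\<bar> \<le> Mb n"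
    and bound2: "\<And>n y. y \<in> {-l..l} \<Longrightarrow> \<bar>deriv (deriv (p n)) y\<bar> \<le> Mb n"
begin

definition total :: "nat \<Rightarrow> nat \<Rightarrow> real \<times> real \<Rightarrow> real" where
  "total i j z = (\<Sum>n. mode p i j n z)"

lemma mode_bound:
  assumes ij: "i + j \<le> 2" and z: "z \<in> closure (plate l)"
  shows "\<bar>mode p i j n z\<bar> \<le> Mb n"
proof -
  let ?m = "real (Suc n)"
  have y: "snd z \<in> {-l..l}" using z by (auto simp: closure_plate[OF l])
  have m: "1 \<le> ?m" by simp
  have S: "\<bar>(deriv ^^ i) (\<lambda>x. sin (?m * x)) t\<bar> \<le> ?m ^ i" for t
  proof -
    consider "i = 0" | "i = 1" | "i = 2" using ij by linarith
    then show ?thesis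
    proof cases
      case 3
      then show ?thesis
        using mult_left_mono[OF abs_sin_le_one[of "?m * t"], of "?m\<^sup>2"]
        by (simp add: numeral_2_eq_2[symmetric] deriv_deriv_sin_mode abs_mult) (simp add: numeral_2_eq_2 deriv_deriv_sin_mode abs_mult)
    qed (use mult_left_mono[OF abs_cos_le_one[of "?m * t"], of ?m] in \<open>simp_all add: deriv_sin_mode abs_mult\<close>)
  qed
  have P: "?m ^ i * \<bar>(deriv ^^ j) (p n) (snd z)\<bar> \<le> Mb n"
  proof -
    consider "j = 0" | "j = 1" | "j = 2" using ij by linarith
    then show ?thesis
    proof cases
      case 1
      have "?m ^ i * \<bar>p n (snd z)\<bar> \<le> ?m\<^sup>2 * \<bar>p n (snd z)\<bar>"
        using m ij 1 by (intro mult_right_mono power_increasing) auto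
      then show ?thesis using bound0[OF y, of n] 1 by simp
    next
      case 2
      have "?m ^ i * \<bar>deriv (p n) (snd z)\<bar> \<le> ?m ^ 1 * \<bar>deriv (p n) (snd z)\<bar>"
        using m ij 2 by (intro mult_right_mono power_increasing) auto
      then show ?thesis using bound1[OF y, of n] 2 by simp
    next
      case 3
      then have "i = 0" using ij by simp
      then show ?thesis using bound2[OF y, of n] 3 by (simp add: numeral_2_eq_2)
    qed
  qed
  have "\<bar>mode p i j n z\<bar> \<le> ?m ^ i * \<bar>(deriv ^^ j) (p n) (snd z)\<bar>"
    unfolding mode_def tensor_def abs_mult using S by (intro mult_right_mono) auto
  then show ?thesis using P by linarith
qed

lemma Mb_nonneg: "0 \<le> Mb n"
  using bound2[of l n] l by (intro order_trans[OF abs_ge_zero bound2[of l n]]) simp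

lemma mode_continuous: "continuous_on S (mode p i j n)"
  unfolding mode_def
  by (intro tensor_continuous_on smooth_continuous_on smooth_funpow_deriv smooth_sin_cos p_smooth)

lemma mode_sums: "i + j \<le> 2 \<Longrightarrow> z \<in> closure (plate l) \<Longrightarrow> (\<lambda>n. mode p i j n z) sums total i j z"
  unfolding total_def using mode_bound Mb
  by (intro summable_sums summable_comparison_test'[OF Mb]) auto

lemma partial_sum_bound:
  assumes "i + j \<le> 2" "z \<in> closure (plate l)"
  shows "\<bar>\<Sum>k<n. mode p i j k z\<bar> \<le> suminf Mb"
proof -
  have "\<bar>\<Sum>k<n. mode p i j k z\<bar> \<le> (\<Sum>k<n. Mb k)"
    by (rule order_trans[OF sum_abs sum_mono]) (rule mode_bound[OF assms])
  also have "\<dots> \<le> suminf Mb" by (rule sum_le_suminf[OF Mb]) (auto simp: Mb_nonneg)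
  finally show ?thesis .
qed

lemma total_bound:
  assumes "i + j \<le> 2" "z \<in> closure (plate l)"
  shows "\<bar>total i j z\<bar> \<le> suminf Mb"
  using mode_sums[OF assms] partial_sum_bound[OF assms]
  by (intro LIMSEQ_le_const2[OF tendsto_rabs[OF mode_sums[OF assms, unfolded sums_def]]]) auto

lemma total_continuous:
  assumes "i + j \<le> 2"
  shows "continuous_on (closure (plate l)) (total i j)"
proof -
  have "uniform_limit (closure (plate l)) (\<lambda>n z. \<Sum>k<n. mode p i j k z) (total i j) sequentially"
    unfolding total_def using mode_bound[OF assms] by (intro Weierstrass_m_test[OF _ Mb]) auto
  then show ?thesis
    by (rule uniform_limit_theorem[rotated])
      (auto intro!: always_eventually continuous_on_sum mode_continuous)
qed

lemma total_L2: "i + j \<le> 2 \<Longrightarrow> total i j \<in> L2 (plate l)"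
  by (rule bounded_L2_plate[OF continuous_measurable_plate[OF total_continuous] total_bound])
    (use closure_subset in auto)

text \<open>The partial sums are bounded by \<open>suminf Mb\<close>, so dominated convergence
  allows termwise integration against any integrable weight, in particular against the weak
  derivatives of a competitor.\<close>

lemma integral_total_sums:
  assumes ij: "i + j \<le> 2" and h: "integrable (on_plate l) h"
  shows "(\<lambda>n. LINT z|on_plate l. h z * mode p i j n z) sums (LINT z|on_plate l. h z * total i j z)"
proof -
  have cl: "z \<in> closure (plate l)" if "z \<in> space (on_plate l)" for z
    using that closure_subset[of "plate l"] by auto
  have "(\<lambda>n. LINT z|on_plate l. h z * (\<Sum>k<n. mode p i j k z)) \<longlonglongrightarrow> (LINT z|on_plate l. h z * total i j z)"
  proof (rule integral_mult_tendsto[OF h, where B = "suminf Mb"])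
    show "(\<lambda>z. \<Sum>k<n. mode p i j k z) \<in> borel_measurable (on_plate l)" for n
      by (intro continuous_measurable_plate continuous_on_sum mode_continuous)
    show "(\<lambda>n. \<Sum>k<n. mode p i j k z) \<longlonglongrightarrow> total i j z" if "z \<in> space (on_plate l)" for z
      using mode_sums[OF ij cl[OF that]] by (simp add: sums_def)
  qed (use partial_sum_bound[OF ij] cl in auto)
  moreover have "(LINT z|on_plate l. h z * (\<Sum>k<n. mode p i j k z)) = (\<Sum>k<n. LINT z|on_plate l. h z * mode p i j k z)" for n
    unfolding sum_distrib_left
    by (intro Bochner_Integration.integral_sum integrable_mult_continuous_plate[OF l h] mode_continuous)
  ultimately show ?thesis by (simp add: sums_def)
qed

text \<open>The identity holds for each mode classically; both sides are summed and limits
  compared.\<close>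

lemma total_has_weak_derivative:
  assumes ij: "i + j \<le> 2"
  shows "has_weak_derivative (plate l) i j (total 0 0) (total i j)"
  unfolding has_weak_derivative_def
proof
  fix \<phi> assume \<phi>: "\<phi> \<in> test_functions (plate l)"
  define D where "D = (partial_x ^^ i) ((partial_y ^^ j) \<phi>)"
  have I: "integrable (on_plate l) \<psi>" if "\<psi> \<in> test_functions (plate l)" for \<psi>
    by (rule continuous_integrable_plate[OF l test_function_continuous[OF that]])
  have T: "D \<in> test_functions (plate l)" unfolding D_def by (rule partial_funpow_test_functions[OF \<phi>])
  have "(\<lambda>n. LINT z|on_plate l. D z * mode p 0 0 n z) sums (LINT z|on_plate l. D z * total 0 0 z)"
    by (rule integral_total_sums[OF _ I[OF T]]) simp
  moreover have "(LINT z|on_plate l. D z * mode p 0 0 n z) = (-1) ^ (i + j) * (LINT z|on_plate l. \<phi> z * mode p i j n z)" for n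
    using bspec[OF tensor_has_weak_derivative[OF l smooth_sin_cos(1)[of "real (Suc n)"] p_smooth[of n],
        unfolded has_weak_derivative_def] \<phi>, of i j]
    by (simp only: mode_def D_def mult.commute funpow.simps id_apply)
  moreover have "(\<lambda>n. (-1) ^ (i + j) * (LINT z|on_plate l. \<phi> z * mode p i j n z)) sums
      ((-1) ^ (i + j) * (LINT z|on_plate l. \<phi> z * total i j z))"
    by (intro sums_mult integral_total_sums[OF ij I[OF \<phi>]])
  ultimately have "(LINT z|on_plate l. D z * total 0 0 z) = (-1) ^ (i + j) * (LINT z|on_plate l. \<phi> z * total i j z)"
    using sums_unique2 by (metis (no_types, lifting) sums_cong)
  then show "(LINT z|on_plate l. total 0 0 z * (partial_x ^^ i) ((partial_y ^^ j) \<phi>) z) =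
      (-1) ^ (i + j) * (LINT z|on_plate l. total i j z * \<phi> z)"
    by (simp add: D_def mult.commute)
qed

lemma total_H2_star: "total 0 0 \<in> H2_star l"
proof -
  have "total 0 0 \<in> H2 (plate l)"
    unfolding H2_def mem_Collect_eq
    by (intro conjI allI impI total_L2, simp, rule bexI, rule total_has_weak_derivative, assumption, rule total_L2)
  moreover have "total 0 0 z = 0" if "z \<in> {0, pi} \<times> {-l<..<l}" for z
  proof -
    have "fst z = 0 \<or> fst z = pi" using that by auto
    then have "mode p 0 0 n z = 0" for n
      unfolding mode_simps tensor_def using sin_of_nat_mult_pi[of "Suc n"] by auto
    then show ?thesis by (simp add: total_def)
  qed
  ultimately show ?thesis by (auto simp: H2_star_def total_continuous)
qed

text \<open>Green's formula turns the energy of each mode against \<open>v\<close> into the integral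
  of \<open>v\<close> against the load of that mode. The conditions \<open>bc2\<close> and
  \<open>bc3\<close> are the edge conditions required of \<open>Q\<close> and \<open>R\<close>
  there.\<close>

lemma inner_total_sums:
  assumes v: "v \<in> H2_star l"
    and bc2: "\<And>n y. y = l \<or> y = -l \<Longrightarrow> deriv (deriv (p n)) y = \<sigma> * (real (Suc n))\<^sup>2 * p n y"
    and bc3: "\<And>n y. y = l \<or> y = -l \<Longrightarrow>
      deriv (deriv (deriv (p n))) y = (2 - \<sigma>) * (real (Suc n))\<^sup>2 * deriv (p n) y"
    and load: "\<And>n y. deriv (deriv (deriv (deriv (p n)))) y - 2 * (real (Suc n))\<^sup>2 * deriv (deriv (p n)) y
      + (real (Suc n)) ^ 4 * p n y = F n y"
  shows "(\<lambda>n. LINT z|on_plate l. v z * (sin (real (Suc n) * fst z) * F n (snd z))) sums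
    H2_star_inner l \<sigma> (total 0 0) v"
proof -
  let ?v20 = "weak_derivative (plate l) 2 0 v" and ?v02 = "weak_derivative (plate l) 0 2 v"
    and ?v11 = "weak_derivative (plate l) 1 1 v"
  let ?u20 = "weak_derivative (plate l) 2 0 (total 0 0)" and ?u02 = "weak_derivative (plate l) 0 2 (total 0 0)"
    and ?u11 = "weak_derivative (plate l) 1 1 (total 0 0)"
  note vw = H2_weak_derivative[OF l H2_star_D(1)[OF v]]
  have vI: "integrable (on_plate l) ?v20" "integrable (on_plate l) ?v02" "integrable (on_plate l) ?v11"
    by (rule L2_integrable_plate[OF vw(1)], simp)+
  have AE: "AE z in on_plate l. ?u20 z = total 2 0 z" "AE z in on_plate l. ?u02 z = total 0 2 z"
    "AE z in on_plate l. ?u11 z = total 1 1 z"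
    by (rule weak_derivative_AE(3)[OF l total_L2 total_has_weak_derivative], simp, simp)+
  have um: "?u20 \<in> borel_measurable (on_plate l)" "?u02 \<in> borel_measurable (on_plate l)" "?u11 \<in> borel_measurable (on_plate l)"
    using weak_derivative_AE(1)[OF l total_L2 total_has_weak_derivative] by (simp_all add: L2_def)
  have tm: "total 2 0 \<in> borel_measurable (on_plate l)" "total 0 2 \<in> borel_measurable (on_plate l)" "total 1 1 \<in> borel_measurable (on_plate l)"
    by (rule continuous_measurable_plate[OF total_continuous], simp)+
  note [measurable] = um tm vI[THEN borel_measurable_integrable]
  have I: "integrable (on_plate l) (\<lambda>z. h z * total i j z)" if "integrable (on_plate l) h" "i + j \<le> 2" for h i j
    by (rule integrable_mult_continuous_plate[OF l that(1) total_continuous[OF that(2)]])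
  \<comment> \<open>The form is regrouped by the derivatives of \<open>v\<close>, with coefficients
    u_xx + \<sigma> u_yy, u_yy + \<sigma> u_xx and 2 (1 - \<sigma>) u_xy; the chosen representatives
    for u are replaced by the classical sums almost everywhere.\<close>
  have "H2_star_inner l \<sigma> (total 0 0) v = (LINT z|on_plate l.
      ?v20 z * total 2 0 z + \<sigma> * (?v20 z * total 0 2 z) + (?v02 z * total 0 2 z + \<sigma> * (?v02 z * total 2 0 z))
      + 2 * (1 - \<sigma>) * (?v11 z * total 1 1 z))"
    unfolding H2_star_inner_def Let_def
  proof (rule integral_cong_AE)
    show "AE z in on_plate l. (?u20 z + ?u02 z) * (?v20 z + ?v02 z) +
        (1 - \<sigma>) * (2 * ?u11 z * ?v11 z - ?u20 z * ?v02 z - ?u02 z * ?v20 z) =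
        ?v20 z * total 2 0 z + \<sigma> * (?v20 z * total 0 2 z) + (?v02 z * total 0 2 z + \<sigma> * (?v02 z * total 2 0 z))
        + 2 * (1 - \<sigma>) * (?v11 z * total 1 1 z)"
      using AE by eventually_elim (simp add: algebra_simps)
  qed measurable
  also have "\<dots> = (LINT z|on_plate l. ?v20 z * total 2 0 z) + \<sigma> * (LINT z|on_plate l. ?v20 z * total 0 2 z)
      + ((LINT z|on_plate l. ?v02 z * total 0 2 z) + \<sigma> * (LINT z|on_plate l. ?v02 z * total 2 0 z))
      + 2 * (1 - \<sigma>) * (LINT z|on_plate l. ?v11 z * total 1 1 z)"
    using I[OF vI(1), of 2 0] I[OF vI(1), of 0 2] I[OF vI(2), of 2 0] I[OF vI(2), of 0 2] I[OF vI(3), of 1 1]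
    by simp
  finally have inner: "H2_star_inner l \<sigma> (total 0 0) v = \<dots>" .
  have "(\<lambda>n. (LINT z|on_plate l. ?v20 z * mode p 2 0 n z) + \<sigma> * (LINT z|on_plate l. ?v20 z * mode p 0 2 n z)
      + ((LINT z|on_plate l. ?v02 z * mode p 0 2 n z) + \<sigma> * (LINT z|on_plate l. ?v02 z * mode p 2 0 n z))
      + 2 * (1 - \<sigma>) * (LINT z|on_plate l. ?v11 z * mode p 1 1 n z)) sums H2_star_inner l \<sigma> (total 0 0) v"
    unfolding inner by (intro sums_add sums_mult integral_total_sums vI) simp_all
  moreover have "(LINT z|on_plate l. ?v20 z * mode p 2 0 n z) + \<sigma> * (LINT z|on_plate l. ?v20 z * mode p 0 2 n z)
      + ((LINT z|on_plate l. ?v02 z * mode p 0 2 n z) + \<sigma> * (LINT z|on_plate l. ?v02 z * mode p 2 0 n z))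
      + 2 * (1 - \<sigma>) * (LINT z|on_plate l. ?v11 z * mode p 1 1 n z) =
      (LINT z|on_plate l. v z * (sin (real (Suc n) * fst z) * F n (snd z)))" for n
  proof -
    define m where "m = real (Suc n)"
    define s where "s = (\<lambda>x. sin (m * x))"
    define c where "c = (\<lambda>x. cos (m * x))"
    \<comment> \<open>\<open>P\<close>, \<open>Q\<close> and \<open>R\<close> are these three
      coefficients for the single mode sin (m x) p(y). Vanishing of \<open>Q\<close> at the edges is
      the bending condition, and equality of \<open>deriv Q\<close> with \<open>m * R\<close> there
      is the shear condition.\<close>
    define P where "P = (\<lambda>y. - m\<^sup>2 * p n y + \<sigma> * deriv (deriv (p n)) y)"
    define Q where "Q = (\<lambda>y. deriv (deriv (p n)) y + (- \<sigma> * m\<^sup>2) * p n y)"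
    define R where "R = (\<lambda>y. (2 * (1 - \<sigma>) * m) * deriv (p n) y)"
    note sm = smooth_add smooth_mult smooth_const smooth_deriv p_smooth
    have smP: "smooth P" "smooth Q" "smooth R" unfolding P_def Q_def R_def by (intro sm)+
    note D = smooth_DERIV[OF p_smooth] smooth_DERIV[OF smooth_deriv[OF p_smooth]]
      smooth_DERIV[OF smooth_deriv[OF smooth_deriv[OF p_smooth]]]
      smooth_DERIV[OF smooth_deriv[OF smooth_deriv[OF smooth_deriv[OF p_smooth]]]]
    have dQ: "deriv Q = (\<lambda>y. deriv (deriv (deriv (p n))) y + (- \<sigma> * m\<^sup>2) * deriv (p n) y)"
      unfolding Q_def by (rule ext, rule DERIV_imp_deriv, intro DERIV_add DERIV_cmult D)
    have ddQ: "deriv (deriv Q) = (\<lambda>y. deriv (deriv (deriv (deriv (p n)))) y + (- \<sigma> * m\<^sup>2) * deriv (deriv (p n)) y)"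
      unfolding dQ by (rule ext, rule DERIV_imp_deriv, intro DERIV_add DERIV_cmult D)
    have dR: "deriv R = (\<lambda>y. (2 * (1 - \<sigma>) * m) * deriv (deriv (p n)) y)"
      unfolding R_def by (rule ext, rule DERIV_imp_deriv, intro DERIV_cmult D)
    have spi: "s 0 = 0" "s pi = 0" unfolding s_def m_def by (simp, rule sin_of_nat_mult_pi)
    have green: "(LINT z|on_plate l. ?v20 z * tensor s P z) + (LINT z|on_plate l. ?v02 z * tensor s Q z) +
        (LINT z|on_plate l. ?v11 z * tensor c R z) =
        (LINT z|on_plate l. v z * tensor s (\<lambda>y. - m\<^sup>2 * P y + deriv (deriv Q) y - m * deriv R y) z)"
    proof (rule green_formula[OF l v])
      show "?v20 \<in> L2 (plate l)" "has_weak_derivative (plate l) 2 0 v ?v20"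
        "?v11 \<in> L2 (plate l)" "has_weak_derivative (plate l) 1 1 v ?v11"
        "?v02 \<in> L2 (plate l)" "has_weak_derivative (plate l) 0 2 v ?v02"
        by (rule vw; simp)+
      show "smooth s" "smooth c" unfolding s_def c_def by (rule smooth_sin_cos)+
      show "deriv (deriv s) x = - m\<^sup>2 * s x" for x unfolding s_def deriv_deriv_sin_mode by simp
      show "deriv c x = - m * s x" for x unfolding s_def c_def deriv_cos_mode by simp
      show "Q l = 0" "Q (-l) = 0" using bc2[of _ n] by (simp_all add: Q_def m_def)
      show "deriv Q l = m * R l" "deriv Q (-l) = m * R (-l)"
        unfolding dQ R_def using bc3[of _ n, folded m_def] by (simp_all add: power2_eq_square algebra_simps)
    qed (fact spi smP)+
    have e: "tensor s (\<lambda>y. - m\<^sup>2 * P y + deriv (deriv Q) y - m * deriv R y) z = sin (real (Suc n) * fst z) * F n (snd z)" for z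
    proof -
      have "- m\<^sup>2 * P y + deriv (deriv Q) y - m * deriv R y = F n y" for y
        using load[of n y, folded m_def] unfolding ddQ dR P_def
        by (simp add: algebra_simps power2_eq_square power4_eq_xxxx)
      then show ?thesis by (simp only: tensor_def s_def m_def)
    qed
    have c: "continuous_on (closure (plate l)) (tensor s f)" if "smooth f" for f
      unfolding s_def by (intro tensor_continuous_on smooth_continuous_on smooth_sin_cos that)
    have e20: "(LINT z|on_plate l. ?v20 z * tensor s P z) =
        (LINT z|on_plate l. ?v20 z * mode p 2 0 n z) + \<sigma> * (LINT z|on_plate l. ?v20 z * mode p 0 2 n z)"
    proof -
      have "(LINT z|on_plate l. ?v20 z * tensor s P z) =
          (LINT z|on_plate l. ?v20 z * mode p 2 0 n z + \<sigma> * (?v20 z * mode p 0 2 n z))"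
        unfolding mode_simps by (simp add: tensor_def s_def P_def m_def[symmetric] algebra_simps del: of_nat_Suc)
      also have "\<dots> = (LINT z|on_plate l. ?v20 z * mode p 2 0 n z) + (LINT z|on_plate l. \<sigma> * (?v20 z * mode p 0 2 n z))"
        by (intro Bochner_Integration.integral_add integrable_mult_right integrable_mult_continuous_plate[OF l vI(1)] mode_continuous)
      finally show ?thesis by simp
    qed
    have e02: "(LINT z|on_plate l. ?v02 z * tensor s Q z) =
        (LINT z|on_plate l. ?v02 z * mode p 0 2 n z) + \<sigma> * (LINT z|on_plate l. ?v02 z * mode p 2 0 n z)"
    proof -
      have "(LINT z|on_plate l. ?v02 z * tensor s Q z) =
          (LINT z|on_plate l. ?v02 z * mode p 0 2 n z + \<sigma> * (?v02 z * mode p 2 0 n z))"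
        unfolding mode_simps by (simp add: tensor_def s_def Q_def m_def[symmetric] algebra_simps del: of_nat_Suc)
      also have "\<dots> = (LINT z|on_plate l. ?v02 z * mode p 0 2 n z) + (LINT z|on_plate l. \<sigma> * (?v02 z * mode p 2 0 n z))"
        by (intro Bochner_Integration.integral_add integrable_mult_right integrable_mult_continuous_plate[OF l vI(2)] mode_continuous)
      finally show ?thesis by simp
    qed
    have e11: "(LINT z|on_plate l. ?v11 z * tensor c R z) = 2 * (1 - \<sigma>) * (LINT z|on_plate l. ?v11 z * mode p 1 1 n z)"
    proof -
      have "(LINT z|on_plate l. ?v11 z * tensor c R z) = (LINT z|on_plate l. 2 * (1 - \<sigma>) * (?v11 z * mode p 1 1 n z))"
        unfolding mode_simps by (simp add: tensor_def c_def R_def m_def[symmetric] algebra_simps del: of_nat_Suc)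
      then show ?thesis by simp
    qed
    show ?thesis using green unfolding e20 e02 e11 e by simp
  qed
  ultimately show ?thesis by simp
qed

end

subsection \<open>The profiles of the modes\<close>

text \<open>The hyperbolic terms span the kernel of the square of d^2/dy^2 - m^2, and the
  exponential is the particular part.\<close>

definition profile :: "real \<Rightarrow> real \<Rightarrow> real \<Rightarrow> real \<Rightarrow> real \<Rightarrow> real \<Rightarrow> real \<Rightarrow> real \<Rightarrow> real" where
  "profile \<alpha> m G A B C D y =
     G * exp (\<alpha> * y) + A * cosh (m * y) + B * sinh (m * y) + C * (y * cosh (m * y)) + D * (y * sinh (m * y))"

lemma smooth_profile: "smooth (profile \<alpha> m G A B C D)"
  unfolding profile_def[abs_def]
  by (intro smooth_add smooth_mult smooth_const smooth_exp smooth_cosh_sinh smooth_ident)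

text \<open>Differentiation acts linearly on the five coefficients, so higher derivatives are
  obtained by rewriting.\<close>

lemma deriv_profile:
  "deriv (profile \<alpha> m G A B C D) = profile \<alpha> m (\<alpha> * G) (m * B + C) (m * A + D) (m * D) (m * C)"
proof (rule ext, rule DERIV_imp_deriv)
  fix y
  show "(profile \<alpha> m G A B C D has_real_derivative profile \<alpha> m (\<alpha> * G) (m * B + C) (m * A + D) (m * D) (m * C) y) (at y)"
    unfolding profile_def[abs_def]
    by (auto intro!: derivative_eq_intros simp: algebra_simps)
qed

lemma profile_equation:
  "deriv (deriv (deriv (deriv (profile \<alpha> m G A B C D)))) y - 2 * m\<^sup>2 * deriv (deriv (profile \<alpha> m G A B C D)) y
    + m ^ 4 * profile \<alpha> m G A B C D y = (m\<^sup>2 - \<alpha>\<^sup>2)\<^sup>2 * G * exp (\<alpha> * y)"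
  unfolding deriv_profile profile_def by (simp add: algebra_simps power2_eq_square power4_eq_xxxx)

lemma exp_eq_cosh_plus_sinh: "exp x = cosh x + sinh x" for x :: real
  by (simp add: cosh_plus_sinh)

text \<open>The two systems are the even and the odd parts in \<open>y\<close> of the natural boundary conditions.\<close>

lemma profile_boundary_conditions:
  assumes AD: "system_AD l \<sigma> \<alpha> \<gamma> k A D" and BC: "system_BC l \<sigma> \<alpha> \<gamma> k B C"
    and y: "y = l \<or> y = -l"
  defines "G \<equiv> \<gamma> k / ((real k)\<^sup>2 - \<alpha>\<^sup>2)\<^sup>2"
  shows "deriv (deriv (profile \<alpha> k G A B C D)) y = \<sigma> * (real k)\<^sup>2 * profile \<alpha> k G A B C D y"
    "deriv (deriv (deriv (profile \<alpha> k G A B C D))) y = (2 - \<sigma>) * (real k)\<^sup>2 * deriv (profile \<alpha> k G A B C D) y"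
proof -
  define m where "m = real k"
  have AD': "(1 - \<sigma>) * m^2 * cosh (m * l) * A + m * (2 * cosh (m * l) + (1 - \<sigma>) * m * l * sinh (m * l)) * D
       = G * (\<sigma> * m^2 - \<alpha>^2) * cosh (\<alpha> * l)"
    "(\<sigma> - 1) * m^3 * sinh (m * l) * A + m^2 * ((1 + \<sigma>) * sinh (m * l) + (\<sigma> - 1) * m * l * cosh (m * l)) * D
       = \<alpha> * G * ((2 - \<sigma>) * m^2 - \<alpha>^2) * sinh (\<alpha> * l)"
    using AD unfolding system_AD_def Let_def G_def m_def by simp_all
  have BC': "(1 - \<sigma>) * m^2 * sinh (m * l) * B + m * (2 * sinh (m * l) + (1 - \<sigma>) * m * l * cosh (m * l)) * C
       = G * (\<sigma> * m^2 - \<alpha>^2) * sinh (\<alpha> * l)"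
    "(\<sigma> - 1) * m^3 * cosh (m * l) * B + m^2 * ((1 + \<sigma>) * cosh (m * l) + (\<sigma> - 1) * m * l * sinh (m * l)) * C
       = \<alpha> * G * ((2 - \<sigma>) * m^2 - \<alpha>^2) * cosh (\<alpha> * l)"
    using BC unfolding system_BC_def Let_def G_def m_def by simp_all
  \<comment> \<open>With names for the four hyperbolic values, the conditions at l and at -l become
    polynomial consequences of the systems; passing to -l only flips the signs of \<open>sh\<close>
    and \<open>sa\<close>.\<close>
  define ch sh ca sa where "ch = cosh (m * l)" and "sh = sinh (m * l)" and "ca = cosh (\<alpha> * l)" and "sa = sinh (\<alpha> * l)"
  note eqs = AD'[folded ch_def sh_def ca_def sa_def] BC'[folded ch_def sh_def ca_def sa_def]
  have ml: "cosh (m * -l) = ch" "sinh (m * -l) = - sh" "exp (\<alpha> * -l) = ca - sa"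
    "cosh (m * l) = ch" "sinh (m * l) = sh" "exp (\<alpha> * l) = ca + sa"
    by (simp_all add: ch_def sh_def ca_def sa_def exp_eq_cosh_plus_sinh)
  show "deriv (deriv (profile \<alpha> k G A B C D)) y = \<sigma> * (real k)\<^sup>2 * profile \<alpha> k G A B C D y"
    using y eqs(1,3) unfolding deriv_profile profile_def m_def[symmetric]
    by (elim disjE; hypsubst; unfold ml; algebra)
  show "deriv (deriv (deriv (profile \<alpha> k G A B C D))) y = (2 - \<sigma>) * (real k)\<^sup>2 * deriv (profile \<alpha> k G A B C D) y"
    using y eqs(2,4) unfolding deriv_profile profile_def m_def[symmetric]
    by (elim disjE; hypsubst; unfold ml; algebra)
qed

subsection \<open>The linear systems for the coefficients\<close>

lemma linear_system_2x2:
  fixes a11 a12 a21 a22 r1 r2 x y :: real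
  assumes "a11 * a22 - a12 * a21 \<noteq> 0"
  shows "a11 * x + a12 * y = r1 \<and> a21 * x + a22 * y = r2 \<longleftrightarrow>
    x = (r1 * a22 - a12 * r2) / (a11 * a22 - a12 * a21) \<and> y = (a11 * r2 - r1 * a21) / (a11 * a22 - a12 * a21)"
proof
  assume *: "a11 * x + a12 * y = r1 \<and> a21 * x + a22 * y = r2"
  then have "a11 * x + a12 * y = r1" "a21 * x + a22 * y = r2" by auto
  note r = this[symmetric]
  have "x * (a11 * a22 - a12 * a21) = r1 * a22 - a12 * r2" unfolding r by algebra
  moreover have "y * (a11 * a22 - a12 * a21) = a11 * r2 - r1 * a21" unfolding r by algebra
  ultimately show "x = (r1 * a22 - a12 * r2) / (a11 * a22 - a12 * a21) \<and> y = (a11 * r2 - r1 * a21) / (a11 * a22 - a12 * a21)"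
    using assms by (simp add: eq_divide_eq)
next
  define d where "d = a11 * a22 - a12 * a21"
  assume "x = (r1 * a22 - a12 * r2) / (a11 * a22 - a12 * a21) \<and> y = (a11 * r2 - r1 * a21) / (a11 * a22 - a12 * a21)"
  then have "x * d = r1 * a22 - a12 * r2" "y * d = a11 * r2 - r1 * a21"
    using assms by (simp_all add: d_def)
  then have "(a11 * x + a12 * y - r1) * d = 0 \<and> (a21 * x + a22 * y - r2) * d = 0"
    using d_def by algebra
  then show "a11 * x + a12 * y = r1 \<and> a21 * x + a22 * y = r2" using assms by (simp add: d_def)
qed

text \<open>Cramer's rule: each numerator consists of two products bounded by
  \<open>r * b\<close>.\<close>

lemma linear_system_2x2_bound:
  fixes a11 a12 a21 a22 r1 r2 x y :: real
  assumes sol: "a11 * x + a12 * y = r1" "a21 * x + a22 * y = r2"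
    and det: "a11 * a22 - a12 * a21 \<ge> d" "d > 0"
    and b: "\<bar>a11\<bar> \<le> b" "\<bar>a12\<bar> \<le> b" "\<bar>a21\<bar> \<le> b" "\<bar>a22\<bar> \<le> b" and r: "\<bar>r1\<bar> \<le> r" "\<bar>r2\<bar> \<le> r"
  shows "\<bar>x\<bar> \<le> 2 * r * b / d" "\<bar>y\<bar> \<le> 2 * r * b / d"
proof -
  have aux: "\<bar>t\<bar> \<le> 2 * r * b / d" if "t = (s1 * c1 - s2 * c2) / (a11 * a22 - a12 * a21)"
    "\<bar>s1\<bar> \<le> r" "\<bar>s2\<bar> \<le> r" "\<bar>c1\<bar> \<le> b" "\<bar>c2\<bar> \<le> b" for t s1 s2 c1 c2
  proof -
    have "\<bar>s1 * c1\<bar> \<le> r * b" "\<bar>s2 * c2\<bar> \<le> r * b"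
      unfolding abs_mult using that by (auto intro!: mult_mono)
    then have "\<bar>s1 * c1 - s2 * c2\<bar> \<le> 2 * r * b" by linarith
    moreover have "0 \<le> 2 * r * b" using order_trans[OF abs_ge_zero r(1)] order_trans[OF abs_ge_zero b(1)] by simp
    ultimately show ?thesis
      unfolding that(1) abs_divide using det by (intro frac_le) auto
  qed
  have "x = (r1 * a22 - r2 * a12) / (a11 * a22 - a12 * a21)" "y = (r2 * a11 - r1 * a21) / (a11 * a22 - a12 * a21)"
    using linear_system_2x2[of a11 a22 a12 a21 x y r1 r2] sol det by (simp_all add: mult.commute)
  then show "\<bar>x\<bar> \<le> 2 * r * b / d" "\<bar>y\<bar> \<le> 2 * r * b / d"
    using aux[of x r1 a22 r2 a12] aux[of y r2 a11 r1 a21] b r by blast+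
qed

lemma ex1_pair_linear_system:
  fixes a11 a12 a21 a22 r1 r2 :: real
  assumes "a11 * a22 - a12 * a21 > 0"
  shows "\<exists>!(x, y). a11 * x + a12 * y = r1 \<and> a21 * x + a22 * y = r2"
proof -
  have ne: "a11 * a22 - a12 * a21 \<noteq> 0" using assms by simp
  show ?thesis
    unfolding linear_system_2x2[OF ne] case_prod_unfold
    by (rule ex1I[of _ "((r1 * a22 - a12 * r2) / (a11 * a22 - a12 * a21), (a11 * r2 - r1 * a21) / (a11 * a22 - a12 * a21))"])
      (simp_all add: prod_eq_iff)
qed

text \<open>The last inequality, a consequence of t \<le> sinh t, is what keeps the determinant of
  the first system positive.\<close>

lemma cosh_sinh_facts:
  fixes t :: real
  assumes "t > 0"
  shows "sinh t > 0" "cosh t > 0" "sinh t \<le> cosh t" "cosh t ^ 2 = sinh t ^ 2 + 1" "t \<le> cosh t * sinh t"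
proof -
  show s: "sinh t > 0" using assms by simp
  show "cosh t > 0" by simp
  show "sinh t \<le> cosh t" by (simp add: sinh_def cosh_def)
  show "cosh t ^ 2 = sinh t ^ 2 + 1" using hyperbolic_pythagoras[of t] by simp
  have "sinh 0 - 0 \<le> sinh t - t"
  proof (rule DERIV_nonneg_imp_nondecreasing[where f = "\<lambda>t. sinh t - t"])
    fix x :: real
    have "((\<lambda>t. sinh t - t) has_real_derivative cosh x - 1) (at x)"
      by (auto intro!: derivative_eq_intros)
    then show "\<exists>y. ((\<lambda>t. sinh t - t) has_real_derivative y) (at x) \<and> 0 \<le> y"
      using cosh_real_ge_1[of x] by (intro exI[of _ "cosh x - 1"]) simp
  qed (use assms in simp)
  then have "t \<le> sinh t" by simp
  also have "\<dots> \<le> cosh t * sinh t" using s cosh_real_ge_1[of t] by simp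
  finally show "t \<le> cosh t * sinh t" .
qed

context
  fixes l \<sigma> m :: real
  assumes l: "l > 0" and \<sigma>: "0 < \<sigma>" "\<sigma> < 1" and m: "m \<ge> 1"
begin

private abbreviation "ch \<equiv> cosh (m * l)"
private abbreviation "sh \<equiv> sinh (m * l)"

private lemma ml_pos: "m * l > 0" using l m by simp

private lemmas cs = cosh_sinh_facts[OF ml_pos]

text \<open>By the hyperbolic Pythagorean identity the determinant is (1 - \<sigma>) m^4 times (3 +
  \<sigma>) ch sh - (1 - \<sigma>) m l. As m l \<le> ch sh, the negative term costs at most one of
  the three copies of ch sh.\<close>

lemma det_AD:
  "((1 - \<sigma>) * m^2 * ch) * (m^2 * ((1 + \<sigma>) * sh + (\<sigma> - 1) * m * l * ch))
    - (m * (2 * ch + (1 - \<sigma>) * m * l * sh)) * ((\<sigma> - 1) * m^3 * sh) \<ge> (1 - \<sigma>) * m^4 * (2 * (ch * sh))"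
proof -
  have eq: "((1 - \<sigma>) * m^2 * ch) * (m^2 * ((1 + \<sigma>) * sh + (\<sigma> - 1) * m * l * ch))
    - (m * (2 * ch + (1 - \<sigma>) * m * l * sh)) * ((\<sigma> - 1) * m^3 * sh) =
    (1 - \<sigma>) * m^4 * ((3 + \<sigma>) * (ch * sh) - (1 - \<sigma>) * (m * l) * 1)"
    using cs(4) by algebra
  have "(1 - \<sigma>) * m^4 * (2 * (ch * sh)) \<le> (1 - \<sigma>) * m^4 * ((3 + \<sigma>) * (ch * sh) - (1 - \<sigma>) * (m * l) * 1)"
  proof (rule mult_left_mono)
    have "(1 - \<sigma>) * (m * l) \<le> 1 * (ch * sh)"
      using \<sigma> cs ml_pos by (rule_tac mult_mono) simp_all
    moreover have "0 \<le> \<sigma> * (ch * sh)" using \<sigma> cs by simp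
    ultimately show "2 * (ch * sh) \<le> (3 + \<sigma>) * (ch * sh) - (1 - \<sigma>) * (m * l) * 1"
      by (simp add: distrib_right)
    show "0 \<le> (1 - \<sigma>) * m^4" using \<sigma> by simp
  qed
  then show ?thesis unfolding eq .
qed

text \<open>As for \<open>det_AD\<close>, but the linear term now has a positive sign; the weaker
  common lower bound allows both systems to be estimated together.\<close>

lemma det_BC:
  "((1 - \<sigma>) * m^2 * sh) * (m^2 * ((1 + \<sigma>) * ch + (\<sigma> - 1) * m * l * sh))
    - (m * (2 * sh + (1 - \<sigma>) * m * l * ch)) * ((\<sigma> - 1) * m^3 * ch) \<ge> (1 - \<sigma>) * m^4 * (2 * (ch * sh))"
proof -
  have eq: "((1 - \<sigma>) * m^2 * sh) * (m^2 * ((1 + \<sigma>) * ch + (\<sigma> - 1) * m * l * sh))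
    - (m * (2 * sh + (1 - \<sigma>) * m * l * ch)) * ((\<sigma> - 1) * m^3 * ch) =
    (1 - \<sigma>) * m^4 * ((3 + \<sigma>) * (ch * sh) + (1 - \<sigma>) * (m * l) * 1)"
    using cs(4) by algebra
  have "(1 - \<sigma>) * m^4 * (2 * (ch * sh)) \<le> (1 - \<sigma>) * m^4 * ((3 + \<sigma>) * (ch * sh) + (1 - \<sigma>) * (m * l) * 1)"
  proof (rule mult_left_mono)
    have "0 \<le> (1 - \<sigma>) * (m * l)" using \<sigma> ml_pos by simp
    moreover have "0 \<le> (1 + \<sigma>) * (ch * sh)" using \<sigma> cs by simp
    ultimately show "2 * (ch * sh) \<le> (3 + \<sigma>) * (ch * sh) + (1 - \<sigma>) * (m * l) * 1"
      by (simp add: distrib_right)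
    show "0 \<le> (1 - \<sigma>) * m^4" using \<sigma> by simp
  qed
  then show ?thesis unfolding eq .
qed

lemma det_lower_pos: "(1 - \<sigma>) * m^4 * (2 * (ch * sh)) > 0"
  using \<sigma> m cs by simp

text \<open>With (u, v) = (ch, sh) these are the entries of the first system, with (u, v) = (sh, ch)
  those of the second.\<close>

lemma matrix_entry_bounds:
  assumes uv: "0 \<le> u" "u \<le> ch" "0 \<le> v" "v \<le> ch"
  shows "\<bar>(1 - \<sigma>) * m^2 * u\<bar> \<le> (2 + l) * m^3 * ch"
    "\<bar>m * (2 * u + (1 - \<sigma>) * m * l * v)\<bar> \<le> (2 + l) * m^3 * ch"
    "\<bar>(\<sigma> - 1) * m^3 * v\<bar> \<le> (2 + l) * m^3 * ch"
    "\<bar>m^2 * ((1 + \<sigma>) * v + (\<sigma> - 1) * m * l * u)\<bar> \<le> (2 + l) * m^3 * ch"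
proof -
  have mp: "m \<le> m^3" "m^2 \<le> m^3" "1 \<le> m" "0 \<le> m^3"
    using m power_increasing[of 1 3 m] power_increasing[of 2 3 m] by auto
  have lm: "0 \<le> l * m" using l m by simp
  have e: "(2 + l) * m^3 * ch = 2 * (m^3 * ch) + l * (m^3 * ch)" by (simp add: algebra_simps)
  have nn: "0 \<le> m^3 * ch" "0 \<le> l * (m^3 * ch)" using cs l mp by simp_all
  have b: "m^2 * w \<le> m^3 * ch" "m * w \<le> m^3 * ch" "m^3 * w \<le> m^3 * ch" if "0 \<le> w" "w \<le> ch" for w
    using that mp m by (auto intro!: mult_mono)
  have lb: "m^2 * l * w \<le> l * (m^3 * ch)" "m^3 * l * w \<le> l * (m^3 * ch)" if "0 \<le> w" "w \<le> ch" for w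
    using mult_left_mono[OF b(1)[OF that], of l] mult_left_mono[OF b(3)[OF that], of l] l by (simp_all add: mult_ac)
  have f: "\<bar>(1 - \<sigma>) * t\<bar> \<le> t" "\<bar>(\<sigma> - 1) * t\<bar> \<le> t" "(1 + \<sigma>) * t \<le> 2 * t" if "0 \<le> t" for t
  proof -
    have "0 \<le> (1 - \<sigma>) * t" "0 \<le> \<sigma> * t" using that \<sigma> by simp_all
    moreover have "\<sigma> * t \<le> 1 * t" using that \<sigma> by (intro mult_right_mono) simp_all
    ultimately show "\<bar>(1 - \<sigma>) * t\<bar> \<le> t" "\<bar>(\<sigma> - 1) * t\<bar> \<le> t" "(1 + \<sigma>) * t \<le> 2 * t"
      by (auto simp: algebra_simps)
  qed
  have "\<bar>(1 - \<sigma>) * (m^2 * u)\<bar> \<le> m^2 * u" using uv by (intro f) simp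
  then show "\<bar>(1 - \<sigma>) * m^2 * u\<bar> \<le> (2 + l) * m^3 * ch"
    using b(1)[OF uv(1,2)] nn unfolding e unfolding mult.assoc by linarith
  have "\<bar>(\<sigma> - 1) * (m^3 * v)\<bar> \<le> m^3 * v" using uv mp by (intro f) simp
  then show "\<bar>(\<sigma> - 1) * m^3 * v\<bar> \<le> (2 + l) * m^3 * ch"
    using b(3)[OF uv(3,4)] nn unfolding e unfolding mult.assoc by linarith
  have "\<bar>(1 - \<sigma>) * (m^2 * l * v)\<bar> \<le> m^2 * l * v" using uv l by (intro f) simp
  moreover have "m * (2 * u + (1 - \<sigma>) * m * l * v) = 2 * (m * u) + (1 - \<sigma>) * (m^2 * l * v)"
    by (simp add: power2_eq_square algebra_simps)
  moreover have "0 \<le> m * u" using uv m by simp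
  ultimately show "\<bar>m * (2 * u + (1 - \<sigma>) * m * l * v)\<bar> \<le> (2 + l) * m^3 * ch"
    using b(2)[OF uv(1,2)] lb(1)[OF uv(3,4)] unfolding e by linarith
  have "(1 + \<sigma>) * (m^2 * v) \<le> 2 * (m^2 * v)" using uv by (intro f) simp
  moreover have "\<bar>(\<sigma> - 1) * (m^3 * l * u)\<bar> \<le> m^3 * l * u" using uv l mp by (intro f) simp
  moreover have "m^2 * ((1 + \<sigma>) * v + (\<sigma> - 1) * m * l * u) = (1 + \<sigma>) * (m^2 * v) + (\<sigma> - 1) * (m^3 * l * u)"
    by (simp add: power2_eq_square power3_eq_cube algebra_simps)
  moreover have "0 \<le> (1 + \<sigma>) * (m^2 * v)" using uv \<sigma> by simp
  ultimately show "\<bar>m^2 * ((1 + \<sigma>) * v + (\<sigma> - 1) * m * l * u)\<bar> \<le> (2 + l) * m^3 * ch"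
    using b(1)[OF uv(3,4)] lb(2)[OF uv(1,2)] unfolding e by linarith
qed

end

section \<open>Solvability of the two systems and decay of their solutions\<close>

lemma system_AD_ex1:
  assumes "l > 0" "0 < \<sigma>" "\<sigma> < 1" "k \<ge> 1"
  shows "\<exists>!(a, d). system_AD l \<sigma> \<alpha> \<gamma> k a d"
  unfolding system_AD_def Let_def
  by (rule ex1_pair_linear_system, rule less_le_trans[OF det_lower_pos det_AD]) (use assms in auto)

lemma system_BC_ex1:
  assumes "l > 0" "0 < \<sigma>" "\<sigma> < 1" "k \<ge> 1"
  shows "\<exists>!(b, c). system_BC l \<sigma> \<alpha> \<gamma> k b c"
  unfolding system_BC_def Let_def
  by (rule ex1_pair_linear_system, rule less_le_trans[OF det_lower_pos det_BC]) (use assms in auto)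

text \<open>The quotient k^2 / (k^2 - \<alpha>^2) converges to 1, hence is bounded, and
  \<open>K\<close> is the square of a bound. The excluded values of \<alpha> are the zeros of the
  denominators.\<close>

lemma resonance_bound:
  assumes "\<alpha> \<ge> 0" "\<alpha> \<notin> real ` {1..}"
  obtains K where "0 < K" "\<And>k. k \<ge> 1 \<Longrightarrow> ((real k)\<^sup>2 - \<alpha>\<^sup>2)\<^sup>2 > 0 \<and> 1 / ((real k)\<^sup>2 - \<alpha>\<^sup>2)\<^sup>2 \<le> K / real k ^ 4"
proof -
  have ne: "(real k)\<^sup>2 - \<alpha>\<^sup>2 \<noteq> 0" if "k \<ge> 1" for k
  proof
    assume "(real k)\<^sup>2 - \<alpha>\<^sup>2 = 0"
    then have "real k = \<alpha>" using assms(1) by (simp add: power2_eq_iff_nonneg)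
    then show False using assms(2) that by auto
  qed
  have "(\<lambda>k. 1 / (1 - \<alpha>\<^sup>2 * (1 / real k)\<^sup>2)) \<longlonglongrightarrow> 1 / (1 - \<alpha>\<^sup>2 * 0\<^sup>2)"
    by (intro tendsto_intros lim_1_over_n) simp
  moreover have "\<forall>\<^sub>F k in sequentially. 1 / (1 - \<alpha>\<^sup>2 * (1 / real k)\<^sup>2) = (real k)\<^sup>2 / ((real k)\<^sup>2 - \<alpha>\<^sup>2)"
    using eventually_gt_at_top[of 0]
  proof eventually_elim
    case (elim k)
    then have "1 - \<alpha>\<^sup>2 * (1 / real k)\<^sup>2 = ((real k)\<^sup>2 - \<alpha>\<^sup>2) / (real k)\<^sup>2"
      by (simp add: power_divide diff_divide_distrib)
    then show ?case by simp
  qed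
  ultimately have "(\<lambda>k. (real k)\<^sup>2 / ((real k)\<^sup>2 - \<alpha>\<^sup>2)) \<longlonglongrightarrow> 1 / (1 - \<alpha>\<^sup>2 * 0\<^sup>2)"
    by (rule Lim_transform_eventually)
  then have "Bseq (\<lambda>k. (real k)\<^sup>2 / ((real k)\<^sup>2 - \<alpha>\<^sup>2))"
    by (rule convergent_imp_Bseq[OF convergentI])
  then obtain K0 where K0: "0 < K0" "\<forall>k. norm ((real k)\<^sup>2 / ((real k)\<^sup>2 - \<alpha>\<^sup>2)) \<le> K0"
    by (rule BseqE)
  show ?thesis
  proof (rule that[of "K0\<^sup>2"])
    show "0 < K0\<^sup>2" using K0 by simp
    fix k :: nat assume k: "k \<ge> 1"
    have "\<bar>(real k)\<^sup>2 / ((real k)\<^sup>2 - \<alpha>\<^sup>2)\<bar> \<le> \<bar>K0\<bar>"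
      using K0(1) spec[OF K0(2), of k] by (simp only: real_norm_def abs_of_pos)
    then have "((real k)\<^sup>2 / ((real k)\<^sup>2 - \<alpha>\<^sup>2))\<^sup>2 \<le> K0\<^sup>2" by (simp only: abs_le_square_iff)
    then have "real k ^ 4 / ((real k)\<^sup>2 - \<alpha>\<^sup>2)\<^sup>2 \<le> K0\<^sup>2"
      by (simp add: power_divide power4_eq_xxxx power2_eq_square mult.assoc)
    then show "((real k)\<^sup>2 - \<alpha>\<^sup>2)\<^sup>2 > 0 \<and> 1 / ((real k)\<^sup>2 - \<alpha>\<^sup>2)\<^sup>2 \<le> K0\<^sup>2 / real k ^ 4"
      using ne[OF k] k by (simp add: field_simps)
  qed
qed

text \<open>A crude bound suffices: by Bessel's inequality the coefficients are square summable, so that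
  even the factor \<open>1 / k\<close> makes the second derivatives of the modes absolutely summable.\<close>

lemma coefficient_bounds:
  assumes l: "l > 0" and \<sigma>: "0 < \<sigma>" "\<sigma> < 1" and \<alpha>: "\<alpha> \<ge> 0" "\<alpha> \<notin> real ` {1..}"
  obtains K where "0 \<le> K"
    "\<And>k A B C D t. k \<ge> 1 \<Longrightarrow> system_AD l \<sigma> \<alpha> \<gamma> k A D \<Longrightarrow> system_BC l \<sigma> \<alpha> \<gamma> k B C \<Longrightarrow> t \<in> {A, B, C, D} \<Longrightarrow>
      \<bar>t\<bar> * cosh (real k * l) \<le> K * \<bar>\<gamma> k\<bar> / real k ^ 3"
    "\<And>k. k \<ge> 1 \<Longrightarrow> \<bar>\<gamma> k / ((real k)\<^sup>2 - \<alpha>\<^sup>2)\<^sup>2\<bar> \<le> K * \<bar>\<gamma> k\<bar> / real k ^ 3"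
proof -
  obtain K0 where K0: "0 < K0" "\<And>k. k \<ge> 1 \<Longrightarrow> ((real k)\<^sup>2 - \<alpha>\<^sup>2)\<^sup>2 > 0 \<and> 1 / ((real k)\<^sup>2 - \<alpha>\<^sup>2)\<^sup>2 \<le> K0 / real k ^ 4"
    using resonance_bound[OF \<alpha>] by blast
  \<comment> \<open>Collects the factors independent of k: 2 + \<alpha>^2 from the numerators, 1 +
    \<alpha> for the possible prefactor \<alpha>, and the hyperbolic value at the edge.\<close>
  define H where "H = (2 + \<alpha>\<^sup>2) * (1 + \<alpha>) * cosh (\<alpha> * l)"
  have ca: "cosh (\<alpha> * l) \<ge> 1" by (rule cosh_real_ge_1)
  have H0: "0 \<le> H" unfolding H_def using \<alpha> ca by (intro mult_nonneg_nonneg) auto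
  have rhs: "\<bar>\<gamma> k * ((\<sigma> * (real k)\<^sup>2 - \<alpha>\<^sup>2) / ((real k)\<^sup>2 - \<alpha>\<^sup>2)\<^sup>2) * w\<bar> \<le> H * K0 * \<bar>\<gamma> k\<bar> / (real k)\<^sup>2"
    "\<bar>\<alpha> * \<gamma> k * (((2 - \<sigma>) * (real k)\<^sup>2 - \<alpha>\<^sup>2) / ((real k)\<^sup>2 - \<alpha>\<^sup>2)\<^sup>2) * w\<bar> \<le> H * K0 * \<bar>\<gamma> k\<bar> / (real k)\<^sup>2"
    if k: "k \<ge> 1" and w: "\<bar>w\<bar> \<le> cosh (\<alpha> * l)" for k w
  proof -
    let ?m = "real k"
    have m: "1 \<le> ?m\<^sup>2" "0 < ?m" using k by (simp_all add: power2_eq_square mult_ge1_I)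
    have q: "0 \<le> 1 / (?m\<^sup>2 - \<alpha>\<^sup>2)\<^sup>2" "1 / (?m\<^sup>2 - \<alpha>\<^sup>2)\<^sup>2 \<le> K0 / ?m ^ 4" using K0(2)[OF k] by auto
    have am: "\<alpha>\<^sup>2 \<le> \<alpha>\<^sup>2 * ?m\<^sup>2" using mult_left_mono[OF m(1), of "\<alpha>\<^sup>2"] by simp
    have sm: "0 \<le> \<sigma> * ?m\<^sup>2" "\<sigma> * ?m\<^sup>2 \<le> 1 * ?m\<^sup>2" using \<sigma> by (simp, intro mult_right_mono) auto
    have n1: "\<bar>\<sigma> * ?m\<^sup>2 - \<alpha>\<^sup>2\<bar> \<le> (2 + \<alpha>\<^sup>2) * ?m\<^sup>2" "\<bar>(2 - \<sigma>) * ?m\<^sup>2 - \<alpha>\<^sup>2\<bar> \<le> (2 + \<alpha>\<^sup>2) * ?m\<^sup>2"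
      unfolding left_diff_distrib distrib_right abs_le_iff using am sm m(1) zero_le_power2[of \<alpha>] by linarith+
    have gen: "\<bar>a * \<gamma> k * (N / (?m\<^sup>2 - \<alpha>\<^sup>2)\<^sup>2) * w\<bar> \<le> H * K0 * \<bar>\<gamma> k\<bar> / ?m\<^sup>2"
      if a: "\<bar>a\<bar> \<le> 1 + \<alpha>" and N: "\<bar>N\<bar> \<le> (2 + \<alpha>\<^sup>2) * ?m\<^sup>2" for a N
    proof -
      have "\<bar>a * \<gamma> k * (N / (?m\<^sup>2 - \<alpha>\<^sup>2)\<^sup>2) * w\<bar> = (\<bar>a\<bar> * (\<bar>N\<bar> * (1 / (?m\<^sup>2 - \<alpha>\<^sup>2)\<^sup>2)) * \<bar>w\<bar>) * \<bar>\<gamma> k\<bar>"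
        by (simp add: abs_mult)
      also have "\<dots> \<le> ((1 + \<alpha>) * (((2 + \<alpha>\<^sup>2) * ?m\<^sup>2) * (K0 / ?m ^ 4)) * cosh (\<alpha> * l)) * \<bar>\<gamma> k\<bar>"
        using a N q w \<alpha> K0(1) by (intro mult_right_mono mult_mono) auto
      also have "\<dots> = H * K0 * \<bar>\<gamma> k\<bar> / ?m\<^sup>2"
        using m by (simp add: H_def field_simps power2_eq_square power4_eq_xxxx)
      finally show ?thesis .
    qed
    show "\<bar>\<gamma> k * ((\<sigma> * ?m\<^sup>2 - \<alpha>\<^sup>2) / (?m\<^sup>2 - \<alpha>\<^sup>2)\<^sup>2) * w\<bar> \<le> H * K0 * \<bar>\<gamma> k\<bar> / ?m\<^sup>2"
      using gen[of 1, OF _ n1(1)] \<alpha> by simp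
    show "\<bar>\<alpha> * \<gamma> k * (((2 - \<sigma>) * ?m\<^sup>2 - \<alpha>\<^sup>2) / (?m\<^sup>2 - \<alpha>\<^sup>2)\<^sup>2) * w\<bar> \<le> H * K0 * \<bar>\<gamma> k\<bar> / ?m\<^sup>2"
      using gen[of \<alpha>, OF _ n1(2)] \<alpha> by simp
  qed
  \<comment> \<open>Makes cosh (k l) at most \<kappa> sinh (k l) for all k \<ge> 1: the difference
    cosh - sinh is exp (- k l) \<le> 1, and sinh (k l) is at least sinh l.\<close>
  define \<kappa> where "\<kappa> = 1 + 1 / sinh l"
  have \<kappa>: "\<kappa> \<ge> 0" using l by (simp add: \<kappa>_def)
  have ck: "cosh (real k * l) \<le> \<kappa> * sinh (real k * l)" if k: "k \<ge> 1" for k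
  proof -
    have "l \<le> real k * l" using k l by simp
    then have "sinh l \<le> sinh (real k * l)" by simp
    then have "1 \<le> sinh (real k * l) / sinh l" using l by simp
    moreover have "cosh (real k * l) - sinh (real k * l) \<le> 1"
      using k l by (simp add: cosh_minus_sinh)
    ultimately show ?thesis by (simp add: \<kappa>_def distrib_right)
  qed
  \<comment> \<open>The first summand serves for the particular part, the second comes from Cramer's
    rule.\<close>
  define K where "K = K0 + H * K0 * (2 + l) * \<kappa> / (1 - \<sigma>)"
  have K1: "0 \<le> H * K0 * (2 + l) * \<kappa> / (1 - \<sigma>)" using H0 K0 l \<kappa> \<sigma> by simp
  show ?thesis
  proof (rule that[of K])
    show "0 \<le> K" using K1 K0 by (simp add: K_def)
    fix k :: nat assume k: "k \<ge> 1"
    let ?m = "real k" let ?c = "cosh (real k * l)" let ?s = "sinh (real k * l)"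
    have m: "1 \<le> ?m" "0 < ?m" using k by simp_all
    note cs = cosh_sinh_facts[OF mult_pos_pos[OF m(2) l]]
    show "\<bar>\<gamma> k / (?m\<^sup>2 - \<alpha>\<^sup>2)\<^sup>2\<bar> \<le> K * \<bar>\<gamma> k\<bar> / ?m ^ 3"
    proof -
      have "\<bar>\<gamma> k / (?m\<^sup>2 - \<alpha>\<^sup>2)\<^sup>2\<bar> = 1 / (?m\<^sup>2 - \<alpha>\<^sup>2)\<^sup>2 * \<bar>\<gamma> k\<bar>" by simp
      also have "\<dots> \<le> (K0 / ?m ^ 4) * \<bar>\<gamma> k\<bar>" using K0(2)[OF k] by (intro mult_right_mono) auto
      also have "\<dots> \<le> (K / ?m ^ 3) * \<bar>\<gamma> k\<bar>"
      proof (intro mult_right_mono frac_le)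
        show "?m ^ 3 \<le> ?m ^ 4" using m by (intro power_increasing) auto
      qed (use K0 K1 m in \<open>auto simp: K_def\<close>)
      finally show ?thesis by simp
    qed
    fix A B C D t assume AD: "system_AD l \<sigma> \<alpha> \<gamma> k A D" and BC: "system_BC l \<sigma> \<alpha> \<gamma> k B C" and t: "t \<in> {A, B, C, D}"
    note AD' = AD[unfolded system_AD_def Let_def] and BC' = BC[unfolded system_BC_def Let_def]
    \<comment> \<open>The bound of \<open>linear_system_2x2_bound\<close>: right sides of order
      k^(-2), entries of order k^3 cosh (k l), determinant at least of order k^4 cosh (k l) sinh (k
      l).\<close>
    define X where "X = 2 * (H * K0 * \<bar>\<gamma> k\<bar> / ?m\<^sup>2) * ((2 + l) * ?m^3 * ?c) / ((1 - \<sigma>) * ?m^4 * (2 * (?c * ?s)))"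
    have w: "\<bar>cosh (\<alpha> * l)\<bar> \<le> cosh (\<alpha> * l)" "\<bar>sinh (\<alpha> * l)\<bar> \<le> cosh (\<alpha> * l)"
      using ca by (simp_all add: abs_le_iff sinh_def cosh_def)
    note e = matrix_entry_bounds[OF l \<sigma> m(1)]
    have "\<bar>A\<bar> \<le> X" "\<bar>D\<bar> \<le> X"
      unfolding X_def using cs
      by (intro linear_system_2x2_bound[OF AD'[THEN conjunct1] AD'[THEN conjunct2] det_AD[OF l \<sigma> m(1)] det_lower_pos[OF l \<sigma> m(1)]]
          e rhs k w; simp)+
    moreover have "\<bar>B\<bar> \<le> X" "\<bar>C\<bar> \<le> X"
      unfolding X_def using cs
      by (intro linear_system_2x2_bound[OF BC'[THEN conjunct1] BC'[THEN conjunct2] det_BC[OF l \<sigma> m(1)] det_lower_pos[OF l \<sigma> m(1)]]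
          e rhs k w; simp)+
    ultimately have "\<bar>t\<bar> \<le> X" using t by auto
    moreover have "X * ?c \<le> K * \<bar>\<gamma> k\<bar> / ?m ^ 3"
    proof -
      have "X = H * K0 * (2 + l) / (1 - \<sigma>) * \<bar>\<gamma> k\<bar> / ?m ^ 3 * (1 / ?s)"
      proof -
        have X: "2 * (P / M\<^sup>2) * (L * M ^ 3 * c) / (q * M ^ 4 * (2 * (c * s))) = L * P / q / M ^ 3 * (1 / s)"
          if "q \<noteq> 0" "M \<noteq> 0" "c \<noteq> 0" "s \<noteq> 0" for P M L c s q :: real
          using that by (simp add: divide_simps power2_eq_square power3_eq_cube power4_eq_xxxx)
        have "1 - \<sigma> \<noteq> 0" "?m \<noteq> 0" "?c \<noteq> 0" "?s \<noteq> 0" using cs m \<sigma> by auto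
        from X[OF this, of "H * K0 * \<bar>\<gamma> k\<bar>" "2 + l"] show ?thesis unfolding X_def by (simp add: mult_ac)
      qed
      then have "X * ?c = H * K0 * (2 + l) / (1 - \<sigma>) * \<bar>\<gamma> k\<bar> / ?m ^ 3 * (?c / ?s)" by simp
      also have "\<dots> \<le> H * K0 * (2 + l) / (1 - \<sigma>) * \<bar>\<gamma> k\<bar> / ?m ^ 3 * \<kappa>"
        using ck[OF k] cs H0 K0 l \<sigma> m by (intro mult_left_mono) (auto simp: divide_le_eq)
      also have "\<dots> = (H * K0 * (2 + l) * \<kappa> / (1 - \<sigma>)) * \<bar>\<gamma> k\<bar> / ?m ^ 3" by simp
      also have "\<dots> \<le> K * \<bar>\<gamma> k\<bar> / ?m ^ 3"
        using K0 m by (intro divide_right_mono mult_right_mono) (auto simp: K_def)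
      finally show ?thesis .
    qed
    ultimately show "\<bar>t\<bar> * ?c \<le> K * \<bar>\<gamma> k\<bar> / ?m ^ 3"
      using cs by (meson mult_right_mono order_trans less_imp_le)
  qed
qed

subsection \<open>The series solution\<close>

lemma profile_bound:
  assumes l: "l > 0" and \<alpha>: "\<alpha> \<ge> 0" and m: "m > 0" and y: "y \<in> {-l..l}"
  shows "\<bar>profile \<alpha> m G A B C D y\<bar> \<le>
    \<bar>G\<bar> * exp (\<alpha> * l) + \<bar>A\<bar> * cosh (m * l) + \<bar>B\<bar> * cosh (m * l) + l * (\<bar>C\<bar> * cosh (m * l)) + l * (\<bar>D\<bar> * cosh (m * l))"
proof -
  have yl: "\<bar>y\<bar> \<le> l" using y by auto
  have c: "\<bar>cosh (m * y)\<bar> \<le> cosh (m * l)"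
  proof -
    have "cosh (m * y) = cosh (m * \<bar>y\<bar>)" by (cases "y \<ge> 0") auto
    also have "\<dots> \<le> cosh (m * l)" using yl m l by (subst cosh_real_nonneg_le_iff) auto
    finally show ?thesis by simp
  qed
  have "\<bar>sinh (m * y)\<bar> \<le> cosh (m * y)" by (simp add: abs_le_iff sinh_def cosh_def)
  then have s: "\<bar>sinh (m * y)\<bar> \<le> cosh (m * l)" using c by linarith
  have e: "\<bar>exp (\<alpha> * y)\<bar> \<le> exp (\<alpha> * l)" using \<alpha> y by (simp add: mult_left_mono)
  have yc: "\<bar>y\<bar> * \<bar>cosh (m * y)\<bar> \<le> l * cosh (m * l)" and ys: "\<bar>y\<bar> * \<bar>sinh (m * y)\<bar> \<le> l * cosh (m * l)"
    using c s yl l by (intro mult_mono; simp)+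
  have "\<bar>C * (y * cosh (m * y))\<bar> \<le> l * (\<bar>C\<bar> * cosh (m * l))" "\<bar>D * (y * sinh (m * y))\<bar> \<le> l * (\<bar>D\<bar> * cosh (m * l))"
    using mult_left_mono[OF yc, of "\<bar>C\<bar>"] mult_left_mono[OF ys, of "\<bar>D\<bar>"]
    by (simp_all only: abs_mult abs_ge_zero mult.left_commute[of l])
  moreover have "\<bar>G * exp (\<alpha> * y)\<bar> \<le> \<bar>G\<bar> * exp (\<alpha> * l)" "\<bar>A * cosh (m * y)\<bar> \<le> \<bar>A\<bar> * cosh (m * l)"
    "\<bar>B * sinh (m * y)\<bar> \<le> \<bar>B\<bar> * cosh (m * l)"
    unfolding abs_mult using c s e by (intro mult_left_mono; simp)+
  moreover have tri: "\<bar>t1 + t2 + t3 + t4 + t5\<bar> \<le> \<bar>t1\<bar> + \<bar>t2\<bar> + \<bar>t3\<bar> + \<bar>t4\<bar> + \<bar>t5\<bar>" for t1 t2 t3 t4 t5 :: real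
    by linarith
  ultimately show ?thesis
    unfolding profile_def by (blast intro: order_trans[OF tri] add_mono)
qed

text \<open>Differentiating a profile up to twice costs at most a factor m^2 in its coefficients,
  which turns the decay of order m^(-3) into a majorant of order \<bar>\<gamma>\<bar> / m.\<close>

lemma profile_mode_series:
  assumes l: "l > 0" and \<sigma>: "0 < \<sigma>" "\<sigma> < 1" and \<alpha>: "\<alpha> \<ge> 0" "\<alpha> \<notin> real ` {1..}"
    and \<gamma>: "summable (\<lambda>n. (\<gamma> (Suc n))\<^sup>2)"
    and AD: "\<And>n. system_AD l \<sigma> \<alpha> \<gamma> (Suc n) (A n) (D n)"
    and BC: "\<And>n. system_BC l \<sigma> \<alpha> \<gamma> (Suc n) (B n) (C n)"
  obtains Mb where "mode_series l
    (\<lambda>n. profile \<alpha> (real (Suc n)) (\<gamma> (Suc n) / ((real (Suc n))\<^sup>2 - \<alpha>\<^sup>2)\<^sup>2) (A n) (B n) (C n) (D n)) Mb"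
proof -
  obtain K where K: "0 \<le> K"
    "\<And>k A B C D t. k \<ge> 1 \<Longrightarrow> system_AD l \<sigma> \<alpha> \<gamma> k A D \<Longrightarrow> system_BC l \<sigma> \<alpha> \<gamma> k B C \<Longrightarrow> t \<in> {A, B, C, D} \<Longrightarrow>
      \<bar>t\<bar> * cosh (real k * l) \<le> K * \<bar>\<gamma> k\<bar> / real k ^ 3"
    "\<And>k. k \<ge> 1 \<Longrightarrow> \<bar>\<gamma> k / ((real k)\<^sup>2 - \<alpha>\<^sup>2)\<^sup>2\<bar> \<le> K * \<bar>\<gamma> k\<bar> / real k ^ 3"
    using coefficient_bounds[OF l \<sigma> \<alpha>] by metis
  \<comment> \<open>The exponential term contributes the first summand; 6 is 3 + 3 for the
    coefficients of cosh and sinh, since one or two differentiations give at most (m + 1) q or (m^2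
    + 2 m) q there; 2 l covers the two terms with the factor y.\<close>
  define L where "L = (1 + \<alpha> + \<alpha>\<^sup>2) * exp (\<alpha> * l) + 6 + 2 * l"
  define Mb where "Mb = (\<lambda>n. L * K * (\<bar>\<gamma> (Suc n)\<bar> * (1 / real (Suc n))))"
  have L: "0 \<le> L" using \<alpha> l by (simp add: L_def)
  have bounds: "m\<^sup>2 * \<bar>profile \<alpha> m G a b c d y\<bar> \<le> m\<^sup>2 * (L * q)"
    "m * \<bar>deriv (profile \<alpha> m G a b c d) y\<bar> \<le> m\<^sup>2 * (L * q)"
    "\<bar>deriv (deriv (profile \<alpha> m G a b c d)) y\<bar> \<le> m\<^sup>2 * (L * q)"
    if m: "m \<ge> 1" and y: "y \<in> {-l..l}" and G: "\<bar>G\<bar> \<le> q"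
      and abcd: "\<And>t. t \<in> {a, b, c, d} \<Longrightarrow> \<bar>t\<bar> * cosh (m * l) \<le> q"
    for m G a b c d y q
  proof -
    have q: "0 \<le> q" using G by linarith
    have m0: "m > 0" "1 \<le> m\<^sup>2" "m \<le> m\<^sup>2" using m by (auto simp: power2_eq_square mult_ge1_I)
    define E where "E = exp (\<alpha> * l)"
    have E: "E \<ge> 0" by (simp add: E_def)
    \<comment> \<open>One estimate for all three orders of differentiation: \<open>M\<close> is 1, m
      or m^2, and \<open>w\<close> is the corresponding power of \<alpha>.\<close>
    have main: "\<bar>profile \<alpha> m G' a' b' c' d' y\<bar> \<le> M * (L * q)"
      if "\<bar>G'\<bar> \<le> w * q" "\<bar>a'\<bar> * cosh (m * l) \<le> M * (3 * q)" "\<bar>b'\<bar> * cosh (m * l) \<le> M * (3 * q)"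
        "\<bar>c'\<bar> * cosh (m * l) \<le> M * q" "\<bar>d'\<bar> * cosh (m * l) \<le> M * q" "1 \<le> M" "w \<le> 1 + \<alpha> + \<alpha>\<^sup>2"
      for G' a' b' c' d' M w
    proof -
      have "\<bar>G'\<bar> \<le> (1 + \<alpha> + \<alpha>\<^sup>2) * q" using that(1) mult_right_mono[OF that(7) q] by linarith
      also have "\<dots> \<le> M * ((1 + \<alpha> + \<alpha>\<^sup>2) * q)" using mult_right_mono[OF that(6), of "(1 + \<alpha> + \<alpha>\<^sup>2) * q"] q \<alpha> by simp
      finally have "\<bar>G'\<bar> * E \<le> M * ((1 + \<alpha> + \<alpha>\<^sup>2) * q) * E" using E by (rule mult_right_mono)
      moreover have "l * (\<bar>c'\<bar> * cosh (m * l)) \<le> l * (M * q)" "l * (\<bar>d'\<bar> * cosh (m * l)) \<le> l * (M * q)"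
        using that l by (auto intro: mult_left_mono)
      moreover have "M * (L * q) = M * ((1 + \<alpha> + \<alpha>\<^sup>2) * q) * E + M * (3 * q) + M * (3 * q) + l * (M * q) + l * (M * q)"
        by (simp add: L_def E_def algebra_simps)
      ultimately show ?thesis
        using profile_bound[OF l \<alpha>(1) m0(1) y, of G' a' b' c' d'] that(2,3) unfolding E_def by linarith
    qed
    have comb: "\<bar>s * t + r * u\<bar> * cosh (m * l) \<le> (\<bar>s\<bar> + \<bar>r\<bar>) * q"
      if "t \<in> {a, b, c, d}" "u \<in> {a, b, c, d}" for s t r u
    proof -
      have "\<bar>s * t + r * u\<bar> * cosh (m * l) \<le> (\<bar>s\<bar> * \<bar>t\<bar> + \<bar>r\<bar> * \<bar>u\<bar>) * cosh (m * l)"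
        by (intro mult_right_mono) (auto simp: abs_mult[symmetric])
      also have "\<dots> = \<bar>s\<bar> * (\<bar>t\<bar> * cosh (m * l)) + \<bar>r\<bar> * (\<bar>u\<bar> * cosh (m * l))" by (simp add: algebra_simps)
      also have "\<dots> \<le> \<bar>s\<bar> * q + \<bar>r\<bar> * q" using abcd that by (intro add_mono mult_left_mono) auto
      finally show ?thesis by (simp add: distrib_right)
    qed
    have le: "x * q \<le> M * (3 * q)" "x' * q \<le> M * q" if "x \<le> 3 * M" "x' \<le> M" for x x' M :: real
      using mult_right_mono[OF that(1) q] mult_right_mono[OF that(2) q] by (simp_all add: mult_ac)
    have "\<bar>profile \<alpha> m G a b c d y\<bar> \<le> 1 * (L * q)"
      using G abcd q \<alpha> by (intro main[where w = 1]) (auto intro: order_trans[of _ q])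
    then show "m\<^sup>2 * \<bar>profile \<alpha> m G a b c d y\<bar> \<le> m\<^sup>2 * (L * q)" by (intro mult_left_mono) auto
    have "\<bar>deriv (profile \<alpha> m G a b c d) y\<bar> \<le> m * (L * q)"
      unfolding deriv_profile
    proof (rule main[where w = \<alpha>])
      show "\<bar>\<alpha> * G\<bar> \<le> \<alpha> * q" using G \<alpha> by (simp add: abs_mult mult_left_mono)
      show "\<bar>m * b + c\<bar> * cosh (m * l) \<le> m * (3 * q)" "\<bar>m * a + d\<bar> * cosh (m * l) \<le> m * (3 * q)"
        using comb[of b c m 1] comb[of a d m 1] le(1)[of "m + 1" m 0] m by auto
      show "\<bar>m * d\<bar> * cosh (m * l) \<le> m * q" "\<bar>m * c\<bar> * cosh (m * l) \<le> m * q"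
        using comb[of d d m 0] comb[of c c m 0] m by auto
    qed (use m \<alpha> in auto)
    then have "m * \<bar>deriv (profile \<alpha> m G a b c d) y\<bar> \<le> m * (m * (L * q))" using m0 by (intro mult_left_mono) auto
    then show "m * \<bar>deriv (profile \<alpha> m G a b c d) y\<bar> \<le> m\<^sup>2 * (L * q)" by (simp add: power2_eq_square mult.assoc)
    show "\<bar>deriv (deriv (profile \<alpha> m G a b c d)) y\<bar> \<le> m\<^sup>2 * (L * q)"
      unfolding deriv_profile
    proof (rule main[where w = "\<alpha>\<^sup>2"])
      show "\<bar>\<alpha> * (\<alpha> * G)\<bar> \<le> \<alpha>\<^sup>2 * q"
        using G \<alpha> by (simp add: abs_mult power2_eq_square mult.assoc mult_left_mono)
      have e: "m * (m * a + d) + m * d = m\<^sup>2 * a + 2 * m * d" "m * (m * b + c) + m * c = m\<^sup>2 * b + 2 * m * c"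
        "m * (m * c) = m\<^sup>2 * c + 0 * c" "m * (m * d) = m\<^sup>2 * d + 0 * d"
        by (simp_all add: power2_eq_square algebra_simps)
      show "\<bar>m * (m * a + d) + m * d\<bar> * cosh (m * l) \<le> m\<^sup>2 * (3 * q)"
        "\<bar>m * (m * b + c) + m * c\<bar> * cosh (m * l) \<le> m\<^sup>2 * (3 * q)"
        unfolding e using comb[of a d "m\<^sup>2" "2 * m"] comb[of b c "m\<^sup>2" "2 * m"] le(1)[of "m\<^sup>2 + 2 * m" "m\<^sup>2" 0] m0 by auto
      show "\<bar>m * (m * c)\<bar> * cosh (m * l) \<le> m\<^sup>2 * q" "\<bar>m * (m * d)\<bar> * cosh (m * l) \<le> m\<^sup>2 * q"
        unfolding e using comb[of c c "m\<^sup>2" 0] comb[of d d "m\<^sup>2" 0] by auto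
    qed (use m0 \<alpha> in auto)
  qed
  have Mb_eq: "(real (Suc n))\<^sup>2 * (L * (K * \<bar>\<gamma> (Suc n)\<bar> / real (Suc n) ^ 3)) = Mb n" for n
    unfolding Mb_def by (simp add: power2_eq_square power3_eq_cube del: of_nat_Suc)
  have ser: "mode_series l (\<lambda>n. profile \<alpha> (real (Suc n)) (\<gamma> (Suc n) / ((real (Suc n))\<^sup>2 - \<alpha>\<^sup>2)\<^sup>2) (A n) (B n) (C n) (D n)) Mb"
  proof
    \<comment> \<open>Twice the product is at most the sum of the squares; one square is summable by
      hypothesis, the other is 1/n^2.\<close>
    have "summable (\<lambda>n. \<bar>\<gamma> (Suc n)\<bar> * (1 / real (Suc n)))"
    proof (rule summable_comparison_test')
      show "summable (\<lambda>n. (\<gamma> (Suc n))\<^sup>2 + (1 / real (Suc n))\<^sup>2)"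
      proof (rule summable_add[OF \<gamma>])
        have "summable (\<lambda>n. inverse ((real (Suc n))\<^sup>2))"
          by (rule summable_Suc_iff[of "\<lambda>n. inverse ((real n)\<^sup>2)", THEN iffD2]) (rule inverse_power_summable, simp)
        then show "summable (\<lambda>n. (1 / real (Suc n))\<^sup>2)"
          by (simp only: power_one_over inverse_eq_divide)
      qed
      fix n
      have "0 \<le> (\<bar>\<gamma> (Suc n)\<bar> - 1 / real (Suc n))\<^sup>2" by simp
      then have "2 * (\<bar>\<gamma> (Suc n)\<bar> * (1 / real (Suc n))) \<le> (\<gamma> (Suc n))\<^sup>2 + (1 / real (Suc n))\<^sup>2"
        unfolding power2_diff by simp
      moreover have "0 \<le> \<bar>\<gamma> (Suc n)\<bar> * (1 / real (Suc n))" by simp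
      ultimately show "norm (\<bar>\<gamma> (Suc n)\<bar> * (1 / real (Suc n))) \<le> (\<gamma> (Suc n))\<^sup>2 + (1 / real (Suc n))\<^sup>2"
        unfolding real_norm_def by linarith
    qed
    then show "summable Mb" unfolding Mb_def by (rule summable_mult)
    fix n y assume y: "y \<in> {-l..l}"
    have k: "Suc n \<ge> 1" "real (Suc n) \<ge> 1" by simp_all
    note b = bounds[OF k(2) y K(3)[OF k(1)] K(2)[OF k(1) AD BC], unfolded Mb_eq]
    show "(real (Suc n))\<^sup>2 * \<bar>profile \<alpha> (real (Suc n)) (\<gamma> (Suc n) / ((real (Suc n))\<^sup>2 - \<alpha>\<^sup>2)\<^sup>2) (A n) (B n) (C n) (D n) y\<bar> \<le> Mb n"
      "real (Suc n) * \<bar>deriv (profile \<alpha> (real (Suc n)) (\<gamma> (Suc n) / ((real (Suc n))\<^sup>2 - \<alpha>\<^sup>2)\<^sup>2) (A n) (B n) (C n) (D n)) y\<bar> \<le> Mb n"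
      "\<bar>deriv (deriv (profile \<alpha> (real (Suc n)) (\<gamma> (Suc n) / ((real (Suc n))\<^sup>2 - \<alpha>\<^sup>2)\<^sup>2) (A n) (B n) (C n) (D n))) y\<bar> \<le> Mb n"
      by (rule b; assumption)+
  qed (use l smooth_profile in auto)
  then show ?thesis by (rule that)
qed

lemma H2_star_inner_commute: "H2_star_inner l \<sigma> u v = H2_star_inner l \<sigma> v u"
  unfolding H2_star_inner_def Let_def
  by (rule Bochner_Integration.integral_cong) (auto simp: algebra_simps)

text \<open>For half-integer exponents no resonance occurs, and the load $\sin (i x) e^{\beta y}$ has an
  explicit solution. These solutions replace coercivity in the proof of uniqueness.\<close>

lemma single_mode_solution:
  assumes l: "l > 0" and \<sigma>: "0 < \<sigma>" "\<sigma> < 1" and i: "i \<ge> 1"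
  obtains w where "w \<in> H2_star l"
    "\<forall>v\<in>H2_star l. H2_star_inner l \<sigma> w v =
      (LINT z|on_plate l. v z * (sin (real i * fst z) * exp ((real k + 1 / 2) * snd z)))"
proof -
  define \<beta> where "\<beta> = real k + 1 / 2"
  define G where "G = 1 / ((real i)\<^sup>2 - \<beta>\<^sup>2)\<^sup>2"
  obtain A D where AD: "system_AD l \<sigma> \<beta> (\<lambda>_. 1) i A D"
    using system_AD_ex1[OF l \<sigma> i, of \<beta> "\<lambda>_. 1"] by blast
  obtain B C where BC: "system_BC l \<sigma> \<beta> (\<lambda>_. 1) i B C"
    using system_BC_ex1[OF l \<sigma> i, of \<beta> "\<lambda>_. 1"] by blast
  define q where "q = profile \<beta> (real i) G A B C D"
  \<comment> \<open>A finite sum presented as a mode series: index i - 1 carries frequency i,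
    because modes are numbered from 0.\<close>
  define p where "p = (\<lambda>n. if n = i - 1 then q else (\<lambda>_. 0))"
  have si: "Suc (i - Suc 0) = i" using i by simp
  have q_smooth: "smooth q" unfolding q_def by (rule smooth_profile)
  have bnd: "\<exists>b\<ge>0. \<forall>y\<in>{-l..l}. \<bar>f y\<bar> \<le> b" if "smooth f" for f
    using continuous_bounded_Icc[OF smooth_continuous_on[OF that]] by metis
  obtain b0 where b0: "b0 \<ge> 0" "\<And>y. y \<in> {-l..l} \<Longrightarrow> \<bar>q y\<bar> \<le> b0" using bnd[OF q_smooth] by auto
  obtain b1 where b1: "b1 \<ge> 0" "\<And>y. y \<in> {-l..l} \<Longrightarrow> \<bar>deriv q y\<bar> \<le> b1" using bnd[OF smooth_deriv[OF q_smooth]] by auto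
  obtain b2 where b2: "b2 \<ge> 0" "\<And>y. y \<in> {-l..l} \<Longrightarrow> \<bar>deriv (deriv q) y\<bar> \<le> b2"
    using bnd[OF smooth_deriv[OF smooth_deriv[OF q_smooth]]] by auto
  define Mb where "Mb = (\<lambda>n. if n = i - 1 then (real i)\<^sup>2 * b0 + real i * b1 + b2 else 0)"
  interpret mode_series l p Mb
  proof
    show "smooth (p n)" for n using q_smooth by (simp add: p_def)
    show "summable Mb" unfolding Mb_def by (rule summable_single)
    fix n y assume y: "y \<in> {-l..l}"
    have "(real i)\<^sup>2 * \<bar>q y\<bar> \<le> (real i)\<^sup>2 * b0" "real i * \<bar>deriv q y\<bar> \<le> real i * b1"
      using b0(2)[OF y] b1(2)[OF y] by (auto intro: mult_left_mono)
    moreover have "0 \<le> (real i)\<^sup>2 * b0" "0 \<le> real i * b1" using b0 b1 by auto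
    ultimately have *: "(real i)\<^sup>2 * \<bar>q y\<bar> \<le> (real i)\<^sup>2 * b0 + real i * b1 + b2"
      "real i * \<bar>deriv q y\<bar> \<le> (real i)\<^sup>2 * b0 + real i * b1 + b2"
      "\<bar>deriv (deriv q) y\<bar> \<le> (real i)\<^sup>2 * b0 + real i * b1 + b2"
      using b2(1) b2(2)[OF y] by linarith+
    show "(real (Suc n))\<^sup>2 * \<bar>p n y\<bar> \<le> Mb n" "real (Suc n) * \<bar>deriv (p n) y\<bar> \<le> Mb n" "\<bar>deriv (deriv (p n)) y\<bar> \<le> Mb n"
      using * by (auto simp: p_def Mb_def si simp del: of_nat_Suc)
  qed fact
  \<comment> \<open>Parity excludes resonance: 2 i is even, while twice the exponent is 2 k +
    1.\<close>
  have ne: "((real i)\<^sup>2 - \<beta>\<^sup>2)\<^sup>2 \<noteq> 0"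
  proof
    assume "((real i)\<^sup>2 - \<beta>\<^sup>2)\<^sup>2 = 0"
    then have "real i = \<beta>" by (simp add: \<beta>_def power2_eq_iff_nonneg)
    then have "real (2 * i) = real (2 * k + 1)" by (simp add: \<beta>_def)
    then have "2 * i = 2 * k + 1" by (simp only: of_nat_eq_iff)
    then show False by presburger
  qed
  note bc = profile_boundary_conditions[OF AD BC, folded G_def q_def]
  have eq: "deriv (deriv (deriv (deriv q))) y - 2 * (real i)\<^sup>2 * deriv (deriv q) y + real i ^ 4 * q y = exp (\<beta> * y)" for y
    unfolding q_def profile_equation using ne by (simp add: G_def)
  show ?thesis
  proof (rule that[OF total_H2_star], rule ballI)
    fix v assume v: "v \<in> H2_star l"
    let ?F = "\<lambda>n y. if n = i - 1 then exp (\<beta> * y) else 0"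
    have "(\<lambda>n. LINT z|on_plate l. v z * (sin (real (Suc n) * fst z) * ?F n (snd z))) sums H2_star_inner l \<sigma> (total 0 0) v"
    proof (rule inner_total_sums[OF v])
      fix n y
      show "y = l \<or> y = -l \<Longrightarrow> deriv (deriv (p n)) y = \<sigma> * (real (Suc n))\<^sup>2 * p n y"
        using bc(1)[of y] by (auto simp: p_def si simp del: of_nat_Suc)
      show "y = l \<or> y = -l \<Longrightarrow> deriv (deriv (deriv (p n))) y = (2 - \<sigma>) * (real (Suc n))\<^sup>2 * deriv (p n) y"
        using bc(2)[of y] by (auto simp: p_def si simp del: of_nat_Suc)
      show "deriv (deriv (deriv (deriv (p n)))) y - 2 * (real (Suc n))\<^sup>2 * deriv (deriv (p n)) y
          + (real (Suc n)) ^ 4 * p n y = ?F n y"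
        using eq[of y] by (auto simp: p_def si simp del: of_nat_Suc)
    qed
    moreover have "(LINT z|on_plate l. v z * (sin (real (Suc n) * fst z) * ?F n (snd z))) =
        (if n = i - 1 then LINT z|on_plate l. v z * (sin (real i * fst z) * exp (\<beta> * snd z)) else 0)" for n
      by (auto simp: si simp del: of_nat_Suc)
    moreover have "(\<lambda>n. if n = i - 1 then LINT z|on_plate l. v z * (sin (real i * fst z) * exp (\<beta> * snd z)) else 0)
        sums (LINT z|on_plate l. v z * (sin (real i * fst z) * exp (\<beta> * snd z)))"
      by (rule sums_single)
    ultimately show "H2_star_inner l \<sigma> (total 0 0) v =
        (LINT z|on_plate l. v z * (sin (real i * fst z) * exp ((real k + 1 / 2) * snd z)))"
      unfolding \<beta>_def[symmetric] by (simp only: sums_unique2)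
  qed
qed

section \<open>Uniqueness of the weak solution\<close>

lemma plate_solution_unique:
  assumes l: "l > 0" and \<sigma>: "0 < \<sigma>" "\<sigma> < 1"
    and u: "plate_solution l \<sigma> f u" and v: "plate_solution l \<sigma> f v" and z: "z \<in> closure (plate l)"
  shows "v z = u z"
proof -
  have uv: "u \<in> H2_star l" "v \<in> H2_star l" using u v by (auto simp: plate_solution_def)
  note c = H2_star_D(2)[OF uv(1)] H2_star_D(2)[OF uv(2)]
  \<comment> \<open>The factor e^(y/2) converts the half-integer exponents of the solvable loads
    into the integer exponents of \<open>sine_exp_orthogonal\<close>, and it has no zeros.\<close>
  define H where "H = (\<lambda>z. (v z - u z) * exp (1 / 2 * snd z))"
  have Hc: "continuous_on (closure (plate l)) H"
    unfolding H_def by (intro continuous_intros c)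
  have "sine_exp_orthogonal l H n" for n
    unfolding sine_exp_orthogonal_def
  proof (intro conjI allI ballI continuous_integrable_plate[OF l Hc])
    fix k i assume "i \<in> {1..n}"
    then have i: "i \<ge> 1" by simp
    obtain w where w: "w \<in> H2_star l"
      "\<forall>v\<in>H2_star l. H2_star_inner l \<sigma> w v =
        (LINT z|on_plate l. v z * (sin (real i * fst z) * exp ((real k + 1 / 2) * snd z)))"
      by (rule single_mode_solution[OF l \<sigma> i])
    have "H2_star_inner l \<sigma> v w = H2_star_inner l \<sigma> u w"
      using u v w(1) by (simp add: plate_solution_def)
    then have "H2_star_inner l \<sigma> w v = H2_star_inner l \<sigma> w u"
      by (simp only: H2_star_inner_commute[of l \<sigma> w])
    then have eq: "(LINT z|on_plate l. v z * (sin (real i * fst z) * exp ((real k + 1 / 2) * snd z))) =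
        (LINT z|on_plate l. u z * (sin (real i * fst z) * exp ((real k + 1 / 2) * snd z)))"
      by (simp only: bspec[OF w(2) uv(1)] bspec[OF w(2) uv(2)])
    have "H z * (sin (real i * fst z) * exp (real k * snd z)) =
        v z * (sin (real i * fst z) * exp ((real k + 1 / 2) * snd z)) - u z * (sin (real i * fst z) * exp ((real k + 1 / 2) * snd z))" for z
    proof -
      have "exp ((real k + 1 / 2) * snd z) = exp (1 / 2 * snd z) * exp (real k * snd z)"
        by (simp add: exp_add[symmetric] algebra_simps)
      then show ?thesis unfolding H_def by (simp only:) (simp add: algebra_simps)
    qed
    then have "(LINT z|on_plate l. H z * (sin (real i * fst z) * exp (real k * snd z))) =
        (LINT z|on_plate l. v z * (sin (real i * fst z) * exp ((real k + 1 / 2) * snd z)) -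
          u z * (sin (real i * fst z) * exp ((real k + 1 / 2) * snd z)))"
      by (simp only:)
    also have "\<dots> = (LINT z|on_plate l. v z * (sin (real i * fst z) * exp ((real k + 1 / 2) * snd z))) -
        (LINT z|on_plate l. u z * (sin (real i * fst z) * exp ((real k + 1 / 2) * snd z)))"
      by (intro Bochner_Integration.integral_diff continuous_integrable_plate[OF l] continuous_on_mult c continuous_on_plate_elementary)
    finally show "(LINT z|on_plate l. H z * (sin (real i * fst z) * exp (real k * snd z))) = 0" using eq by simp
  qed
  then have "H z = 0" by (rule sine_exp_complete[OF l Hc _ z])
  then show ?thesis by (simp add: H_def)
qed

section \<open>Existence of the solution and its series representation\<close>

lemma linear_equation_scale:
  fixes x y a d r r' c :: real
  assumes "x * a + y * d = r" "r' = c * r"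
  shows "x * (c * a) + y * (c * d) = r'"
  unfolding assms(2) assms(1)[symmetric] by (simp add: algebra_simps)

lemma system_AD_scale:
  "system_AD l \<sigma> \<alpha> \<gamma> k a d \<Longrightarrow> system_AD l \<sigma> \<alpha> (\<lambda>k. c * \<gamma> k) k (c * a) (c * d)"
  unfolding system_AD_def Let_def
  by (elim conjE, intro conjI) (erule linear_equation_scale, simp (no_asm) add: mult_ac)+

lemma system_BC_scale:
  "system_BC l \<sigma> \<alpha> \<gamma> k b d \<Longrightarrow> system_BC l \<sigma> \<alpha> (\<lambda>k. c * \<gamma> k) k (c * b) (c * d)"
  unfolding system_BC_def Let_def
  by (elim conjE, intro conjI) (erule linear_equation_scale, simp (no_asm) add: mult_ac)+

lemma series_solution:
  assumes l: "l > 0" and \<sigma>: "0 < \<sigma>" "\<sigma> < 1" and \<alpha>: "\<alpha> \<ge> 0" "\<alpha> \<notin> real ` {1..}" and g: "g \<in> L2 {0<..<pi}"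
    and AD: "\<And>m. m \<ge> 1 \<Longrightarrow> system_AD l \<sigma> \<alpha> (sine_coeff g) m (A m) (D m)"
    and BC: "\<And>m. m \<ge> 1 \<Longrightarrow> system_BC l \<sigma> \<alpha> (sine_coeff g) m (B m) (C m)"
  obtains u where "plate_solution l \<sigma> (load l \<alpha> g) u"
    "\<forall>x y. (x, y) \<in> closure (plate l) \<longrightarrow> summable (\<lambda>n. series_term \<alpha> (sine_coeff g) A B C D x y (Suc n)) \<and>
      u (x, y) = load_const l \<alpha> g * (\<Sum>n. series_term \<alpha> (sine_coeff g) A B C D x y (Suc n))"
proof -
  define K where "K = load_const l \<alpha> g"
  define \<gamma> where "\<gamma> = sine_coeff g"
  define G where "G = (\<lambda>n. \<gamma> (Suc n) / ((real (Suc n))\<^sup>2 - \<alpha>\<^sup>2)\<^sup>2)"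
  define p where "p = (\<lambda>n. profile \<alpha> (real (Suc n)) (G n) (A (Suc n)) (B (Suc n)) (C (Suc n)) (D (Suc n)))"
  define p' where "p' = (\<lambda>n. profile \<alpha> (real (Suc n)) (K * \<gamma> (Suc n) / ((real (Suc n))\<^sup>2 - \<alpha>\<^sup>2)\<^sup>2)
    (K * A (Suc n)) (K * B (Suc n)) (K * C (Suc n)) (K * D (Suc n)))"
  have sum: "summable (\<lambda>n. (\<gamma> (Suc n))\<^sup>2)" unfolding \<gamma>_def by (rule bessel_summable[OF g])
  have AD1: "system_AD l \<sigma> \<alpha> \<gamma> (Suc n) (A (Suc n)) (D (Suc n))" and BC1: "system_BC l \<sigma> \<alpha> \<gamma> (Suc n) (B (Suc n)) (C (Suc n))" for n
    unfolding \<gamma>_def by (rule AD BC; simp)+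
  note AD2 = system_AD_scale[OF AD1, of K] and BC2 = system_BC_scale[OF BC1, of K]
  \<comment> \<open>Two mode series are set up: the one scaled by \<open>K\<close> solves the
    problem, the unscaled one gives the summability of the bare series without dividing by
    \<open>K\<close>.\<close>
  obtain Mb where "mode_series l p Mb"
    using profile_mode_series[OF l \<sigma> \<alpha> sum AD1 BC1] unfolding p_def G_def by blast
  then interpret P: mode_series l p Mb .
  have sum': "summable (\<lambda>n. (K * \<gamma> (Suc n))\<^sup>2)" using summable_mult[OF sum, of "K\<^sup>2"] by (simp add: power_mult_distrib)
  obtain Mb' where "mode_series l p' Mb'"
    using profile_mode_series[OF l \<sigma> \<alpha> sum' AD2 BC2] unfolding p'_def by blast
  then interpret P': mode_series l p' Mb' .
  obtain K0 where K0: "\<And>k. k \<ge> 1 \<Longrightarrow> ((real k)\<^sup>2 - \<alpha>\<^sup>2)\<^sup>2 > 0 \<and> 1 / ((real k)\<^sup>2 - \<alpha>\<^sup>2)\<^sup>2 \<le> K0 / real k ^ 4"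
    using resonance_bound[OF \<alpha>] by blast
  have "plate_solution l \<sigma> (load l \<alpha> g) (P'.total 0 0)"
    unfolding plate_solution_def
  proof (intro conjI ballI P'.total_H2_star)
    fix v assume v: "v \<in> H2_star l"
    have "(\<lambda>n. LINT z|on_plate l. v z * (sin (real (Suc n) * fst z) * (K * \<gamma> (Suc n) * exp (\<alpha> * snd z)))) sums
        H2_star_inner l \<sigma> (P'.total 0 0) v"
    proof (rule P'.inner_total_sums[OF v])
      fix n y
      show "y = l \<or> y = -l \<Longrightarrow> deriv (deriv (p' n)) y = \<sigma> * (real (Suc n))\<^sup>2 * p' n y"
        unfolding p'_def by (rule profile_boundary_conditions(1)[OF AD2 BC2])
      show "y = l \<or> y = -l \<Longrightarrow> deriv (deriv (deriv (p' n))) y = (2 - \<sigma>) * (real (Suc n))\<^sup>2 * deriv (p' n) y"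
        unfolding p'_def by (rule profile_boundary_conditions(2)[OF AD2 BC2])
      have "((real (Suc n))\<^sup>2 - \<alpha>\<^sup>2)\<^sup>2 \<noteq> 0" using K0[of "Suc n"] by simp
      then show "deriv (deriv (deriv (deriv (p' n)))) y - 2 * (real (Suc n))\<^sup>2 * deriv (deriv (p' n)) y
          + (real (Suc n)) ^ 4 * p' n y = K * \<gamma> (Suc n) * exp (\<alpha> * y)"
        unfolding p'_def profile_equation by simp
    qed
    moreover have "(\<lambda>n. K * (sine_coeff g (Suc n) * (LINT z|on_plate l. exp (\<alpha> * snd z) * sin (real (Suc n) * fst z) * v z))) sums
        (K * (LINT z|on_plate l. exp (\<alpha> * snd z) * g (fst z) * v z))"
      by (intro sums_mult sine_series_against_continuous[OF g l] H2_star_D[OF v]) (simp add: H2_star_zero_sides[OF l v])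
    moreover have "(LINT z|on_plate l. v z * (sin (real (Suc n) * fst z) * (K * \<gamma> (Suc n) * exp (\<alpha> * snd z)))) =
        K * (sine_coeff g (Suc n) * (LINT z|on_plate l. exp (\<alpha> * snd z) * sin (real (Suc n) * fst z) * v z))" for n
    proof -
      have "(LINT z|on_plate l. v z * (sin (real (Suc n) * fst z) * (K * \<gamma> (Suc n) * exp (\<alpha> * snd z)))) =
          (LINT z|on_plate l. K * \<gamma> (Suc n) * (exp (\<alpha> * snd z) * sin (real (Suc n) * fst z) * v z))"
        by (rule Bochner_Integration.integral_cong) (simp_all add: mult_ac)
      then show ?thesis by (simp add: \<gamma>_def mult.assoc)
    qed
    moreover have "K * (LINT z|on_plate l. exp (\<alpha> * snd z) * g (fst z) * v z) = (LINT z|on_plate l. load l \<alpha> g z * v z)"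
    proof -
      have "(LINT z|on_plate l. load l \<alpha> g z * v z) = (LINT z|on_plate l. K * (exp (\<alpha> * snd z) * g (fst z) * v z))"
        by (rule Bochner_Integration.integral_cong) (simp_all add: load_def K_def case_prod_unfold)
      then show ?thesis by simp
    qed
    ultimately show "H2_star_inner l \<sigma> (P'.total 0 0) v = (LINT z|on_plate l. load l \<alpha> g z * v z)"
      by (simp only: sums_unique2)
  qed
  moreover have "summable (\<lambda>n. series_term \<alpha> (sine_coeff g) A B C D x y (Suc n)) \<and>
      P'.total 0 0 (x, y) = load_const l \<alpha> g * (\<Sum>n. series_term \<alpha> (sine_coeff g) A B C D x y (Suc n))"
    if xy: "(x, y) \<in> closure (plate l)" for x y
  proof -
    have t: "mode p 0 0 n (x, y) = series_term \<alpha> (sine_coeff g) A B C D x y (Suc n)" for n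
      unfolding mode_simps tensor_def p_def profile_def series_term_def Let_def G_def \<gamma>_def by (simp add: mult_ac)
    have t': "mode p' 0 0 n (x, y) = K * series_term \<alpha> (sine_coeff g) A B C D x y (Suc n)" for n
      unfolding mode_simps tensor_def p'_def profile_def series_term_def Let_def \<gamma>_def by (simp add: algebra_simps)
    have s: "(\<lambda>n. series_term \<alpha> (sine_coeff g) A B C D x y (Suc n)) sums P.total 0 0 (x, y)"
      using P.mode_sums[of 0 0, OF _ xy] unfolding t by simp
    have s': "(\<lambda>n. K * series_term \<alpha> (sine_coeff g) A B C D x y (Suc n)) sums P'.total 0 0 (x, y)"
      using P'.mode_sums[of 0 0, OF _ xy] unfolding t' by simp
    have "P'.total 0 0 (x, y) = K * P.total 0 0 (x, y)"
      by (rule sums_unique2[OF s' sums_mult[OF s]])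
    then show ?thesis using s by (simp add: sums_iff K_def)
  qed
  ultimately show ?thesis by (intro that[of "P'.total 0 0"]) auto
qed

theorem theorem1:
  fixes l \<sigma> \<alpha> :: real and g :: "real \<Rightarrow> real"
  assumes "l > 0" and "0 < \<sigma>" and "\<sigma> < 1"
    and "\<alpha> \<ge> 0" and "\<alpha> \<notin> real ` {1..}"
    and "g \<in> L2 {0<..<pi}"
    and "\<not> (AE x in lebesgue_on {0<..<pi}. g x = 0)"
  shows "(\<forall>m\<ge>1. \<exists>!(a, d). system_AD l \<sigma> \<alpha> (sine_coeff g) m a d) \<and>
    (\<forall>m\<ge>1. \<exists>!(b, c). system_BC l \<sigma> \<alpha> (sine_coeff g) m b c) \<and>
    (\<exists>u. plate_solution l \<sigma> (load l \<alpha> g) u \<and>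
      (\<forall>v. plate_solution l \<sigma> (load l \<alpha> g) v \<longrightarrow> (\<forall>z\<in>closure (plate l). v z = u z)) \<and>
      (\<forall>A B C D.
        (\<forall>m\<ge>1. system_AD l \<sigma> \<alpha> (sine_coeff g) m (A m) (D m) \<and>
                system_BC l \<sigma> \<alpha> (sine_coeff g) m (B m) (C m)) \<longrightarrow>
        (\<forall>(x, y)\<in>closure (plate l).
          summable (\<lambda>n. series_term \<alpha> (sine_coeff g) A B C D x y (Suc n)) \<and>
          u (x, y) = load_const l \<alpha> g *
            (\<Sum>n. series_term \<alpha> (sine_coeff g) A B C D x y (Suc n)))))"
proof -
  have AD: "\<exists>!(a, d). system_AD l \<sigma> \<alpha> (sine_coeff g) m a d" if "m \<ge> 1" for m
    by (rule system_AD_ex1[OF assms(1-3) that])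
  have BC: "\<exists>!(b, c). system_BC l \<sigma> \<alpha> (sine_coeff g) m b c" if "m \<ge> 1" for m
    by (rule system_BC_ex1[OF assms(1-3) that])
  have "\<forall>m\<in>{1..}. \<exists>ad. system_AD l \<sigma> \<alpha> (sine_coeff g) m (fst ad) (snd ad)"
    using ex1_implies_ex[OF AD] by (simp add: case_prod_unfold)
  then obtain ad where ad: "\<And>m. m \<ge> 1 \<Longrightarrow> system_AD l \<sigma> \<alpha> (sine_coeff g) m (fst (ad m)) (snd (ad m))"
    using bchoice[of "{1..}"] by (metis atLeast_iff)
  have "\<forall>m\<in>{1..}. \<exists>bc. system_BC l \<sigma> \<alpha> (sine_coeff g) m (fst bc) (snd bc)"
    using ex1_implies_ex[OF BC] by (simp add: case_prod_unfold)
  then obtain bc where bc: "\<And>m. m \<ge> 1 \<Longrightarrow> system_BC l \<sigma> \<alpha> (sine_coeff g) m (fst (bc m)) (snd (bc m))"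
    using bchoice[of "{1..}"] by (metis atLeast_iff)
  obtain u where u: "plate_solution l \<sigma> (load l \<alpha> g) u"
    by (rule series_solution[OF assms(1-6) ad bc])
  have unique: "v z = u z" if "plate_solution l \<sigma> (load l \<alpha> g) v" "z \<in> closure (plate l)" for v z
    by (rule plate_solution_unique[OF assms(1-3) u that])
  have series: "summable (\<lambda>n. series_term \<alpha> (sine_coeff g) A B C D x y (Suc n)) \<and>
      u (x, y) = load_const l \<alpha> g * (\<Sum>n. series_term \<alpha> (sine_coeff g) A B C D x y (Suc n))"
    if sys: "\<forall>m\<ge>1. system_AD l \<sigma> \<alpha> (sine_coeff g) m (A m) (D m) \<and> system_BC l \<sigma> \<alpha> (sine_coeff g) m (B m) (C m)"
      and xy: "(x, y) \<in> closure (plate l)" for A B C D x y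
  proof -
    have s: "\<And>m. m \<ge> 1 \<Longrightarrow> system_AD l \<sigma> \<alpha> (sine_coeff g) m (A m) (D m)"
      "\<And>m. m \<ge> 1 \<Longrightarrow> system_BC l \<sigma> \<alpha> (sine_coeff g) m (B m) (C m)"
      using sys by auto
    \<comment> \<open>Any admissible coefficients yield a solution of their own, represented by the
      corresponding series; by uniqueness it equals the solution \<open>u\<close> fixed before, so
      \<open>u\<close> does not depend on them.\<close>
    obtain v where v: "plate_solution l \<sigma> (load l \<alpha> g) v"
      "\<forall>x y. (x, y) \<in> closure (plate l) \<longrightarrow> summable (\<lambda>n. series_term \<alpha> (sine_coeff g) A B C D x y (Suc n)) \<and>
        v (x, y) = load_const l \<alpha> g * (\<Sum>n. series_term \<alpha> (sine_coeff g) A B C D x y (Suc n))"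
      by (rule series_solution[OF assms(1-6) s])
    then show ?thesis using unique[OF v(1) xy] xy by simp
  qed
  show ?thesis
  proof (intro conjI exI[of _ u] allI impI ballI u)
    fix A B C D z
    assume "\<forall>m\<ge>1. system_AD l \<sigma> \<alpha> (sine_coeff g) m (A m) (D m) \<and> system_BC l \<sigma> \<alpha> (sine_coeff g) m (B m) (C m)"
      and "z \<in> closure (plate l)"
    then show "case z of (x, y) \<Rightarrow> summable (\<lambda>n. series_term \<alpha> (sine_coeff g) A B C D x y (Suc n)) \<and>
        u (x, y) = load_const l \<alpha> g * (\<Sum>n. series_term \<alpha> (sine_coeff g) A B C D x y (Suc n))"
      using series by (cases z) simp
  qed (simp_all only: AD BC unique)
qed

end
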